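(* Let $\mathbf U_{\mathbb H}$ be the representation of $G^{\mathbb H}_{\mathrm{aff}}=\mathbb H\rtimes\mathbb H^*$ on the right quaternionic Hilbert space $\mathfrak H_{\mathbb H}=L^2_{\mathbb H}(\mathbb H,d\mathfrak x)$ given by $$(\mathbf U_{\mathbb H}(\mathfrak b,\mathfrak a)\mathfrak f)(\mathfrak x)=\frac{1}{|\mathfrak a|^{2}}\,\mathfrak f\big(\mathfrak a^{-1}(\mathfrak x-\mathfrak b)\big).$$ Let $\mathfrak f,\mathfrak f'\in\mathfrak H_{\mathbb H}$ be two admissible vectors, with complex component functions $(f_1,f_2)$ and $(f_1',f_2')$ respectively. Then, in the weak sense, $$\int_{G^{\mathbb H}_{\mathrm{aff}}}\big|\mathbf U_{\mathbb H}(\mathfrak b,\mathfrak a)\mathfrak f\big)\big(\mathbf U_{\mathbb H}(\mathfrak b,\mathfrak a)\mathfrak f'\big|\;d\mu_\ell(\mathfrak b,\mathfrak a)=\mathfrak q\,I_{\mathfrak H_{\mathbb H}},$$ i.e. for all $\mathfrak g,\mathfrak h\in\mathfrak H_{\mathbb H}$, $$\int_{G^{\mathbb H}_{\mathrm{aff}}}(\mathfrak g\mid\mathbf U_{\mathbb H}(\mathfrak b,\mathfrak a)\mathfrak f)\,(\mathbf U_{\mathbb H}(\mathfrak b,\mathfrak a)\mathfrak f'\mid\mathfrak h)\,d\mu_\ell(\mathfrak b,\mathfrak a)=(\mathfrak g\mid\mathfrak q\,\mathfrak h),$$ where $\mathfrak q$ acts on $\mathfrak H_{\mathbb H}$ by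 multiplication from the left, $(\mathfrak q\mathfrak h)(\mathfrak x)=\mathfrak q\,\mathfrak h(\mathfrak x)$, by the quaternion $$\mathfrak q=\begin{pmatrix}\langle Cf_1'\mid Cf_1\rangle+\langle\overline{Cf_2'}\mid\overline{Cf_2}\rangle & \langle Cf_2'\mid Cf_1\rangle-\langle\overline{Cf_1'}\mid\overline{Cf_2}\rangle\\ \langle Cf_1'\mid Cf_2\rangle-\langle\overline{Cf_2'}\mid\overline{Cf_1}\rangle & \langle\overline{Cf_1'}\mid\overline{Cf_1}\rangle+\langle Cf_2'\mid Cf_2\rangle\end{pmatrix}.$$ In particular, for every nonzero admissible $\mathfrak f$, one has the resolution of the identity $$\big[\|\mathbf C\mathfrak f\|^2_{\mathfrak H_{\mathbb H}}\big]^{-1}\int_{G^{\mathbb H}_{\mathrm{aff}}}\big|\mathbf U_{\mathbb H}(\mathfrak b,\mathfrak a)\mathfrak f\big)\big(\mathbf U_{\mathbb H}(\mathfrak b,\mathfrak a)\mathfrak f\big|\;d\mu_\ell(\mathfrak b,\mathfrak a)=I_{\mathfrak H_{\mathbb H}}.$$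
   Context: $\mathbb H$ is the division algebra of quaternions, $\mathbb H^*$ its multiplicative group of nonzero elements, $|\cdot|$ the quaternionic norm. A quaternion $q_0+q_1\mathbf i+q_2\mathbf j+q_3\mathbf k$ is identified with the $2\times2$ complex matrix $\begin{pmatrix}z_1&-\overline{z_2}\\ z_2&\overline{z_1}\end{pmatrix}$, $z_1=q_0+iq_3$, $z_2=q_2+iq_1$; quaternion multiplication is matrix multiplication, quaternionic conjugation is the matrix adjoint $\dagger$, and real numbers correspond to real multiples of the identity matrix. $\mathbb H$ is identified with $\mathbb R^4$ via real components, and $d\mathfrak x$ is Lebesgue measure on $\mathbb R^4$. The quaternionic affine group $G^{\mathbb H}_{\mathrm{aff}}=\mathbb H\rtimes\mathbb H^*$ is the set of pairs $(\mathfrak b,\mathfrak a)$, $\mathfrak b\in\mathbb H$, $\mathfrak a\in\mathbb H^*$, with product $(\mathfrak b,\mathfrak a)(\mathfrak b',\mathfrak a')=(\mathfrak b+\mathfrak a\mathfrak b',\mathfrak a\mathfrak a')$. Its left Haar measure is normalized as $d\mu_\ell(\mathfrak b,\mathfrak a)=\dfrac{d\mathfrak b\,d\mathfrak a}{|\mathfrak a|^{8}}$, with $d\mathfrak b,d\mathfrak a$ Lebesgue measures on $\mathbb R^4$. $\mathfrak H_{\mathbb H}=L^2_{\mathbb H}(\mathbb H,d\mathfrak x)$ consists of square-integrable functions $\mathfrak f:\mathbb H\to\mathbb H$, written $\mathfrak f(\mathfrak x)=\begin{pmatrix}f_1(\mathfrak x)&-\overline{f_2(\mathfrak x)}\\ f_2(\mathfrak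 x)&\overline{f_1(\mathfrak x)}\end{pmatrix}$ with component functions $f_1,f_2\in\mathfrak K_{\mathbb C}=L^2_{\mathbb C}(\mathbb H,d\mathfrak x)$. It is a right quaternionic Hilbert space with $(\mathfrak f\mathfrak q)(\mathfrak x)=\mathfrak f(\mathfrak x)\mathfrak q$ and inner product $(\mathfrak f\mid\mathfrak f')=\int_{\mathbb H}\mathfrak f(\mathfrak x)^\dagger\mathfrak f'(\mathfrak x)\,d\mathfrak x\in\mathbb H$; $\|\mathfrak f\|^2_{\mathfrak H_{\mathbb H}}=(\mathfrak f\mid\mathfrak f)$, a nonnegative real number. For $\mathfrak f,\mathfrak f'\in\mathfrak H_{\mathbb H}$, $|\mathfrak f)(\mathfrak f'|$ is the rank-one operator $\mathfrak h\mapsto\mathfrak f\,(\mathfrak f'\mid\mathfrak h)$. $\langle\cdot\mid\cdot\rangle$ is the inner product of $\mathfrak K_{\mathbb C}$, conjugate-linear in the first variable. $C$ is the operator on $\mathfrak K_{\mathbb C}$ given in the Fourier domain by $(\widehat{Cf})(\mathfrak k)=\left[\frac{2\pi}{|\mathfrak k|}\right]^2\widehat f(\mathfrak k)$, with domain all $f\in\mathfrak K_{\mathbb C}$ such that $(2\pi)^4\int_{\mathbb R^4}|\widehat f(\mathfrak k)|^2|\mathfrak k|^{-4}\,d\mathfrak k<\infty$, where $\widehat f$ is the unitary Fourier transform on $L^2(\mathbb R^4)$, $\widehat f(\mathfrak k)=(2\pi)^{-2}\int e^{-i\mathfrak k\cdot\mathfrak x}f(\mathfrak x)\,d\mathfrak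 x$. The operator $\mathbf C$ on $\mathfrak H_{\mathbb H}$ is $(\mathbf C\mathfrak f)(\mathfrak x)=\begin{pmatrix}(Cf_1)(\mathfrak x)&-\overline{(Cf_2)(\mathfrak x)}\\ (Cf_2)(\mathfrak x)&\overline{(Cf_1)(\mathfrak x)}\end{pmatrix}$. A vector $\mathfrak f\in\mathfrak H_{\mathbb H}$ is admissible if it is in the domain of $\mathbf C$, i.e. both $f_1$ and $f_2$ are in the domain of $C$. *)

theory Defs
  imports "HOL-Analysis.Analysis"
begin

section \<open>Quaternions\<close>

datatype quat = Quat (QRe: real) (QIm1: real) (QIm2: real) (QIm3: real)

lemma quat_eq_iff:
  "p = q \<longleftrightarrow> QRe p = QRe q \<and> QIm1 p = QIm1 q \<and> QIm2 p = QIm2 q \<and> QIm3 p = QIm3 q"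
  by (cases p; cases q) simp

instantiation quat :: ring_1
begin

definition zero_quat :: quat where "0 = Quat 0 0 0 0"

definition one_quat :: quat where "1 = Quat 1 0 0 0"

definition plus_quat :: "quat \<Rightarrow> quat \<Rightarrow> quat" where
  "p + q = Quat (QRe p + QRe q) (QIm1 p + QIm1 q) (QIm2 p + QIm2 q) (QIm3 p + QIm3 q)"

definition minus_quat :: "quat \<Rightarrow> quat \<Rightarrow> quat" where
  "p - q = Quat (QRe p - QRe q) (QIm1 p - QIm1 q) (QIm2 p - QIm2 q) (QIm3 p - QIm3 q)"

definition uminus_quat :: "quat \<Rightarrow> quat" where
  "- p = Quat (- QRe p) (- QIm1 p) (- QIm2 p) (- QIm3 p)"

definition times_quat :: "quat \<Rightarrow> quat \<Rightarrow> quat" where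
  "p * q = Quat
    (QRe p * QRe q - QIm1 p * QIm1 q - QIm2 p * QIm2 q - QIm3 p * QIm3 q)
    (QRe p * QIm1 q + QIm1 p * QRe q + QIm2 p * QIm3 q - QIm3 p * QIm2 q)
    (QRe p * QIm2 q - QIm1 p * QIm3 q + QIm2 p * QRe q + QIm3 p * QIm1 q)
    (QRe p * QIm3 q + QIm1 p * QIm2 q - QIm2 p * QIm1 q + QIm3 p * QRe q)"

instance
  by standard
    (simp_all add: quat_eq_iff zero_quat_def one_quat_def plus_quat_def minus_quat_def
      uminus_quat_def times_quat_def algebra_simps)

end

lemma quat_sel [simp]:
  "QRe 0 = 0" "QIm1 0 = 0" "QIm2 0 = 0" "QIm3 0 = 0"
  "QRe 1 = 1" "QIm1 1 = 0" "QIm2 1 = 0" "QIm3 1 = 0"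
  "QRe (p + q) = QRe p + QRe q" "QIm1 (p + q) = QIm1 p + QIm1 q"
  "QIm2 (p + q) = QIm2 p + QIm2 q" "QIm3 (p + q) = QIm3 p + QIm3 q"
  "QRe (p - q) = QRe p - QRe q" "QIm1 (p - q) = QIm1 p - QIm1 q"
  "QIm2 (p - q) = QIm2 p - QIm2 q" "QIm3 (p - q) = QIm3 p - QIm3 q"
  "QRe (- p) = - QRe p" "QIm1 (- p) = - QIm1 p"
  "QIm2 (- p) = - QIm2 p" "QIm3 (- p) = - QIm3 p"
  by (simp_all add: zero_quat_def one_quat_def plus_quat_def minus_quat_def uminus_quat_def)

instantiation quat :: real_algebra_1
begin

definition scaleR_quat :: "real \<Rightarrow> quat \<Rightarrow> quat" where
  "scaleR r q = Quat (r * QRe q) (r * QIm1 q) (r * QIm2 q) (r * QIm3 q)"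

instance
  by standard (simp_all add: quat_eq_iff scaleR_quat_def times_quat_def algebra_simps)

end

lemma quat_sel_scaleR [simp]:
  "QRe (r *\<^sub>R q) = r * QRe q" "QIm1 (r *\<^sub>R q) = r * QIm1 q"
  "QIm2 (r *\<^sub>R q) = r * QIm2 q" "QIm3 (r *\<^sub>R q) = r * QIm3 q"
  by (simp_all add: scaleR_quat_def)

definition qcnj :: "quat \<Rightarrow> quat" where
  "qcnj q = Quat (QRe q) (- QIm1 q) (- QIm2 q) (- QIm3 q)"

instantiation quat :: real_inner
begin

definition inner_quat :: "quat \<Rightarrow> quat \<Rightarrow> real" where
  "inner p q = QRe p * QRe q + QIm1 p * QIm1 q + QIm2 p * QIm2 q + QIm3 p * QIm3 q"

definition norm_quat :: "quat \<Rightarrow> real" where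
  "norm q = sqrt ((QRe q)\<^sup>2 + (QIm1 q)\<^sup>2 + (QIm2 q)\<^sup>2 + (QIm3 q)\<^sup>2)"

definition sgn_quat :: "quat \<Rightarrow> quat" where
  "sgn q = q /\<^sub>R norm q" for q :: quat

definition dist_quat :: "quat \<Rightarrow> quat \<Rightarrow> real" where
  "dist p q = norm (p - q)" for p q :: quat

definition uniformity_quat :: "(quat \<times> quat) filter" where
  "(uniformity :: (quat \<times> quat) filter) = (INF e\<in>{0 <..}. principal {(x, y). dist x y < e})"

definition open_quat :: "quat set \<Rightarrow> bool" where
  "open U \<longleftrightarrow> (\<forall>x\<in>U. eventually (\<lambda>(x', y). x' = x \<longrightarrow> y \<in> U) uniformity)" for U :: "quat set"

instance
proof
  fix x y z :: quat and r :: real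
  show "inner x y = inner y x"
    by (simp add: inner_quat_def mult.commute)
  show "inner (x + y) z = inner x z + inner y z"
    by (simp add: inner_quat_def algebra_simps)
  show "inner (r *\<^sub>R x) y = r * inner x y"
    by (simp add: inner_quat_def algebra_simps)
  show "0 \<le> inner x x"
    by (simp add: inner_quat_def)
  show "inner x x = 0 \<longleftrightarrow> x = 0"
    by (simp add: inner_quat_def quat_eq_iff add_nonneg_eq_0_iff)
  show "norm x = sqrt (inner x x)"
    by (simp add: inner_quat_def norm_quat_def power2_eq_square)
qed (simp_all add: sgn_quat_def dist_quat_def uniformity_quat_def open_quat_def)

end

instantiation quat :: real_normed_div_algebra
begin

definition inverse_quat :: "quat \<Rightarrow> quat" where
  "inverse q = qcnj q /\<^sub>R (norm q)\<^sup>2" for q :: quat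

definition divide_quat :: "quat \<Rightarrow> quat \<Rightarrow> quat" where
  "p div q = p * inverse q" for p q :: quat

instance
proof
  fix x y :: quat
  have nn: "(norm x)\<^sup>2 = QRe x * QRe x + QIm1 x * QIm1 x + QIm2 x * QIm2 x + QIm3 x * QIm3 x"
    by (simp add: norm_quat_def power2_eq_square)
  have l: "qcnj x * x = (norm x)\<^sup>2 *\<^sub>R 1" and r: "x * qcnj x = (norm x)\<^sup>2 *\<^sub>R 1"
    unfolding nn by (simp_all add: quat_eq_iff qcnj_def times_quat_def)
  show "x \<noteq> 0 \<Longrightarrow> inverse x * x = 1" "x \<noteq> 0 \<Longrightarrow> x * inverse x = 1"
    by (simp_all add: inverse_quat_def l r)
  show "x div y = x * inverse y"
    by (simp add: divide_quat_def)
  show "inverse (0::quat) = 0"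
    by (simp add: inverse_quat_def)
  show "norm (x * y) = norm x * norm y"
    unfolding norm_quat_def real_sqrt_mult [symmetric] times_quat_def quat.sel
    by (rule arg_cong [where f = sqrt]) algebra
qed

end

instantiation quat :: euclidean_space
begin

definition Basis_quat :: "quat set" where
  "Basis = {Quat 1 0 0 0, Quat 0 1 0 0, Quat 0 0 1 0, Quat 0 0 0 1}"

instance
proof
  fix u v x :: quat
  show "u \<in> Basis \<Longrightarrow> v \<in> Basis \<Longrightarrow> inner u v = (if u = v then 1 else 0)"
    unfolding Basis_quat_def insert_iff empty_iff by (elim disjE) (simp_all add: inner_quat_def)
  show "(\<forall>u\<in>Basis. inner x u = 0) \<longleftrightarrow> x = 0"
    by (cases x) (simp add: Basis_quat_def inner_quat_def zero_quat_def)
qed (simp_all add: Basis_quat_def)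

end

text \<open>The complex entries and the matrix of a quaternion.\<close>

definition qz1 :: "quat \<Rightarrow> complex" where "qz1 q = Complex (QRe q) (QIm3 q)"

definition qz2 :: "quat \<Rightarrow> complex" where "qz2 q = Complex (QIm2 q) (QIm1 q)"

definition quat_of :: "complex \<Rightarrow> complex \<Rightarrow> quat" where
  "quat_of z1 z2 = Quat (Re z1) (Im z2) (Re z2) (Im z1)"

definition quat_mat :: "quat \<Rightarrow> complex^2^2" where
  "quat_mat q = vector [vector [qz1 q, - cnj (qz2 q)], vector [qz2 q, cnj (qz1 q)]]"

lemma quat_of_inverse [simp]:
  "qz1 (quat_of z1 z2) = z1" "qz2 (quat_of z1 z2) = z2" "quat_of (qz1 q) (qz2 q) = q"
  by (simp_all add: qz1_def qz2_def quat_of_def)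

lemma quat_mat_inj: "quat_mat p = quat_mat q \<Longrightarrow> p = q"
  by (auto simp: quat_mat_def vec_eq_iff forall_2 qz1_def qz2_def quat_eq_iff)

lemma quat_mat_mult: "quat_mat (p * q) = quat_mat p ** quat_mat q"
  by (auto simp: quat_mat_def vec_eq_iff forall_2 qz1_def qz2_def matrix_matrix_mult_def sum_2
      times_quat_def complex_eq_iff algebra_simps)

lemma quat_mat_add: "quat_mat (p + q) = quat_mat p + quat_mat q"
  by (auto simp: quat_mat_def vec_eq_iff forall_2 qz1_def qz2_def complex_eq_iff)

lemma quat_mat_of_real: "quat_mat (of_real r) = mat (complex_of_real r)"
  by (auto simp: of_real_def quat_mat_def vec_eq_iff forall_2 qz1_def qz2_def mat_def
      complex_eq_iff)

lemma quat_mat_qcnj: "quat_mat (qcnj q) = (\<chi> i j. cnj (quat_mat q $ j $ i))"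
  by (auto simp: quat_mat_def vec_eq_iff forall_2 qz1_def qz2_def qcnj_def complex_eq_iff)

section \<open>Square-integrable functions\<close>

text \<open>Elements of an \<open>L\<^sup>2\<close> space are represented by functions, not by classes modulo null sets.
  With \<open>'b = complex\<close> this is the complex Hilbert space, with \<open>'b = quat\<close> the right quaternionic
  one.\<close>

definition L2 :: "(quat \<Rightarrow> 'b::real_normed_vector) set" where
  "L2 = {f. f \<in> borel_measurable lebesgue \<and> integrable lebesgue (\<lambda>x. (norm (f x))\<^sup>2)}"

definition cip :: "(quat \<Rightarrow> complex) \<Rightarrow> (quat \<Rightarrow> complex) \<Rightarrow> complex" where
  "cip f g = (LINT x|lebesgue. cnj (f x) * g x)"

definition qip :: "(quat \<Rightarrow> quat) \<Rightarrow> (quat \<Rightarrow> quat) \<Rightarrow> quat" where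
  "qip f g = (LINT x|lebesgue. qcnj (f x) * g x)"

definition qnorm :: "(quat \<Rightarrow> quat) \<Rightarrow> real" where
  "qnorm f = sqrt (QRe (qip f f))"

definition comp1 :: "(quat \<Rightarrow> quat) \<Rightarrow> quat \<Rightarrow> complex" where "comp1 f x = qz1 (f x)"

definition comp2 :: "(quat \<Rightarrow> quat) \<Rightarrow> quat \<Rightarrow> complex" where "comp2 f x = qz2 (f x)"

definition rank_one :: "(quat \<Rightarrow> quat) \<Rightarrow> (quat \<Rightarrow> quat) \<Rightarrow> (quat \<Rightarrow> quat) \<Rightarrow> quat \<Rightarrow> quat" where
  "rank_one f f' h = (\<lambda>x. f x * qip f' h)"

section \<open>The unitary Fourier transform and the operator \<open>C\<close>\<close>

definition fourier_L1 :: "(quat \<Rightarrow> complex) \<Rightarrow> quat \<Rightarrow> complex" where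
  "fourier_L1 f k =
     complex_of_real (1 / (2 * pi)\<^sup>2) * (LINT x|lebesgue. exp (- \<i> * complex_of_real (k \<bullet> x)) * f x)"

text \<open>Unitary extension from \<open>L\<^sup>1 \<inter> L\<^sup>2\<close> to \<open>L\<^sup>2\<close> by continuity. It is determined up to null sets,
  so a representative is chosen; likewise for \<open>Cop\<close> below.\<close>

definition is_fourier_L2 :: "(quat \<Rightarrow> complex) \<Rightarrow> (quat \<Rightarrow> complex) \<Rightarrow> bool" where
  "is_fourier_L2 f F \<longleftrightarrow> F \<in> L2 \<and>
     (\<exists>\<phi>. (\<forall>n. \<phi> n \<in> L2 \<and> integrable lebesgue (\<phi> n)) \<and>
       (\<lambda>n::nat. \<integral>\<^sup>+x. ennreal ((norm (\<phi> n x - f x))\<^sup>2) \<partial>lebesgue) \<longlonglongrightarrow> 0 \<and>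
       (\<lambda>n. \<integral>\<^sup>+k. ennreal ((norm (fourier_L1 (\<phi> n) k - F k))\<^sup>2) \<partial>lebesgue) \<longlonglongrightarrow> 0)"

definition fourier_L2 :: "(quat \<Rightarrow> complex) \<Rightarrow> quat \<Rightarrow> complex" where
  "fourier_L2 f = (SOME F. is_fourier_L2 f F)"

definition C_domain :: "(quat \<Rightarrow> complex) set" where
  "C_domain = {f \<in> L2.
     ennreal ((2 * pi) ^ 4) * (\<integral>\<^sup>+k. ennreal ((norm (fourier_L2 f k))\<^sup>2 / norm k ^ 4) \<partial>lebesgue) < \<infinity>}"

definition Cop :: "(quat \<Rightarrow> complex) \<Rightarrow> quat \<Rightarrow> complex" where
  "Cop f = (SOME g. g \<in> L2 \<and>
     (AE k in lebesgue.
        fourier_L2 g k = complex_of_real ((2 * pi / norm k)\<^sup>2) * fourier_L2 f k))"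

definition bold_C :: "(quat \<Rightarrow> quat) \<Rightarrow> quat \<Rightarrow> quat" where
  "bold_C f x = quat_of (Cop (comp1 f) x) (Cop (comp2 f) x)"

definition admissible :: "(quat \<Rightarrow> quat) \<Rightarrow> bool" where
  "admissible f \<longleftrightarrow> f \<in> L2 \<and> comp1 f \<in> C_domain \<and> comp2 f \<in> C_domain"

section \<open>The quaternionic affine group and its representation\<close>

definition Gaff :: "(quat \<times> quat) set" where
  "Gaff = UNIV \<times> (- {0})"

definition aff_mult :: "quat \<times> quat \<Rightarrow> quat \<times> quat \<Rightarrow> quat \<times> quat" where
  "aff_mult p p' = (fst p + snd p * fst p', snd p * snd p')"

definition haar_left :: "(quat \<times> quat) measure" where
  "haar_left = density (restrict_space (lborel \<Otimes>\<^sub>M lborel) Gaff) (\<lambda>(b, a). ennreal (1 / norm a ^ 8))"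

definition U :: "quat \<times> quat \<Rightarrow> (quat \<Rightarrow> quat) \<Rightarrow> quat \<Rightarrow> quat" where
  "U p f = (\<lambda>x. (1 / (norm (snd p))\<^sup>2) *\<^sub>R f (inverse (snd p) * (x - fst p)))"

lemma U_hom:
  assumes "p \<in> Gaff" "p' \<in> Gaff"
  shows "U (aff_mult p p') f = U p (U p' f)"
proof
  fix x
  obtain b a b' a' where p: "p = (b, a)" "p' = (b', a')" by (cases p; cases p') auto
  have a: "a \<noteq> 0" "a' \<noteq> 0" using assms by (auto simp: p Gaff_def)
  have "inverse (a * a') * (x - (b + a * b')) = inverse a' * (inverse a * (x - b) - b')"
    using a by (simp add: nonzero_inverse_mult_distrib mult.assoc algebra_simps)
      (simp add: mult.assoc [symmetric])
  then show "U (aff_mult p p') f x = U p (U p' f) x"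
    by (simp add: U_def aff_mult_def p norm_mult power_mult_distrib mult.commute)
qed

end

(* The representation acts on the components f1, f2 through the affine representation on complex
   L^2(R^4), and the quaternionic coefficients are combinations of complex ones, so everything
   reduces to the complex orthogonality relation
     integral <g|U f> <U f'|h> = <C f'|C f> <g|h>.
   On the Fourier side <g|U(b,a) f> is, up to (2 pi)^2, the Fourier transform at b of
   k |-> |a|^2 cnj(ghat k) fhat(cnj(a) k).  Plancherel in b, Fubini, and the fact that a |-> cnj(a) k
   is |k| times an isometry, so that da/|a|^4 is carried to itself, give the product formula.

   Plancherel on the intersection of L^1 and L^2: the transform of the autocorrelation of phi is
   (2 pi)^2 |phihat|^2; pair it with a dilated Gaussian, which is its own transform, by the
   multiplication formula, and let the dilation tend to 0. *)

theory Submission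
  imports Defs "HOL-Probability.Characteristic_Functions"
begin

section \<open>Change of variables under similarities\<close>

text \<open>Elements of L^2 are Lebesgue measurable functions, and \<open>fourier_L2\<close> and
  \<open>Cop\<close> are chosen representatives. Hence the transform is handled as a relation,
  \<open>is_fourier_L2\<close>, that is stable under changes on null sets, and integration over the
  group goes through Borel representatives. Plancherel in b needs the kernel in L^1 and L^2 at once:
  it lies in L^1 for every a \<noteq> 0 by Cauchy-Schwarz, but in L^2 only for almost every a, and
  this is where admissibility enters. The two kernels contribute |a|^4 against the Haar density
  |a|^(-8); what is left is da/|a|^4, the source of the weight |k|^(-4) in \<open>C_domain\<close>.
  The constant (2 pi)^4 collects the factors (2 pi)^2 of the two coefficients. Conjugates produced
  by quaternion multiplication are moved onto g and h, which are arbitrary, so that the complex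
  relation is only applied to the components of f and f', whose admissibility is assumed.\<close>

lemma linear_borel_measurable:
  fixes f :: "'a::euclidean_space \<Rightarrow> 'b::real_normed_vector"
  assumes "linear f" shows "f \<in> borel_measurable borel"
  using assms by (intro borel_measurable_continuous_onI linear_continuous_on)
    (simp add: linear_conv_bounded_linear)

text \<open>The preimage of a box is its image under the inverse map, which is again orthogonal and
  therefore preserves the measure of the box; agreement on boxes determines
  \<open>lborel\<close>.\<close>

lemma distr_orthogonal_lborel_vec:
  fixes T :: "real^'n::{finite,wellorder} \<Rightarrow> real^'n::_"
  assumes T: "orthogonal_transformation T"
  shows "distr lborel borel T = lborel"
proof (rule lborel_eqI[symmetric])
  have [measurable]: "T \<in> borel_measurable borel"
    using T by (intro linear_borel_measurable orthogonal_transformation_linear)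
  fix l u :: "(real,'n) vec" assume le: "\<And>b. b \<in> Basis \<Longrightarrow> l \<bullet> b \<le> u \<bullet> b"
  have inv: "orthogonal_transformation (inv T)" using T orthogonal_transformation_inv by blast
  have v: "T -` box l u = inv T ` box l u"
    using T by (simp add: bij_vimage_eq_inv_image orthogonal_transformation_bij)
  have lm: "inv T ` box l u \<in> lmeasurable"
    by (rule measurable_orthogonal_image[OF inv]) simp
  have b: "T -` box l u \<in> sets borel"
    using measurable_sets_borel[OF \<open>T \<in> borel_measurable borel\<close>, of "box l u"] by simp
  have "emeasure (distr lborel borel T) (box l u) = emeasure lborel (T -` box l u)"
    by (simp add: emeasure_distr)
  also have "\<dots> = emeasure lebesgue (inv T ` box l u)"
    using b by (simp add: v)
  also have "\<dots> = ennreal (measure lebesgue (inv T ` box l u))"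
    using lm by (rule emeasure_eq_measure2)
  also have "\<dots> = ennreal (measure lebesgue (box l u))"
    by (simp add: measure_orthogonal_image[OF inv])
  also have "\<dots> = emeasure lborel (box l u)"
    by (simp add: emeasure_lborel_box_eq measure_lborel_box_eq)
  also have "\<dots> = (\<Prod>b\<in>Basis. (u - l) \<bullet> b)"
    using le by simp
  finally show "emeasure (distr lborel borel T) (box l u) = ennreal (\<Prod>b\<in>Basis. (u - l) \<bullet> b)" .
qed simp

section \<open>Transport of orthogonal invariance from \<open>real^4\<close> to the
  quaternions\<close>

definition vec_quat :: "real^4 \<Rightarrow> quat" where
  "vec_quat v = Quat (v$1) (v$2) (v$3) (v$4)"

definition quat_vec :: "quat \<Rightarrow> real^4" where
  "quat_vec q = vector [QRe q, QIm1 q, QIm2 q, QIm3 q]"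

lemma vector_4_sel: "vector [a,b,c,d] $ (1::4) = (a::real)" "vector [a,b,c,d] $ (2::4) = b"
  "vector [a,b,c,d] $ (3::4) = c" "vector [a,b,c,d] $ (4::4) = d"
  by (simp_all add: vector_def)

lemma quat_vec_inverse [simp]: "vec_quat (quat_vec q) = q" "quat_vec (vec_quat v) = v"
  by (auto simp: vec_quat_def quat_vec_def vec_eq_iff forall_4 vector_4_sel)

lemma linear_vec_quat: "linear vec_quat" and linear_quat_vec: "linear quat_vec"
  by (auto intro!: linearI simp: vec_quat_def quat_vec_def vec_eq_iff forall_4 quat_eq_iff vector_4_sel)

lemma norm_vec_quat: "norm (vec_quat v) = norm v"
  by (simp add: norm_quat_def vec_quat_def norm_vec_def L2_set_def sum_4)

lemma norm_quat_vec: "norm (quat_vec q) = norm q"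
  using norm_vec_quat[of "quat_vec q"] by simp

lemma prod_Basis_vec4: "(\<Prod>b\<in>Basis. (v::real^4) \<bullet> b) = v$1 * v$2 * v$3 * v$4"
proof -
  have B: "Basis = (\<lambda>i::4. axis i (1::real)) ` UNIV"
    by (auto simp: Basis_vec_def)
  have I: "inj (\<lambda>i::4. axis i (1::real))"
    by (auto simp: inj_on_def axis_eq_axis)
  have "(\<Prod>b\<in>Basis. v \<bullet> b) = (\<Prod>i\<in>UNIV. v \<bullet> axis i 1)"
    unfolding B prod.reindex[OF I] by (simp add: o_def)
  also have "\<dots> = (\<Prod>i\<in>UNIV. v $ i)"
    by (simp add: inner_axis)
  finally have "(\<Prod>b\<in>Basis. v \<bullet> b) = (\<Prod>i\<in>UNIV. v $ i)" .
  then show ?thesis unfolding UNIV_4 by (simp add: mult.assoc)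
qed

lemma prod_Basis_quat: "(\<Prod>b\<in>Basis. f b) = f (Quat 1 0 0 0) * f (Quat 0 1 0 0) * f (Quat 0 0 1 0) * f (Quat 0 0 0 1)"
  for f :: "quat \<Rightarrow> 'a::comm_monoid_mult"
  by (simp add: Basis_quat_def mult.assoc)

lemma ball_Basis_quat: "(\<forall>b\<in>Basis. P b) \<longleftrightarrow> P (Quat 1 0 0 0) \<and> P (Quat 0 1 0 0) \<and> P (Quat 0 0 1 0) \<and> P (Quat 0 0 0 1)"
  by (simp add: Basis_quat_def)

text \<open>Coordinate boxes correspond to coordinate boxes with the same side lengths.\<close>

lemma distr_vec_quat: "distr lborel borel vec_quat = lborel"
proof (rule lborel_eqI[symmetric])
  fix l u :: quat assume le: "\<And>b. b \<in> Basis \<Longrightarrow> l \<bullet> b \<le> u \<bullet> b"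
  have [measurable]: "vec_quat \<in> borel_measurable borel"
    by (rule linear_borel_measurable[OF linear_vec_quat])
  have v: "vec_quat -` box l u = box (quat_vec l) (quat_vec u)"
    by (auto simp: mem_box_cart mem_box ball_Basis_quat inner_quat_def vec_quat_def quat_vec_def forall_4 vector_4_sel)
  have le': "\<forall>b\<in>Basis. quat_vec l \<bullet> b \<le> quat_vec u \<bullet> b"
    using le[of "Quat 1 0 0 0"] le[of "Quat 0 1 0 0"] le[of "Quat 0 0 1 0"] le[of "Quat 0 0 0 1"]
    by (simp add: Basis_vec_def Basis_quat_def inner_quat_def inner_axis UNIV_4 quat_vec_def vector_4_sel)
  have "emeasure (distr lborel borel vec_quat) (box l u) = emeasure lborel (box (quat_vec l) (quat_vec u))"
    by (simp add: emeasure_distr v)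
  also have "\<dots> = ennreal (\<Prod>b\<in>Basis. (quat_vec u - quat_vec l) \<bullet> b)"
    using le' by (intro emeasure_lborel_box) auto
  also have "(\<Prod>b\<in>Basis. (quat_vec u - quat_vec l) \<bullet> b) = (\<Prod>b\<in>Basis. (u - l) \<bullet> b)"
    by (simp only: prod_Basis_vec4 prod_Basis_quat) (simp add: inner_quat_def quat_vec_def vector_4_sel)
  finally show "emeasure (distr lborel borel vec_quat) (box l u) = ennreal (\<Prod>b\<in>Basis. (u - l) \<bullet> b)" .
qed simp

lemma distr_orthogonal_lborel_quat:
  fixes T :: "quat \<Rightarrow> quat"
  assumes T: "linear T" "\<And>x. norm (T x) = norm x"
  shows "distr lborel borel T = lborel"
proof -
  note [measurable] = linear_borel_measurable[OF linear_vec_quat] linear_borel_measurable[OF linear_quat_vec]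
     linear_borel_measurable[OF T(1)]
  let ?S = "\<lambda>v. quat_vec (T (vec_quat v))"
  have "linear ?S"
    using linear_compose[OF linear_compose[OF linear_vec_quat T(1)] linear_quat_vec] by (simp add: o_def)
  then have S: "orthogonal_transformation ?S"
    by (simp add: orthogonal_transformation T norm_vec_quat norm_quat_vec)
  have "distr lborel borel T = distr (distr lborel borel vec_quat) borel T"
    by (simp add: distr_vec_quat)
  also have "\<dots> = distr lborel borel (\<lambda>v. T (vec_quat v))"
    by (subst distr_distr) (auto simp: o_def)
  also have "\<dots> = distr lborel borel (vec_quat \<circ> ?S)"
    by (simp add: o_def)
  also have "\<dots> = distr (distr lborel borel ?S) borel vec_quat"
    by (subst distr_distr) (auto simp: o_def)
  also have "\<dots> = lborel"
    by (simp add: distr_orthogonal_lborel_vec[OF S] distr_vec_quat)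
  finally show ?thesis .
qed

lemma DIM_quat [simp]: "DIM(quat) = 4"
  by (simp add: Basis_quat_def)

text \<open>A similarity is c times a linear isometry, so its Jacobian is c^4, the exponent being
  the real dimension. This covers left multiplications by quaternions, the map a \<mapsto>
  \<open>qcnj a * k\<close> for fixed k, and real dilations.\<close>

lemma lborel_similarity:
  fixes L :: "quat \<Rightarrow> quat"
  assumes L: "linear L" "\<And>x. norm (L x) = c * norm x" and c: "c > 0"
  shows "lborel = density (distr lborel borel (\<lambda>x. t + L x)) (\<lambda>_. ennreal (c^4))"
proof -
  let ?T = "\<lambda>x. (1/c) *\<^sub>R L x"
  note [measurable] = linear_borel_measurable[OF L(1)]
  have "linear ?T" using L(1) by (intro linear_compose_scale_right)
  then have T: "distr lborel borel ?T = lborel"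
    using c by (intro distr_orthogonal_lborel_quat) (auto simp: L(2))
  have "distr lborel borel (\<lambda>x. t + L x) = distr lborel borel ((\<lambda>x. t + c *\<^sub>R x) \<circ> ?T)"
    using c by (simp add: o_def)
  also have "\<dots> = distr (distr lborel borel ?T) borel (\<lambda>x. t + c *\<^sub>R x)"
    by (subst distr_distr) (auto simp: o_def)
  also have "\<dots> = distr lborel borel (\<lambda>x. t + c *\<^sub>R x)"
    by (simp add: T)
  finally show ?thesis
    using lborel_affine[of c t] c by (simp add: ennreal_power)
qed

context
  fixes L :: "quat \<Rightarrow> quat" and c :: real
  assumes L: "linear L" "\<And>x. norm (L x) = c * norm x" and c: "c > 0"
begin

lemma measurable_similarity: "(\<lambda>x. t + L x) \<in> borel_measurable borel"
  using linear_borel_measurable[OF L(1)] by simp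

lemma nn_integral_similarity:
  assumes [measurable]: "f \<in> borel_measurable borel"
  shows "(\<integral>\<^sup>+x. f x \<partial>lborel) = ennreal (c^4) * (\<integral>\<^sup>+x. f (t + L x) \<partial>lborel)"
proof -
  note [measurable] = measurable_similarity
  show ?thesis
    by (subst lborel_similarity[OF L c, of t])
       (simp_all add: nn_integral_density nn_integral_distr nn_integral_cmult)
qed

lemma integrable_similarity_iff:
  fixes f :: "quat \<Rightarrow> 'b::{banach, second_countable_topology}"
  assumes [measurable]: "f \<in> borel_measurable borel"
  shows "integrable lborel (\<lambda>x. f (t + L x)) \<longleftrightarrow> integrable lborel f"
proof -
  note [measurable] = measurable_similarity
  have "(\<integral>\<^sup>+x. norm (f x) \<partial>lborel) < \<infinity> \<longleftrightarrow> (\<integral>\<^sup>+x. norm (f (t + L x)) \<partial>lborel) < \<infinity>"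
    using c by (subst nn_integral_similarity[where t=t]) (auto simp: ennreal_mult_less_top)
  then show ?thesis unfolding integrable_iff_bounded by simp
qed

lemma integral_similarity:
  fixes f :: "quat \<Rightarrow> 'b::{banach, second_countable_topology}"
  assumes [measurable]: "f \<in> borel_measurable borel"
  shows "(LINT x|lborel. f x) = (c^4) *\<^sub>R (LINT x|lborel. f (t + L x))"
proof -
  note [measurable] = measurable_similarity
  show ?thesis
    using c by (subst lborel_similarity[OF L c, of t])
       (simp_all add: integral_density integral_distr)
qed

text \<open>Preimages of null sets under a similarity are null. This is what lets a Lebesgue
  measurable function be replaced by a Borel one inside a composition.\<close>

lemma AE_similarity:
  assumes "AE x in lborel. P x"
  shows "AE x in lborel. P (t + L x)"
proof -
  note [measurable] = measurable_similarity
  obtain N where N: "{x. \<not> P x} \<subseteq> N" "N \<in> null_sets lborel"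
    using assms by (auto simp: eventually_ae_filter)
  then have [measurable]: "N \<in> sets borel" by auto
  have "AE x in lborel. x \<notin> N" using N AE_not_in by blast
  then have "AE x in lborel. t + L x \<notin> N"
    using c by (subst (asm) lborel_similarity[OF L c, of t]) (simp add: AE_density AE_distr_iff)
  then show ?thesis using N by auto
qed

end

section \<open>Square-integrable functions\<close>

text \<open>The squared L^2 norm takes values in \<open>ennreal\<close>, so that it makes sense
  before membership in \<open>L2\<close> is known.\<close>

definition sqnorm :: "(quat \<Rightarrow> 'b::real_normed_vector) \<Rightarrow> ennreal" where
  "sqnorm f = (\<integral>\<^sup>+x. ennreal ((norm (f x))\<^sup>2) \<partial>lebesgue)"

text \<open>Completeness of Lebesgue measure: the preimages under the two functions differ by a
  subset of a null set.\<close>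

lemma borel_measurable_lebesgue_AE:
  fixes f g :: "'a::euclidean_space \<Rightarrow> 'b::topological_space"
  assumes f: "f \<in> borel_measurable lebesgue" and ae: "AE x in lebesgue. f x = g x"
  shows "g \<in> borel_measurable lebesgue"
proof (rule measurableI)
  fix A :: "'b set" assume A: "A \<in> sets borel"
  show "g -` A \<inter> space lebesgue \<in> sets lebesgue"
    by (rule complete_measure.in_sets_AE[OF completion.complete_measure_axioms, where A="f -` A \<inter> space lebesgue"])
       (use ae measurable_sets[OF f A] in auto)
qed simp

text \<open>Each coordinate has a Borel version, and the union of finitely many exceptional null
  sets is null.\<close>

lemma borel_representative:
  fixes f :: "'a::euclidean_space \<Rightarrow> 'b::euclidean_space"
  assumes f: "f \<in> borel_measurable lebesgue"
  obtains g where "g \<in> borel_measurable borel" "AE x in lebesgue. f x = g x"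
proof -
  have "\<forall>b. \<exists>h. h \<in> borel_measurable lborel \<and> (AE x in lborel. f x \<bullet> b = h x)"
    using f completion_ex_borel_measurable_real[of "\<lambda>x. f x \<bullet> _" lborel] by (simp add: Bex_def)
  from choice[OF this] obtain h where
    h: "\<And>b. h b \<in> borel_measurable borel" "\<And>b. AE x in lborel. f x \<bullet> b = h b x"
    by auto
  note [measurable] = h(1)
  have "AE x in lborel. \<forall>b\<in>Basis. f x \<bullet> b = h b x"
    using h(2) by (intro AE_finite_allI) auto
  then have "AE x in lborel. f x = (\<Sum>b\<in>Basis. h b x *\<^sub>R b)"
  proof eventually_elim
    case (elim x)
    then show ?case by (metis (no_types, lifting) euclidean_representation sum.cong)
  qed
  then show ?thesis
    by (intro that[of "\<lambda>x. \<Sum>b\<in>Basis. h b x *\<^sub>R b"]) (auto simp: AE_completion_iff)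
qed

lemma L2_iff: "f \<in> L2 \<longleftrightarrow> f \<in> borel_measurable lebesgue \<and> sqnorm f < \<infinity>"
  unfolding L2_def sqnorm_def by (auto simp: integrable_iff_bounded)

lemma L2_measurable: "f \<in> L2 \<Longrightarrow> f \<in> borel_measurable lebesgue"
  and L2_finite: "f \<in> L2 \<Longrightarrow> sqnorm f < \<infinity>"
  by (simp_all add: L2_iff)

lemma sqnorm_cong_AE: "AE x in lebesgue. norm (f x) = norm (g x) \<Longrightarrow> sqnorm f = sqnorm g"
  unfolding sqnorm_def by (intro nn_integral_cong_AE) auto

lemma L2_cong_AE: "f \<in> L2 \<Longrightarrow> AE x in lebesgue. f x = g x \<Longrightarrow> g \<in> L2"
  using borel_measurable_lebesgue_AE[of f g] sqnorm_cong_AE[of f g, OF eventually_mono[of "\<lambda>x. f x = g x"]]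
  by (simp add: L2_iff)

lemma norm_sum_square: "(norm (a + b))\<^sup>2 \<le> 2 * (norm a)\<^sup>2 + 2 * (norm b)\<^sup>2"
  for a b :: "'a::real_normed_vector"
proof -
  have "(norm (a + b))\<^sup>2 \<le> (norm a + norm b)\<^sup>2"
    by (intro power_mono norm_triangle_ineq) simp
  also have "\<dots> \<le> 2 * (norm a)\<^sup>2 + 2 * (norm b)\<^sup>2"
    using sum_squares_bound[of "norm a" "norm b"] by (simp add: power2_sum)
  finally show ?thesis .
qed

text \<open>A quadratic stand-in for Minkowski's inequality. The factor 2 is harmless, as the bound
  serves for finiteness, boundedness and limits equal to 0.\<close>

lemma sqnorm_add:
  fixes f g :: "quat \<Rightarrow> 'b::{real_normed_vector, second_countable_topology}"
  assumes [measurable]: "f \<in> borel_measurable lebesgue" "g \<in> borel_measurable lebesgue"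
  shows "sqnorm (\<lambda>x. f x + g x) \<le> 2 * sqnorm f + 2 * sqnorm g"
proof -
  have "sqnorm (\<lambda>x. f x + g x) \<le> (\<integral>\<^sup>+x. 2 * ennreal ((norm (f x))\<^sup>2) + 2 * ennreal ((norm (g x))\<^sup>2) \<partial>lebesgue)"
    unfolding sqnorm_def
  proof (intro nn_integral_mono)
    fix x
    have "ennreal ((norm (f x + g x))\<^sup>2) \<le> ennreal (2 * (norm (f x))\<^sup>2 + 2 * (norm (g x))\<^sup>2)"
      by (intro ennreal_leI norm_sum_square)
    then show "ennreal ((norm (f x + g x))\<^sup>2) \<le> 2 * ennreal ((norm (f x))\<^sup>2) + 2 * ennreal ((norm (g x))\<^sup>2)"
      by (simp add: ennreal_mult)
  qed
  also have "\<dots> = 2 * sqnorm f + 2 * sqnorm g"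
    unfolding sqnorm_def by (simp add: nn_integral_add nn_integral_cmult)
  finally show ?thesis .
qed

lemma sqnorm_uminus: "sqnorm (\<lambda>x. - f x) = sqnorm f"
  by (simp add: sqnorm_def)

lemma sqnorm_diff:
  fixes f g :: "quat \<Rightarrow> 'b::{real_normed_vector, second_countable_topology}"
  assumes "f \<in> borel_measurable lebesgue" "g \<in> borel_measurable lebesgue"
  shows "sqnorm (\<lambda>x. f x - g x) \<le> 2 * sqnorm f + 2 * sqnorm g"
  using sqnorm_add[of f "\<lambda>x. - g x"] assms by (simp add: sqnorm_uminus)

lemma sqnorm_cmult:
  fixes f :: "quat \<Rightarrow> complex"
  assumes "f \<in> borel_measurable lebesgue"
  shows "sqnorm (\<lambda>x. c * f x) = ennreal ((norm c)\<^sup>2) * sqnorm f"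
  using assms unfolding sqnorm_def
  by (subst nn_integral_cmult[symmetric]) (auto simp: norm_mult power_mult_distrib ennreal_mult)

lemma L2_add:
  fixes f g :: "quat \<Rightarrow> 'b::{real_normed_vector, second_countable_topology}"
  shows "f \<in> L2 \<Longrightarrow> g \<in> L2 \<Longrightarrow> (\<lambda>x. f x + g x) \<in> L2"
  unfolding L2_iff using sqnorm_add[of f g] by (auto simp: ennreal_mult_less_top intro: le_less_trans)

lemma L2_diff:
  fixes f g :: "quat \<Rightarrow> 'b::{real_normed_vector, second_countable_topology}"
  shows "f \<in> L2 \<Longrightarrow> g \<in> L2 \<Longrightarrow> (\<lambda>x. f x - g x) \<in> L2"
  unfolding L2_iff using sqnorm_diff[of f g] by (auto simp: ennreal_mult_less_top intro: le_less_trans)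

lemma L2_cmult:
  fixes f :: "quat \<Rightarrow> complex"
  shows "f \<in> L2 \<Longrightarrow> (\<lambda>x. c * f x) \<in> L2"
  unfolding L2_iff by (auto simp: sqnorm_cmult ennreal_mult_less_top)

lemma L2_bound:
  assumes "f \<in> L2" "g \<in> borel_measurable lebesgue" "\<And>x. norm (g x) \<le> norm (f x)"
  shows "g \<in> L2"
proof -
  have "sqnorm g \<le> sqnorm f"
    unfolding sqnorm_def by (intro nn_integral_mono ennreal_leI power_mono assms) simp
  then show ?thesis using assms by (auto simp: L2_iff)
qed

lemma sqnorm_cnj: "sqnorm (\<lambda>x. cnj (f x)) = sqnorm f"
  by (simp add: sqnorm_def)

lemma measurable_cnj [measurable]: "cnj \<in> borel_measurable borel"
  by (intro borel_measurable_continuous_onI continuous_on_cnj continuous_on_id)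

lemma L2_cnj: "f \<in> L2 \<Longrightarrow> (\<lambda>x. cnj (f x)) \<in> L2"
  unfolding L2_iff sqnorm_cnj by auto

lemma L2_zero: "(\<lambda>x. 0) \<in> L2"
  by (simp add: L2_iff sqnorm_def)

lemma sqnorm_eq_0_iff:
  assumes "f \<in> borel_measurable lebesgue"
  shows "sqnorm f = 0 \<longleftrightarrow> (AE x in lebesgue. f x = 0)"
  unfolding sqnorm_def using assms by (subst nn_integral_0_iff_AE) auto

text \<open>Cauchy-Schwarz for the bilinear pairing, without conjugate, because the multiplication
  formula for the Fourier transform is bilinear; \<open>cip\<close> is recovered by conjugating the
  first function.\<close>

lemma integrable_pairing:
  fixes f g :: "quat \<Rightarrow> complex"
  assumes f: "f \<in> L2" and g: "g \<in> L2"
  shows "integrable lebesgue (\<lambda>x. f x * g x)"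
    and "ennreal ((norm (LINT x|lebesgue. f x * g x))\<^sup>2) \<le> sqnorm f * sqnorm g"
proof -
  note [measurable] = L2_measurable[OF f] L2_measurable[OF g]
  let ?I = "\<integral>\<^sup>+x. ennreal (norm (f x * g x)) \<partial>lebesgue"
  have "?I\<^sup>2 = (\<integral>\<^sup>+x. ennreal (norm (f x)) * ennreal (norm (g x)) \<partial>lebesgue)\<^sup>2"
    by (simp add: norm_mult ennreal_mult)
  also have "\<dots> \<le> (\<integral>\<^sup>+x. (ennreal (norm (f x)))\<^sup>2 \<partial>lebesgue) * (\<integral>\<^sup>+x. (ennreal (norm (g x)))\<^sup>2 \<partial>lebesgue)"
    by (rule Cauchy_Schwarz_nn_integral) measurable
  also have "\<dots> = sqnorm f * sqnorm g"
    by (simp add: sqnorm_def ennreal_power)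
  finally have I: "?I\<^sup>2 \<le> sqnorm f * sqnorm g" .
  also have "\<dots> < \<infinity>"
    using L2_finite[OF f] L2_finite[OF g] by (simp add: ennreal_mult_less_top)
  finally have I2: "?I\<^sup>2 < \<infinity>" .
  have "?I < \<infinity>"
  proof (rule ccontr)
    assume "\<not> ?I < \<infinity>"
    then have "?I = top" by (simp add: not_less top_unique)
    then have "?I\<^sup>2 = top" unfolding power2_eq_square by (simp only: ennreal_top_mult) simp
    with I2 show False by simp
  qed
  then show int: "integrable lebesgue (\<lambda>x. f x * g x)"
    by (intro integrableI_bounded) auto
  have "ennreal (norm (LINT x|lebesgue. f x * g x)) \<le> ?I"
    using int by (rule integral_norm_bound_ennreal)
  then have "(ennreal (norm (LINT x|lebesgue. f x * g x)))\<^sup>2 \<le> ?I\<^sup>2"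
    by (rule power_mono) simp
  also note I
  finally show "ennreal ((norm (LINT x|lebesgue. f x * g x))\<^sup>2) \<le> sqnorm f * sqnorm g"
    by (simp add: ennreal_power)
qed

lemma sqnorm_eq_integral:
  assumes "f \<in> L2"
  shows "sqnorm f = ennreal (LINT x|lebesgue. (norm (f x))\<^sup>2)"
  unfolding sqnorm_def using assms by (intro nn_integral_eq_integral) (auto simp: L2_def)

lemma complex_norm_square_integral:
  "(LINT x|lebesgue. cnj (f x) * f x) = complex_of_real (LINT x|lebesgue. (norm (f x))\<^sup>2)"
proof -
  have "cnj (f x) * f x = complex_of_real ((norm (f x))\<^sup>2)" for x
    by (metis complex_norm_square mult.commute)
  then show ?thesis by (simp del: of_real_power)
qed

lemma sqnorm_eq_cip: "f \<in> L2 \<Longrightarrow> sqnorm f = ennreal (Re (cip f f))"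
  by (simp add: sqnorm_eq_integral cip_def complex_norm_square_integral)

section \<open>Convergence and completeness in L^2\<close>

lemma ennreal_tendsto_norm_0:
  fixes a :: "nat \<Rightarrow> 'a::real_normed_vector"
  assumes "\<And>n. ennreal ((norm (a n))\<^sup>2) \<le> b n" "b \<longlonglongrightarrow> 0"
  shows "a \<longlonglongrightarrow> 0"
proof -
  have "(\<lambda>n. ennreal ((norm (a n))\<^sup>2)) \<longlonglongrightarrow> ennreal 0"
    by (rule tendsto_sandwich[of "\<lambda>_. 0" _ _ b]) (use assms in auto)
  then have "(\<lambda>n. (norm (a n))\<^sup>2) \<longlonglongrightarrow> 0"
    by (subst (asm) tendsto_ennreal_iff) auto
  then have "(\<lambda>n. sqrt ((norm (a n))\<^sup>2)) \<longlonglongrightarrow> sqrt 0"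
    by (rule tendsto_real_sqrt)
  then show ?thesis by (simp add: tendsto_norm_zero_iff)
qed

text \<open>In the expansion uv = (u - f)(v - g) + (u - f) g + f (v - g) + f g, Cauchy-Schwarz sends
  the first three integrals to 0.\<close>

lemma pairing_tendsto:
  fixes u v :: "nat \<Rightarrow> quat \<Rightarrow> complex"
  assumes u: "\<And>n. u n \<in> L2" "f \<in> L2" "(\<lambda>n. sqnorm (\<lambda>x. u n x - f x)) \<longlonglongrightarrow> 0"
    and v: "\<And>n. v n \<in> L2" "g \<in> L2" "(\<lambda>n. sqnorm (\<lambda>x. v n x - g x)) \<longlonglongrightarrow> 0"
  shows "(\<lambda>n. LINT x|lebesgue. u n x * v n x) \<longlonglongrightarrow> (LINT x|lebesgue. f x * g x)"
proof -
  note uf = L2_diff[OF u(1) u(2)] and vg = L2_diff[OF v(1) v(2)]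
  let ?a = "\<lambda>n. LINT x|lebesgue. (u n x - f x) * (v n x - g x)"
  let ?b = "\<lambda>n. LINT x|lebesgue. (u n x - f x) * g x"
  let ?c = "\<lambda>n. LINT x|lebesgue. f x * (v n x - g x)"
  have "?a \<longlonglongrightarrow> 0"
    by (rule ennreal_tendsto_norm_0[OF integrable_pairing(2)[OF uf vg]])
       (use tendsto_mult_ennreal[OF u(3) v(3)] in simp)
  moreover have "?b \<longlonglongrightarrow> 0"
    by (rule ennreal_tendsto_norm_0[OF integrable_pairing(2)[OF uf v(2)]])
       (use tendsto_mult_ennreal[OF u(3) tendsto_const[of "sqnorm g"]] L2_finite[OF v(2)] in simp)
  moreover have "?c \<longlonglongrightarrow> 0"
    by (rule ennreal_tendsto_norm_0[OF integrable_pairing(2)[OF u(2) vg]])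
       (use tendsto_mult_ennreal[OF tendsto_const[of "sqnorm f"] v(3)] L2_finite[OF u(2)] in simp)
  ultimately have "(\<lambda>n. ?a n + ?b n + ?c n + (LINT x|lebesgue. f x * g x)) \<longlonglongrightarrow> 0 + 0 + 0 + (LINT x|lebesgue. f x * g x)"
    by (intro tendsto_add tendsto_const)
  moreover have "?a n + ?b n + ?c n + (LINT x|lebesgue. f x * g x) = (LINT x|lebesgue. u n x * v n x)" for n
  proof -
    have "(LINT x|lebesgue. u n x * v n x) =
      (LINT x|lebesgue. (u n x - f x) * (v n x - g x) + (u n x - f x) * g x + f x * (v n x - g x) + f x * g x)"
      by (simp add: algebra_simps)
    also have "\<dots> = ?a n + ?b n + ?c n + (LINT x|lebesgue. f x * g x)"
      using integrable_pairing(1)[OF uf vg] integrable_pairing(1)[OF uf v(2)]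
        integrable_pairing(1)[OF u(2) vg] integrable_pairing(1)[OF u(2) v(2)]
      by (simp add: Bochner_Integration.integral_add Bochner_Integration.integrable_add)
    finally show ?thesis by simp
  qed
  ultimately show ?thesis by simp
qed

lemma L2lim_cnj:
  "(\<lambda>n. sqnorm (\<lambda>x. u n x - f x)) \<longlonglongrightarrow> 0 \<Longrightarrow> (\<lambda>n. sqnorm (\<lambda>x. cnj (u n x) - cnj (f x))) \<longlonglongrightarrow> 0"
  by (simp add: sqnorm_def flip: complex_cnj_diff)

lemma cip_tendsto:
  assumes "\<And>n. u n \<in> L2" "f \<in> L2" "(\<lambda>n. sqnorm (\<lambda>x. u n x - f x)) \<longlonglongrightarrow> 0"
    and "\<And>n. v n \<in> L2" "g \<in> L2" "(\<lambda>n. sqnorm (\<lambda>x. v n x - g x)) \<longlonglongrightarrow> 0"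
  shows "(\<lambda>n. cip (u n) (v n)) \<longlonglongrightarrow> cip f g"
  unfolding cip_def using assms by (intro pairing_tendsto L2_cnj L2lim_cnj)

lemma L2lim_add:
  fixes u v :: "nat \<Rightarrow> quat \<Rightarrow> complex"
  assumes u: "\<And>n. u n \<in> L2" "f \<in> L2" "(\<lambda>n. sqnorm (\<lambda>x. u n x - f x)) \<longlonglongrightarrow> 0"
    and v: "\<And>n. v n \<in> L2" "g \<in> L2" "(\<lambda>n. sqnorm (\<lambda>x. v n x - g x)) \<longlonglongrightarrow> 0"
  shows "(\<lambda>n. sqnorm (\<lambda>x. (u n x + v n x) - (f x + g x))) \<longlonglongrightarrow> 0"
proof (rule tendsto_sandwich[of "\<lambda>_. 0"])
  have "(\<lambda>n. 2 * sqnorm (\<lambda>x. u n x - f x) + 2 * sqnorm (\<lambda>x. v n x - g x)) \<longlonglongrightarrow> 2 * 0 + 2 * 0"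
    by (intro tendsto_add tendsto_mult_ennreal u v tendsto_const) auto
  then show "(\<lambda>n. 2 * sqnorm (\<lambda>x. u n x - f x) + 2 * sqnorm (\<lambda>x. v n x - g x)) \<longlonglongrightarrow> 0" by simp
  show "\<forall>\<^sub>F n in sequentially. sqnorm (\<lambda>x. (u n x + v n x) - (f x + g x))
      \<le> 2 * sqnorm (\<lambda>x. u n x - f x) + 2 * sqnorm (\<lambda>x. v n x - g x)"
  proof (intro always_eventually allI)
    fix n
    show "sqnorm (\<lambda>x. (u n x + v n x) - (f x + g x))
      \<le> 2 * sqnorm (\<lambda>x. u n x - f x) + 2 * sqnorm (\<lambda>x. v n x - g x)"
      using sqnorm_add[OF L2_measurable[OF L2_diff[OF u(1) u(2)]] L2_measurable[OF L2_diff[OF v(1) v(2)]], of n n]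
      by (simp add: algebra_simps)
  qed
qed auto

lemma L2lim_cmult:
  fixes u :: "nat \<Rightarrow> quat \<Rightarrow> complex"
  assumes u: "\<And>n. u n \<in> L2" "f \<in> L2" "(\<lambda>n. sqnorm (\<lambda>x. u n x - f x)) \<longlonglongrightarrow> 0"
  shows "(\<lambda>n. sqnorm (\<lambda>x. c * u n x - c * f x)) \<longlonglongrightarrow> 0"
proof -
  have "sqnorm (\<lambda>x. c * u n x - c * f x) = ennreal ((norm c)\<^sup>2) * sqnorm (\<lambda>x. u n x - f x)" for n
    using sqnorm_cmult[OF L2_measurable[OF L2_diff[OF u(1) u(2)]], of c n] by (simp add: right_diff_distrib)
  moreover have "(\<lambda>n. ennreal ((norm c)\<^sup>2) * sqnorm (\<lambda>x. u n x - f x)) \<longlonglongrightarrow> ennreal ((norm c)\<^sup>2) * 0"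
    by (intro tendsto_mult_ennreal u tendsto_const) auto
  ultimately show ?thesis by simp
qed

text \<open>Density of L^1 \<inter> L^2. Integrability of a cut-off comes from Cauchy-Schwarz
  against the indicator of the ball, which has finite measure.\<close>

lemma L2_truncate:
  fixes f :: "quat \<Rightarrow> complex"
  assumes f: "f \<in> L2"
  defines "\<phi> \<equiv> \<lambda>(n::nat) x. indicator (ball 0 (real n)) x * f x"
  shows "\<phi> n \<in> L2" "integrable lebesgue (\<phi> n)" "(\<lambda>n. sqnorm (\<lambda>x. \<phi> n x - f x)) \<longlonglongrightarrow> 0"
proof -
  note [measurable] = L2_measurable[OF f]
  have [measurable]: "(indicator (ball (0::quat) (real n)) :: quat \<Rightarrow> complex) \<in> borel_measurable lebesgue" for n
    by (intro borel_measurable_indicator) simp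
  have m: "\<phi> n \<in> borel_measurable lebesgue" for n
    unfolding \<phi>_def by measurable
  show "\<phi> n \<in> L2"
    by (rule L2_bound[OF f m]) (auto simp: \<phi>_def indicator_def)
  have ind: "(indicator (ball (0::quat) (real n)) :: quat \<Rightarrow> complex) \<in> L2"
  proof -
    have "sqnorm (indicator (ball (0::quat) (real n)) :: quat \<Rightarrow> complex) = (\<integral>\<^sup>+x. indicator (ball (0::quat) (real n)) x \<partial>lebesgue)"
      unfolding sqnorm_def by (intro nn_integral_cong) (auto simp: indicator_def)
    also have "\<dots> = emeasure lborel (ball (0::quat) (real n))" by simp
    also have "\<dots> < \<infinity>" by (rule emeasure_lborel_ball_finite)
    finally show ?thesis by (simp add: L2_iff)
  qed
  show "integrable lebesgue (\<phi> n)"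
    unfolding \<phi>_def by (rule integrable_pairing[OF ind f])
  have "(\<lambda>n. \<integral>\<^sup>+x. ennreal ((norm (\<phi> n x - f x))\<^sup>2) \<partial>lebesgue) \<longlonglongrightarrow> (\<integral>\<^sup>+x. 0 \<partial>(lebesgue :: quat measure))"
  proof (rule nn_integral_dominated_convergence[where w="\<lambda>x. ennreal ((norm (f x))\<^sup>2)"])
    show "(\<lambda>x. ennreal ((norm (\<phi> n x - f x))\<^sup>2)) \<in> borel_measurable lebesgue" for n
      using m[of n] by measurable
    show "(\<integral>\<^sup>+x. ennreal ((norm (f x))\<^sup>2) \<partial>lebesgue) < \<infinity>"
      using L2_finite[OF f] by (simp add: sqnorm_def)
    show "AE x in lebesgue. ennreal ((norm (\<phi> n x - f x))\<^sup>2) \<le> ennreal ((norm (f x))\<^sup>2)" for n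
      by (auto simp: \<phi>_def indicator_def)
    show "AE x in lebesgue. (\<lambda>n. ennreal ((norm (\<phi> n x - f x))\<^sup>2)) \<longlonglongrightarrow> 0"
    proof (rule AE_I2)
      fix x :: quat
      obtain N :: nat where N: "norm x < real N" using reals_Archimedean2 by blast
      have "ennreal ((norm (\<phi> n x - f x))\<^sup>2) = 0" if "n \<ge> N" for n
        using that N by (auto simp: \<phi>_def)
      then show "(\<lambda>n. ennreal ((norm (\<phi> n x - f x))\<^sup>2)) \<longlonglongrightarrow> 0"
        by (intro tendsto_eventually) (auto simp: eventually_sequentially)
    qed
  qed auto
  then show "(\<lambda>n. sqnorm (\<lambda>x. \<phi> n x - f x)) \<longlonglongrightarrow> 0"
    by (simp add: sqnorm_def)
qed

text \<open>Riesz-Fischer. A rapidly Cauchy subsequence converges almost everywhere, and Fatou's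
  lemma turns the pointwise limit into a limit in the mean of the whole sequence.\<close>

lemma L2_complete:
  fixes u :: "nat \<Rightarrow> quat \<Rightarrow> complex"
  assumes u: "\<And>n. u n \<in> L2"
    and cauchy: "\<And>e::real. e > 0 \<Longrightarrow> \<exists>N. \<forall>m\<ge>N. \<forall>n\<ge>N. sqnorm (\<lambda>x. u m x - u n x) \<le> ennreal e"
  obtains F where "F \<in> L2" "(\<lambda>n. sqnorm (\<lambda>x. u n x - F x)) \<longlonglongrightarrow> 0"
proof -
  note [measurable] = L2_measurable[OF u]
  have "\<exists>N. \<forall>m\<ge>N. \<forall>n\<ge>N. sqnorm (\<lambda>x. u m x - u n x) \<le> ennreal ((1/4)^k)" for k
    by (rule cauchy) simp
  then obtain N where N: "\<And>k m n. m \<ge> N k \<Longrightarrow> n \<ge> N k \<Longrightarrow> sqnorm (\<lambda>x. u m x - u n x) \<le> ennreal ((1/4)^k)"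
    by metis
  \<comment> \<open>The sum of all thresholds up to k makes r monotone and at least
    \<open>N k\<close>; the summand k makes it tend to infinity.\<close>
  define r where "r k = (\<Sum>i\<le>k. N i) + k" for k
  have "N k \<le> (\<Sum>i\<le>k. N i)" for k
    by (intro member_le_sum) auto
  then have le: "r k \<ge> N k" for k
    unfolding r_def by (metis trans_le_add1)
  moreover have "r (Suc k) \<ge> r k" for k by (simp add: r_def)
  ultimately have rN: "r k \<ge> N k" "r (Suc k) \<ge> N k" "r k \<ge> k" for k
    using le_trans[OF le] by (auto simp: r_def)
  define d where "d k x = u (r (Suc k)) x - u (r k) x" for k x
  have [measurable]: "d k \<in> borel_measurable lebesgue" for k
    unfolding d_def by measurable
  have d: "sqnorm (d k) \<le> ennreal ((1/4)^k)" for k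
    unfolding d_def by (intro N rN)
  \<comment> \<open>The increments have squared norm at most 4^(-k). The weight 2^k leaves a
    convergent series of integrals and yet forces |d_k(x)| to decay geometrically wherever the sum
    is finite.\<close>
  let ?S = "\<lambda>x. \<Sum>k. ennreal (2^k * (norm (d k x))\<^sup>2)"
  have "(\<integral>\<^sup>+x. ?S x \<partial>lebesgue) = (\<Sum>k. \<integral>\<^sup>+x. ennreal (2^k * (norm (d k x))\<^sup>2) \<partial>lebesgue)"
    by (intro nn_integral_suminf) measurable
  also have "\<dots> = (\<Sum>k. ennreal (2^k) * sqnorm (d k))"
    unfolding sqnorm_def by (intro suminf_cong) (simp add: ennreal_mult nn_integral_cmult)
  also have "\<dots> \<le> (\<Sum>k. ennreal ((1/2)^k))"
  proof (intro suminf_le)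
    fix k
    have "ennreal (2^k) * sqnorm (d k) \<le> ennreal (2^k) * ennreal ((1/4)^k)"
      by (intro mult_left_mono d) simp
    also have "\<dots> = ennreal ((1/2)^k)"
      by (simp add: ennreal_mult[symmetric] power_mult_distrib[symmetric])
    finally show "ennreal (2^k) * sqnorm (d k) \<le> ennreal ((1/2)^k)" .
  qed auto
  also have "\<dots> < \<infinity>"
    by (subst suminf_ennreal2) (auto intro: summable_geometric)
  finally have S_fin: "AE x in lebesgue. ?S x \<noteq> \<infinity>"
    by (intro nn_integral_PInf_AE) (auto simp: less_top)
  define F where "F x = lim (\<lambda>k. u (r k) x)" for x
  have [measurable]: "F \<in> borel_measurable lebesgue"
    unfolding F_def by measurable
  have conv: "AE x in lebesgue. (\<lambda>k. u (r k) x) \<longlonglongrightarrow> F x"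
    using S_fin
  proof eventually_elim
    case (elim x)
    define s where "s = enn2real (?S x)"
    have "?S x < top" using elim by (simp only: less_top infinity_ennreal_def)
    then have s: "?S x = ennreal s" "s \<ge> 0"
      unfolding s_def by (simp_all only: ennreal_enn2real enn2real_nonneg)
    have "norm (d k x) \<le> sqrt s * (1 / sqrt 2)^k" for k
    proof -
      have "ennreal (2^k * (norm (d k x))\<^sup>2) = (\<Sum>j\<in>{k}. ennreal (2^j * (norm (d j x))\<^sup>2))" by simp
      also have "\<dots> \<le> ?S x" by (intro sum_le_suminf) auto
      finally have "2^k * (norm (d k x))\<^sup>2 \<le> s" using s by simp
      then have "(norm (d k x))\<^sup>2 \<le> s / 2^k" by (simp add: field_simps)
      then have "norm (d k x) \<le> sqrt (s / 2^k)" by (simp add: real_le_rsqrt)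
      also have "\<dots> = sqrt s * (1 / sqrt 2)^k"
        by (simp add: real_sqrt_divide real_sqrt_power power_divide)
      finally show ?thesis .
    qed
    moreover have "summable (\<lambda>k. sqrt s * (1 / sqrt 2)^k)"
      by (intro summable_mult summable_geometric) auto
    ultimately have "summable (\<lambda>k. d k x)"
      by (rule summable_comparison_test'[rotated])
    then have "(\<lambda>n. \<Sum>k<n. d k x) \<longlonglongrightarrow> (\<Sum>k. d k x)" by (rule summable_LIMSEQ)
    moreover have "(\<Sum>k<n. d k x) = u (r n) x - u (r 0) x" for n
      unfolding d_def by (rule sum_lessThan_telescope)
    ultimately have "(\<lambda>n. u (r n) x - u (r 0) x + u (r 0) x) \<longlonglongrightarrow> (\<Sum>k. d k x) + u (r 0) x"
      by (intro tendsto_add tendsto_const) simp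
    then have "convergent (\<lambda>n. u (r n) x)" by (auto simp: convergent_def)
    then show ?case unfolding F_def by (simp add: convergent_LIMSEQ_iff)
  qed
  \<comment> \<open>The limit is taken along the subsequence with n fixed;
    \<open>r j \<ge> j\<close> brings the second index beyond \<open>N k\<close> as well.\<close>
  have fatou: "sqnorm (\<lambda>x. u n x - F x) \<le> ennreal ((1/4)^k)" if n: "n \<ge> N k" for n k
  proof -
    have "sqnorm (\<lambda>x. u n x - F x) = (\<integral>\<^sup>+x. liminf (\<lambda>j. ennreal ((norm (u n x - u (r j) x))\<^sup>2)) \<partial>lebesgue)"
      unfolding sqnorm_def
    proof (intro nn_integral_cong_AE, use conv in eventually_elim)
      case (elim x)
      then have "(\<lambda>j. ennreal ((norm (u n x - u (r j) x))\<^sup>2)) \<longlonglongrightarrow> ennreal ((norm (u n x - F x))\<^sup>2)"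
        by (intro tendsto_ennrealI tendsto_intros)
      then show ?case by (rule lim_imp_Liminf[OF sequentially_bot, symmetric])
    qed
    also have "\<dots> \<le> liminf (\<lambda>j. \<integral>\<^sup>+x. ennreal ((norm (u n x - u (r j) x))\<^sup>2) \<partial>lebesgue)"
      by (intro nn_integral_liminf) measurable
    also have "\<dots> \<le> ennreal ((1/4)^k)"
    proof (rule Liminf_le)
      have "(\<integral>\<^sup>+x. ennreal ((norm (u n x - u (r j) x))\<^sup>2) \<partial>lebesgue) \<le> ennreal ((1/4)^k)" if "j \<ge> N k" for j
        using N[OF n, of "r j"] rN(3)[of j] that by (simp add: sqnorm_def)
      then show "\<forall>\<^sub>F j in sequentially. (\<integral>\<^sup>+x. ennreal ((norm (u n x - u (r j) x))\<^sup>2) \<partial>lebesgue) \<le> ennreal ((1/4)^k)"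
        by (auto simp: eventually_sequentially)
    qed simp
    finally show ?thesis .
  qed
  have "(\<lambda>x. u (N 0) x - F x) \<in> L2"
    using fatou[of 0 "N 0"] by (auto simp: L2_iff intro: le_less_trans)
  from L2_diff[OF u[of "N 0"] this] have F: "F \<in> L2" by simp
  have "(\<lambda>n. sqnorm (\<lambda>x. u n x - F x)) \<longlonglongrightarrow> 0"
  proof (rule order_tendstoI)
    fix e :: ennreal assume e0: "0 < e"
    then obtain e' :: real where e': "0 < e'" "ennreal e' \<le> e"
      proof (cases e)
      case (real r)
      then show ?thesis using e0 by (intro that[of r]) auto
    next
      case top
      then show ?thesis by (intro that[of 1]) auto
    qed
    have "(\<lambda>k. (1/4::real)^k) \<longlonglongrightarrow> 0" by (intro LIMSEQ_realpow_zero) auto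
    then have "\<forall>\<^sub>F k in sequentially. (1/4::real)^k < e'" using e'(1) by (rule order_tendstoD)
    then obtain k where k: "(1/4::real)^k < e'" by (auto simp: eventually_sequentially)
    have "sqnorm (\<lambda>x. u n x - F x) < e" if "n \<ge> N k" for n
      using fatou[OF that] k e' by (meson ennreal_lessI le_less_trans less_le_trans)
    then show "\<forall>\<^sub>F n in sequentially. sqnorm (\<lambda>x. u n x - F x) < e"
      by (auto simp: eventually_sequentially)
  qed simp
  with F show ?thesis by (rule that)
qed

section \<open>Continuity of translations in the mean\<close>

text \<open>Packages the last step of the approximation arguments below; the null sequence may
  depend on e.\<close>

lemma tendsto_0_approx:
  fixes a :: "nat \<Rightarrow> real"
  assumes "\<And>n. 0 \<le> a n" "\<And>e. e > 0 \<Longrightarrow> \<exists>v. v \<longlonglongrightarrow> 0 \<and> (\<forall>n. a n \<le> e + v n)"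
  shows "a \<longlonglongrightarrow> 0"
proof (rule LIMSEQ_I)
  fix r :: real assume r: "0 < r"
  obtain v where v: "v \<longlonglongrightarrow> 0" "\<And>n. a n \<le> r/2 + v n" using assms(2)[of "r/2"] r by auto
  from LIMSEQ_D[OF v(1), of "r/2"] r obtain N where N: "\<And>n. n \<ge> N \<Longrightarrow> norm (v n - 0) < r/2" by auto
  have "norm (a n - 0) < r" if "n \<ge> N" for n
    using N[OF that] v(2)[of n] assms(1)[of n] by (auto simp: abs_if split: if_splits)
  then show "\<exists>N. \<forall>n\<ge>N. norm (a n - 0) < r" by blast
qed

lemma lborel_translate:
  fixes z :: "'a::euclidean_space"
  shows "lborel = distr lborel borel (\<lambda>x. x + z)"
  using lborel_affine[of 1 z] by (simp add: density_1 add.commute)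

lemma integral_translate:
  fixes f :: "'a::euclidean_space \<Rightarrow> 'b::{banach, second_countable_topology}"
  assumes [measurable]: "f \<in> borel_measurable borel"
  shows "(LINT x|lborel. f (x + z)) = (LINT x|lborel. f x)"
  by (subst (2) lborel_translate[of z]) (simp add: integral_distr)

lemma nn_integral_translate:
  fixes f :: "'a::euclidean_space \<Rightarrow> ennreal"
  assumes [measurable]: "f \<in> borel_measurable borel"
  shows "(\<integral>\<^sup>+x. f (x + z) \<partial>lborel) = (\<integral>\<^sup>+x. f x \<partial>lborel)"
  by (subst (2) lborel_translate[of z]) (simp add: nn_integral_distr)

lemma integrable_translate:
  fixes f :: "'a::euclidean_space \<Rightarrow> 'b::{banach, second_countable_topology}"
  assumes f: "integrable lborel f"
  shows "integrable lborel (\<lambda>x. f (x + z))"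
proof -
  have [measurable]: "f \<in> borel_measurable borel" using f by auto
  show ?thesis using f by (subst (asm) lborel_translate[of z]) (simp add: integrable_distr_eq)
qed

text \<open>Scheffe's argument. The positive part of 1_V(x) - 1_V(x + z) is dominated by the
  indicator of V and tends to 0 because V is open. For the negative part no fixed dominating
  function is at hand, but translation invariance gives it the same integral.\<close>

lemma translation_continuous_open:
  fixes V :: "'a::euclidean_space set"
  assumes V: "open V" "emeasure lborel V < \<infinity>" and z: "z \<longlonglongrightarrow> 0"
  shows "(\<lambda>n. LINT x|lborel. \<bar>indicator V (x + z n) - indicator V x :: real\<bar>) \<longlonglongrightarrow> 0"
proof -
  have [measurable]: "V \<in> sets borel" using V by simp
  let ?p = "\<lambda>n x. max 0 (indicator V x - indicator V (x + z n)) :: real"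
  have iV: "integrable lborel (indicator V :: 'a \<Rightarrow> real)"
    using V by (intro integrable_real_indicator) auto
  note iV' = integrable_translate[OF iV]
  have ip: "integrable lborel (?p n)" for n
    by (rule Bochner_Integration.integrable_bound[OF iV]) (auto simp: indicator_def)
  have "(\<lambda>n. LINT x|lborel. ?p n x) \<longlonglongrightarrow> (LINT x|(lborel::'a measure). 0)"
  proof (rule integral_dominated_convergence[OF _ _ iV])
    show "AE x in lborel. (\<lambda>n. ?p n x) \<longlonglongrightarrow> 0"
    proof (rule AE_I2)
      fix x
      show "(\<lambda>n. ?p n x) \<longlonglongrightarrow> 0"
      proof (cases "x \<in> V")
        case True
        have "(\<lambda>n. x + z n) \<longlonglongrightarrow> x + 0" by (intro tendsto_intros z)
        then have "\<forall>\<^sub>F n in sequentially. x + z n \<in> V"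
          using V(1) True by (intro topological_tendstoD) auto
        then have "\<forall>\<^sub>F n in sequentially. ?p n x = 0"
          by eventually_elim (auto simp: True)
        then show ?thesis by (rule tendsto_eventually)
      next
        case False
        then have "?p n x = 0" for n by (auto simp: indicator_def)
        then show ?thesis by simp
      qed
    qed
    show "AE x in lborel. norm (?p n x) \<le> indicator V x" for n
      by (auto simp: indicator_def)
  qed auto
  moreover have "(LINT x|lborel. \<bar>indicator V (x + z n) - indicator V x :: real\<bar>) = 2 * (LINT x|lborel. ?p n x)" for n
  proof -
    have "(LINT x|lborel. \<bar>indicator V (x + z n) - indicator V x :: real\<bar>)
      = (LINT x|lborel. 2 * ?p n x + (indicator V (x + z n) - indicator V x))"
      by (intro Bochner_Integration.integral_cong) (auto simp: indicator_def)
    also have "\<dots> = 2 * (LINT x|lborel. ?p n x) + ((LINT x|lborel. indicator V (x + z n)) - (LINT x|lborel. indicator V x))"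
      using ip iV iV' by simp
    also have "(LINT x|lborel. indicator V (x + z n) :: real) = (LINT x|lborel. indicator V x)"
      by (rule integral_translate) simp
    finally show ?thesis by simp
  qed
  ultimately show ?thesis
    using tendsto_mult[OF tendsto_const[of 2]] by fastforce
qed

text \<open>Induction on integrable functions: indicators reduce to open sets by outer regularity,
  sums follow from the triangle inequality, and limits use that translation preserves the L^1
  distance to an approximant.\<close>

lemma translation_continuous_L1:
  fixes f :: "'a::euclidean_space \<Rightarrow> 'b::{banach, second_countable_topology}"
  assumes f: "integrable lborel f" and z: "z \<longlonglongrightarrow> 0"
  shows "(\<lambda>n. LINT x|lborel. norm (f (x + z n) - f x)) \<longlonglongrightarrow> 0"
  using f
proof (induct rule: integrable_induct)
  case (base A c)
  then have [measurable]: "A \<in> sets borel" by simp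
  have iA: "integrable lborel (indicator A :: 'a \<Rightarrow> real)"
    using base by (intro integrable_real_indicator) auto
  have "(\<lambda>n. LINT x|lborel. \<bar>indicator A (x + z n) - indicator A x :: real\<bar>) \<longlonglongrightarrow> 0"
  proof (rule tendsto_0_approx)
    fix e :: real assume e: "e > 0"
    \<comment> \<open>The error of replacing A by V enters twice, translated and untranslated,
      whence e/2.\<close>
    from outer_regular_lborel[of A "e/2"] e obtain V where
      V: "open V" "A \<subseteq> V" "emeasure lborel (V - A) < ennreal (e/2)" by auto
    have [measurable]: "V \<in> sets borel" using V by simp
    have Vfin: "emeasure lborel V < \<infinity>"
    proof -
      have "V = A \<union> (V - A)" using V by auto
      then have "emeasure lborel V \<le> emeasure lborel A + emeasure lborel (V - A)"
        by (metis emeasure_subadditive sets_lborel \<open>A \<in> sets borel\<close> \<open>V \<in> sets borel\<close> sets.Diff)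
      also have "\<dots> < \<infinity>" using base V(3) by (auto simp: less_top[symmetric] intro: less_trans)
      finally show ?thesis .
    qed
    let ?D = "indicator (V - A) :: 'a \<Rightarrow> real"
    let ?v = "\<lambda>n. LINT x|lborel. \<bar>indicator V (x + z n) - indicator V x :: real\<bar>"
    have iV: "integrable lborel (indicator V :: 'a \<Rightarrow> real)"
      using Vfin by (intro integrable_real_indicator) auto
    have D: "emeasure lborel (V - A) < \<infinity>" using V(3) by (rule less_trans) simp
    have iD: "integrable lborel ?D"
      using D by (intro integrable_real_indicator) auto
    have ID: "(LINT x|lborel. ?D x) \<le> e/2"
    proof -
      have "ennreal (measure lborel (V - A)) < ennreal (e/2)"
        using V(3) D by (subst emeasure_eq_ennreal_measure[symmetric]) auto
      then have "measure lborel (V - A) < e/2" using e by (subst (asm) ennreal_less_iff) auto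
      then show ?thesis by simp
    qed
    have "(LINT x|lborel. \<bar>indicator A (x + z n) - indicator A x :: real\<bar>) \<le> e + ?v n" for n
    proof -
      note [simp] = iA iV iD integrable_translate[OF iA] integrable_translate[OF iV] integrable_translate[OF iD]
      have "(LINT x|lborel. \<bar>indicator A (x + z n) - indicator A x :: real\<bar>)
        \<le> (LINT x|lborel. (?D (x + z n) + ?D x) + \<bar>indicator V (x + z n) - indicator V x :: real\<bar>)"
      proof (rule integral_mono)
        fix x
        show "\<bar>indicator A (x + z n) - indicator A x :: real\<bar> \<le> (?D (x + z n) + ?D x) + \<bar>indicator V (x + z n) - indicator V x :: real\<bar>"
          using V(2) by (auto simp: indicator_def)
      qed simp_all
      also have "\<dots> = ((LINT x|lborel. ?D (x + z n)) + (LINT x|lborel. ?D x)) + ?v n"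
        by (subst Bochner_Integration.integral_add) (simp_all del: integral_indicator)
      also have "(LINT x|lborel. ?D (x + z n)) = (LINT x|lborel. ?D x)"
        by (rule integral_translate) simp
      finally show ?thesis using ID by simp
    qed
    with translation_continuous_open[OF V(1) Vfin z]
    show "\<exists>v. v \<longlonglongrightarrow> 0 \<and> (\<forall>n. (LINT x|lborel. \<bar>indicator A (x + z n) - indicator A x :: real\<bar>) \<le> e + v n)"
      by blast
  qed simp
  then have "(\<lambda>n. (LINT x|lborel. \<bar>indicator A (x + z n) - indicator A x :: real\<bar>) * norm c) \<longlonglongrightarrow> 0 * norm c"
    by (rule tendsto_mult_right)
  then show ?case by (simp flip: scaleR_diff_left)
next
  case (add f g)
  note [simp] = add(1,3) integrable_translate[OF add(1)] integrable_translate[OF add(3)]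
  have lim: "(\<lambda>n. (LINT x|lborel. norm (f (x + z n) - f x)) + (LINT x|lborel. norm (g (x + z n) - g x))) \<longlonglongrightarrow> 0"
    using tendsto_add[OF add(2,4)] by simp
  have le: "(LINT x|lborel. norm ((f (x + z n) + g (x + z n)) - (f x + g x))) \<le>
      (LINT x|lborel. norm (f (x + z n) - f x)) + (LINT x|lborel. norm (g (x + z n) - g x))" for n
  proof -
    have "(LINT x|lborel. norm ((f (x + z n) + g (x + z n)) - (f x + g x)))
      \<le> (LINT x|lborel. norm (f (x + z n) - f x) + norm (g (x + z n) - g x))"
      by (intro integral_mono) (simp_all add: norm_diff_triangle_ineq)
    then show ?thesis by simp
  qed
  show ?case
    by (rule tendsto_sandwich[OF _ _ tendsto_const lim])
       (auto intro!: always_eventually le)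
next
  case (lim f s)
  note [simp] = lim(1,5) integrable_translate[OF lim(1)] integrable_translate[OF lim(5)]
  have [measurable]: "f \<in> borel_measurable borel" "\<And>i. s i \<in> borel_measurable borel"
    using borel_measurable_integrable[OF lim(5)] borel_measurable_integrable[OF lim(1)] by simp_all
  have app: "(\<lambda>i. LINT x|lborel. norm (s i x - f x)) \<longlonglongrightarrow> (LINT x|(lborel::'a measure). 0)"
  proof (rule integral_dominated_convergence[where w="\<lambda>x. 3 * norm (f x)"])
    show "AE x in lborel. (\<lambda>i. norm (s i x - f x)) \<longlonglongrightarrow> 0"
      using lim(3) by (auto intro!: AE_I2 tendsto_norm_zero simp: LIM_zero_iff)
    show "AE x in lborel. norm (norm (s i x - f x)) \<le> 3 * norm (f x)" for i
    proof (rule AE_I2)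
      fix x show "norm (norm (s i x - f x)) \<le> 3 * norm (f x)"
        using lim(4)[of x i] norm_triangle_ineq4[of "s i x" "f x"] by simp
    qed
  qed auto
  show ?case
  proof (rule tendsto_0_approx)
    fix e :: real assume e: "e > 0"
    from LIMSEQ_D[OF app, of "e/2"] e obtain i where i: "norm ((LINT x|lborel. norm (s i x - f x)) - (LINT x|(lborel::'a measure). 0)) < e/2"
      by (meson half_gt_zero order_refl)
    then have i: "(LINT x|lborel. norm (s i x - f x)) < e/2" by (auto simp: abs_if split: if_splits)
    have "(LINT x|lborel. norm (f (x + z n) - f x)) \<le> e + (LINT x|lborel. norm (s i (x + z n) - s i x))" for n
    proof -
      have "(LINT x|lborel. norm (f (x + z n) - f x)) \<le>
        (LINT x|lborel. (norm (s i (x + z n) - f (x + z n)) + norm (s i x - f x)) + norm (s i (x + z n) - s i x))"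
      proof (rule integral_mono)
        fix x
        have "f (x + z n) - f x = - (s i (x + z n) - f (x + z n)) + (s i x - f x) + (s i (x + z n) - s i x)"
          by simp
        then show "norm (f (x + z n) - f x) \<le> (norm (s i (x + z n) - f (x + z n)) + norm (s i x - f x)) + norm (s i (x + z n) - s i x)"
          using norm_triangle_ineq[of "- (s i (x + z n) - f (x + z n)) + (s i x - f x)" "s i (x + z n) - s i x"]
            norm_triangle_ineq[of "- (s i (x + z n) - f (x + z n))" "s i x - f x"]
          by (simp only: norm_minus_cancel)
      qed simp_all
      also have "\<dots> = ((LINT x|lborel. norm (s i (x + z n) - f (x + z n))) + (LINT x|lborel. norm (s i x - f x)))
           + (LINT x|lborel. norm (s i (x + z n) - s i x))"
        by simp
      also have "(LINT x|lborel. norm (s i (x + z n) - f (x + z n))) = (LINT x|lborel. norm (s i x - f x))"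
        by (rule integral_translate) simp
      finally show ?thesis using i by simp
    qed
    then show "\<exists>v. v \<longlonglongrightarrow> 0 \<and> (\<forall>n. (LINT x|lborel. norm (f (x + z n) - f x)) \<le> e + v n)"
      using lim(2) by blast
  qed simp
qed

section \<open>The Gaussian\<close>

text \<open>Up to normalization the integral is the characteristic function of the standard normal
  distribution.\<close>

lemma gaussian_integral_real:
  "integrable lborel (\<lambda>x::real. iexp (t * x) * complex_of_real (exp (- x\<^sup>2 / 2)))" (is ?I)
  "(LINT x|lborel. iexp (t * x) * complex_of_real (exp (- x\<^sup>2 / 2))) = complex_of_real (sqrt (2 * pi) * exp (- t\<^sup>2 / 2))" (is ?E)
proof -
  have eq: "iexp (t * x) * complex_of_real (exp (- x\<^sup>2 / 2)) =
     complex_of_real (sqrt (2 * pi)) * (std_normal_density x *\<^sub>R iexp (t * x))" for x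
    by (simp add: std_normal_density_def scaleR_conv_of_real)
  have int: "integrable lborel (\<lambda>x. std_normal_density x *\<^sub>R iexp (t * x))"
    by (rule Bochner_Integration.integrable_bound[OF integrable_std_normal_moment[of 0]]) auto
  then show ?I unfolding eq by (rule integrable_mult_right)
  have "(LINT x|lborel. std_normal_density x *\<^sub>R iexp (t * x)) = char std_normal_distribution t"
    unfolding char_def by (subst integral_density) auto
  then show ?E
    unfolding eq integral_mult_right_zero by (simp only: char_std_normal_distribution) simp
qed

text \<open>\<open>lborel\<close> is the image of a product measure over \<open>Basis\<close> under
  the coordinate expansion, and there the integrand factors into one-dimensional Gaussians.\<close>

lemma gaussian_integral:
  fixes k :: "'a::euclidean_space"
  shows "integrable lborel (\<lambda>x::'a. exp (- \<i> * complex_of_real (k \<bullet> x)) * complex_of_real (exp (- (norm x)\<^sup>2 / 2)))" (is ?I)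
    "(LINT x|lborel. exp (- \<i> * complex_of_real (k \<bullet> x)) * complex_of_real (exp (- (norm x)\<^sup>2 / 2))) =
      complex_of_real (sqrt (2 * pi) ^ DIM('a) * exp (- (norm k)\<^sup>2 / 2))" (is ?E)
proof -
  interpret product_sigma_finite "\<lambda>_::'a. lborel :: real measure" ..
  let ?h = "\<lambda>b t. iexp (- (k \<bullet> b) * t) * complex_of_real (exp (- t\<^sup>2 / 2))"
  let ?s = "\<lambda>f. \<Sum>b\<in>Basis. f b *\<^sub>R (b::'a)"
  let ?g = "\<lambda>x::'a. exp (- \<i> * complex_of_real (k \<bullet> x)) * complex_of_real (exp (- (norm x)\<^sup>2 / 2))"
  have nrm: "(norm x)\<^sup>2 = (\<Sum>b\<in>Basis. (x \<bullet> b)\<^sup>2)" for x :: 'a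
    unfolding power2_norm_eq_inner by (subst euclidean_inner) (simp add: power2_eq_square)
  have g: "?g (?s f) = (\<Prod>b\<in>Basis. ?h b (f b))" for f :: "'a \<Rightarrow> real"
  proof -
    have "- \<i> * complex_of_real (k \<bullet> ?s f) = (\<Sum>b\<in>Basis. \<i> * complex_of_real (- (k \<bullet> b) * f b))"
      by (simp add: inner_sum_right sum_distrib_left sum_negf mult_ac)
    moreover have "- (norm (?s f))\<^sup>2 / 2 = (\<Sum>b\<in>Basis. - (f b)\<^sup>2 / 2)"
      by (simp add: nrm inner_sum_left inner_Basis if_distrib sum.delta sum_negf sum_divide_distrib cong: if_cong)
    ultimately show ?thesis by (simp add: exp_sum prod.distrib of_real_prod)
  qed
  have [measurable]: "?s \<in> borel_measurable (Pi\<^sub>M Basis (\<lambda>b. lborel))" by measurable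
  have I: "integrable (Pi\<^sub>M Basis (\<lambda>b. lborel)) (\<lambda>f. \<Prod>b\<in>Basis. ?h b (f b))"
    by (rule product_integrable_prod) (simp_all only: finite_Basis gaussian_integral_real)
  have [measurable]: "?g \<in> borel_measurable borel" by measurable
  show ?I
    by (subst lborel_eq, subst integrable_distr_eq) (use I in \<open>simp_all only: g, simp_all\<close>)
  have "(LINT x|lborel. ?g x) = (LINT f|(Pi\<^sub>M Basis (\<lambda>b. lborel)). (\<Prod>b\<in>Basis. ?h b (f b)))"
    by (subst lborel_eq, subst integral_distr) (simp_all only: g, simp_all)
  also have "\<dots> = (\<Prod>b\<in>Basis. complex_of_real (sqrt (2 * pi) * exp (- (- (k \<bullet> b))\<^sup>2 / 2)))"
    by (subst product_integral_prod) (simp_all only: finite_Basis gaussian_integral_real)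
  also have "\<dots> = complex_of_real (sqrt (2 * pi) ^ DIM('a) * exp (- (norm k)\<^sup>2 / 2))"
    unfolding nrm by (simp add: prod.distrib exp_sum sum_negf sum_divide_distrib flip: of_real_prod)
       (simp add: exp_sum flip: sum_negf)
  finally show ?E .
qed

section \<open>The Fourier transform of integrable functions\<close>

abbreviation fker :: "quat \<Rightarrow> quat \<Rightarrow> complex" where
  "fker k x \<equiv> exp (- \<i> * complex_of_real (k \<bullet> x))"

lemma norm_fker: "norm (fker k x) = 1"
  by (simp add: norm_exp_eq_Re)

lemma cnj_fker: "cnj (fker k x) = fker k (- x)"
  by (simp add: exp_cnj)

lemma fker_add: "fker k (x + y) = fker k x * fker k y"
  by (simp add: inner_add_right distrib_left exp_add[symmetric] algebra_simps)

lemma borel_measurable_lebesgueI: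
  fixes f :: "'a::euclidean_space \<Rightarrow> 'b::topological_space"
  assumes "f \<in> borel_measurable borel" shows "f \<in> borel_measurable lebesgue"
  using assms by (intro measurable_completion) simp

lemma measurable_fker_lebesgue [measurable]: "fker k \<in> borel_measurable lebesgue"
  by (intro borel_measurable_lebesgueI) measurable

lemma fourier_L1_cong_AE:
  assumes [measurable]: "f \<in> borel_measurable lebesgue" "g \<in> borel_measurable lebesgue"
    and ae: "AE x in lebesgue. f x = g x"
  shows "fourier_L1 f = fourier_L1 g"
proof
  fix k
  have "(LINT x|lebesgue. fker k x * f x) = (LINT x|lebesgue. fker k x * g x)"
  proof (rule integral_cong_AE)
    show "(\<lambda>x. fker k x * f x) \<in> borel_measurable lebesgue" "(\<lambda>x. fker k x * g x) \<in> borel_measurable lebesgue"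
      by measurable
  qed (use ae in auto)
  then show "fourier_L1 f k = fourier_L1 g k" by (simp add: fourier_L1_def)
qed

lemma fourier_L1_lborel:
  assumes [measurable]: "\<phi> \<in> borel_measurable borel"
  shows "fourier_L1 \<phi> k = complex_of_real (1 / (2 * pi)\<^sup>2) * (LINT x|lborel. fker k x * \<phi> x)"
  unfolding fourier_L1_def by (subst integral_completion) auto

lemma integrable_representative:
  fixes f :: "'a::euclidean_space \<Rightarrow> 'b::euclidean_space"
  assumes f: "integrable lebesgue f"
  obtains g where "g \<in> borel_measurable borel" "integrable lborel g" "AE x in lebesgue. f x = g x"
proof -
  obtain g where g: "g \<in> borel_measurable borel" "AE x in lebesgue. f x = g x"
    by (rule borel_representative[OF borel_measurable_integrable[OF f]])
  have "integrable lebesgue g"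
    using integrable_cong_AE_imp[OF f borel_measurable_lebesgueI[OF g(1)]] g(2) by (simp add: eq_commute)
  then have "integrable lborel g" using g by (subst (asm) integrable_completion) auto
  with g show ?thesis by (intro that)
qed

lemma L2_representative:
  fixes f :: "quat \<Rightarrow> 'b::euclidean_space"
  assumes f: "f \<in> L2"
  obtains g where "g \<in> borel_measurable borel" "g \<in> L2" "AE x in lebesgue. f x = g x"
proof -
  obtain g where "g \<in> borel_measurable borel" "AE x in lebesgue. f x = g x"
    by (rule borel_representative[OF L2_measurable[OF f]])
  with L2_cong_AE[OF f, of g] show ?thesis by (intro that)
qed

lemma norm_fourier_L1_le:
  assumes "\<phi> \<in> borel_measurable borel" "integrable lborel \<phi>"
  shows "norm (fourier_L1 \<phi> k) \<le> 1 / (2 * pi)\<^sup>2 * (LINT x|lborel. norm (\<phi> x))"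
proof -
  have "norm (LINT x|lborel. fker k x * \<phi> x) \<le> (LINT x|lborel. norm (fker k x * \<phi> x))"
    by (rule integral_norm_bound)
  then show ?thesis
    unfolding fourier_L1_lborel[OF assms(1)]
    by (simp add: norm_mult norm_fker norm_divide norm_power divide_right_mono)
qed

text \<open>A change on a null set leaves the transform unchanged at every point, so it is Borel
  even for an argument that is only Lebesgue measurable.\<close>

lemma fourier_L1_measurable:
  assumes "integrable lebesgue \<phi>"
  shows "fourier_L1 \<phi> \<in> borel_measurable borel"
proof -
  obtain \<phi>0 where [measurable]: "\<phi>0 \<in> borel_measurable borel" and "integrable lborel \<phi>0" and ae: "AE x in lebesgue. \<phi> x = \<phi>0 x"
    by (rule integrable_representative[OF assms])
  have "fourier_L1 \<phi> = (\<lambda>k. complex_of_real (1 / (2 * pi)\<^sup>2) * (LINT x|lborel. fker k x * \<phi>0 x))"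
    using fourier_L1_cong_AE[OF _ _ ae] assms
    by (auto simp: fourier_L1_lborel borel_measurable_lebesgueI borel_measurable_integrable)
  also have "\<dots> \<in> borel_measurable borel"
    by measurable
  finally show ?thesis .
qed

lemma integrable_pair_mult:
  fixes f :: "'a::euclidean_space \<Rightarrow> complex" and g :: "'b::euclidean_space \<Rightarrow> complex"
  assumes [measurable]: "integrable lborel f" "integrable lborel g"
  shows "integrable (lborel \<Otimes>\<^sub>M lborel) (\<lambda>(x, y). f x * g y)"
proof (rule lborel_pair.Fubini_integrable)
  show "integrable lborel (\<lambda>x. LINT y|lborel. norm (case (x, y) of (x, y) \<Rightarrow> f x * g y))"
    using assms by (simp add: norm_mult)
  show "AE x in lborel. integrable lborel (\<lambda>y. case (x, y) of (x, y) \<Rightarrow> f x * g y)"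
    using assms by simp
qed measurable

text \<open>Fubini together with the symmetry of the phase in k and x. The phase has modulus 1, so
  integrability is that of a tensor product.\<close>

lemma fourier_L1_multiplication_borel:
  assumes [measurable]: "\<phi> \<in> borel_measurable borel" "\<psi> \<in> borel_measurable borel"
    and int: "integrable lborel \<phi>" "integrable lborel \<psi>"
  shows "(LINT k|lborel. fourier_L1 \<phi> k * \<psi> k) = (LINT x|lborel. \<phi> x * fourier_L1 \<psi> x)"
proof -
  let ?c = "complex_of_real (1 / (2 * pi)\<^sup>2)"
  let ?f = "\<lambda>k x. fker k x * (\<psi> k * \<phi> x)"
  have I: "integrable (lborel \<Otimes>\<^sub>M lborel) (case_prod ?f)"
    by (rule Bochner_Integration.integrable_bound[OF integrable_pair_mult[OF int(2,1)]])
       (auto simp: norm_mult norm_fker)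
  have "(LINT k|lborel. fourier_L1 \<phi> k * \<psi> k) = (LINT k|lborel. ?c * (LINT x|lborel. ?f k x))"
  proof (rule Bochner_Integration.integral_cong[OF refl])
    fix k
    have "(LINT x|lborel. ?f k x) = (LINT x|lborel. \<psi> k * (fker k x * \<phi> x))"
      by (simp add: mult_ac)
    then show "fourier_L1 \<phi> k * \<psi> k = ?c * (LINT x|lborel. ?f k x)"
      by (simp add: fourier_L1_lborel)
  qed
  also have "\<dots> = ?c * (LINT k|lborel. LINT x|lborel. ?f k x)"
    by (rule integral_mult_right_zero)
  also have "(LINT k|lborel. LINT x|lborel. ?f k x) = (LINT x|lborel. LINT k|lborel. ?f k x)"
    by (rule lborel_pair.Fubini_integral[OF I, symmetric])
  also have "?c * \<dots> = (LINT x|lborel. ?c * (LINT k|lborel. ?f k x))"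
    by (rule integral_mult_right_zero[symmetric])
  also have "\<dots> = (LINT x|lborel. \<phi> x * fourier_L1 \<psi> x)"
  proof (rule Bochner_Integration.integral_cong[OF refl])
    fix x
    have "(LINT k|lborel. ?f k x) = (LINT k|lborel. \<phi> x * (fker x k * \<psi> k))"
      by (simp add: mult_ac inner_commute)
    then show "?c * (LINT k|lborel. ?f k x) = \<phi> x * fourier_L1 \<psi> x"
      by (simp add: fourier_L1_lborel)
  qed
  finally show ?thesis .
qed

text \<open>Substitution x = b + L y. M is the inverse of L and L' its adjoint; for left
  multiplication by a they become left multiplication by \<open>inverse a\<close> and by
  \<open>qcnj a\<close>.\<close>

lemma fourier_L1_similarity_borel:
  fixes L M L' :: "quat \<Rightarrow> quat"
  assumes L: "linear L" "\<And>x. norm (L x) = c * norm x" "c > 0"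
    and M: "linear M" "\<And>x. M (L x) = x"
    and L': "\<And>k x. k \<bullet> L x = L' k \<bullet> x"
    and [measurable]: "\<phi> \<in> borel_measurable borel"
  shows "fourier_L1 (\<lambda>x. \<phi> (M (x - b))) k = complex_of_real (c^4) * fker k b * fourier_L1 \<phi> (L' k)"
proof -
  note [measurable] = linear_borel_measurable[OF M(1)]
  have "(LINT x|lborel. fker k x * \<phi> (M (x - b))) = c^4 *\<^sub>R (LINT x|lborel. fker k (b + L x) * \<phi> (M (b + L x - b)))"
    by (rule integral_similarity[OF L]) measurable
  also have "(LINT x|lborel. fker k (b + L x) * \<phi> (M (b + L x - b))) = (LINT x|lborel. fker k b * (fker (L' k) x * \<phi> x))"
    by (simp only: fker_add L' M(2) add_diff_cancel_left' mult.assoc)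
  also have "\<dots> = fker k b * (LINT x|lborel. fker (L' k) x * \<phi> x)"
    by (rule integral_mult_right_zero)
  finally show ?thesis
    by (simp add: fourier_L1_lborel scaleR_conv_of_real)
qed

lemma fourier_L1_similarity:
  fixes L M L' :: "quat \<Rightarrow> quat"
  assumes L: "linear L" "\<And>x. norm (L x) = c * norm x" "c > 0"
    and M: "linear M" "\<And>x. M (L x) = x" "\<And>x. L (M x) = x"
    and L': "\<And>k x. k \<bullet> L x = L' k \<bullet> x"
    and phi: "\<phi> \<in> borel_measurable lebesgue"
  shows "(\<lambda>x. \<phi> (M (x - b))) \<in> borel_measurable lebesgue"
    "fourier_L1 (\<lambda>x. \<phi> (M (x - b))) k = complex_of_real (c^4) * fker k b * fourier_L1 \<phi> (L' k)"
proof -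
  note [measurable] = linear_borel_measurable[OF M(1)]
  have nM: "norm (M x) = 1/c * norm x" for x
    using L(2)[of "M x"] L(3) by (simp add: M(3))
  obtain \<phi>0 where \<phi>0[measurable]: "\<phi>0 \<in> borel_measurable borel" and ae: "AE x in lebesgue. \<phi> x = \<phi>0 x"
    by (rule borel_representative[OF phi])
  have "AE x in lborel. \<phi> (- M b + M x) = \<phi>0 (- M b + M x)"
    using ae L(3) unfolding AE_completion_iff by (intro AE_similarity[OF M(1) nM]) auto
  then have ae': "AE x in lebesgue. \<phi>0 (M (x - b)) = \<phi> (M (x - b))"
    unfolding AE_completion_iff by (simp add: linear_diff[OF M(1)] eq_commute)
  have m: "(\<lambda>x. \<phi>0 (M (x - b))) \<in> borel_measurable lebesgue"
    by (intro borel_measurable_lebesgueI) measurable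
  show m': "(\<lambda>x. \<phi> (M (x - b))) \<in> borel_measurable lebesgue"
    by (rule borel_measurable_lebesgue_AE[OF m ae'])
  have "fourier_L1 (\<lambda>x. \<phi> (M (x - b))) k = fourier_L1 (\<lambda>x. \<phi>0 (M (x - b))) k"
    using fourier_L1_cong_AE[OF m m' ae'] by simp
  also have "\<dots> = complex_of_real (c^4) * fker k b * fourier_L1 \<phi>0 (L' k)"
    by (rule fourier_L1_similarity_borel[OF L M(1,2) L']) measurable
  also have "fourier_L1 \<phi>0 = fourier_L1 \<phi>"
    by (rule fourier_L1_cong_AE[symmetric, OF phi borel_measurable_lebesgueI[OF \<phi>0] ae])
  finally show "fourier_L1 (\<lambda>x. \<phi> (M (x - b))) k = complex_of_real (c^4) * fker k b * fourier_L1 \<phi> (L' k)" .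
qed

definition gaussian :: "quat \<Rightarrow> complex" where
  "gaussian x = complex_of_real (exp (- (norm x)\<^sup>2 / 2))"

lemma gaussian_measurable [measurable]: "gaussian \<in> borel_measurable borel"
  unfolding gaussian_def by measurable

lemma gaussian_integrable: "integrable lborel gaussian"
  and gaussian_integral_0: "(LINT x|lborel. gaussian x) = complex_of_real ((2 * pi)\<^sup>2)"
  using gaussian_integral[of "0::quat"] unfolding gaussian_def
  by (simp_all add: power4_eq_xxxx power2_eq_square flip: of_real_mult)

lemma fourier_L1_gaussian: "fourier_L1 gaussian k = gaussian k"
proof -
  have "sqrt (2 * pi) ^ 4 = (2 * pi)\<^sup>2"
    by (simp add: power4_eq_xxxx power2_eq_square)
  then show ?thesis
    using gaussian_integral(2)[of k]
    by (subst fourier_L1_lborel) (simp_all add: gaussian_def)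
qed

section \<open>Plancherel's theorem\<close>

text \<open>The convolution of \<phi> with its conjugate reflection. Plancherel's identity is
  Fourier inversion for this function at the single point 0, where its value is the squared norm of
  \<phi>.\<close>

definition autocorrelation :: "(quat \<Rightarrow> complex) \<Rightarrow> quat \<Rightarrow> complex" where
  "autocorrelation \<phi> z = (LINT y|lborel. \<phi> (y + z) * cnj (\<phi> y))"

context
  fixes \<phi> :: "quat \<Rightarrow> complex"
  assumes phi[measurable]: "\<phi> \<in> borel_measurable borel"
    and int: "integrable lborel \<phi>" and phiL2: "\<phi> \<in> L2"
begin

lemma autocorrelation_pair_integrable:
  "integrable (lborel \<Otimes>\<^sub>M lborel) (\<lambda>(y, z). \<phi> (y + z) * cnj (\<phi> y))"
proof (rule lborel_pair.Fubini_integrable)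
  have tr: "(LINT z|lborel. norm (\<phi> (y + z))) = (LINT z|lborel. norm (\<phi> z))" for y
    using integral_translate[of "\<lambda>z. norm (\<phi> z)" y] by (simp add: add.commute)
  show "integrable lborel (\<lambda>y. LINT z|lborel. norm (case (y, z) of (y, z) \<Rightarrow> \<phi> (y + z) * cnj (\<phi> y)))"
    using int by (simp add: norm_mult tr)
  have "integrable lborel (\<lambda>z. \<phi> (y + z))" for y
    using integrable_translate[OF int, of y] by (simp add: add.commute)
  then show "AE y in lborel. integrable lborel (\<lambda>z. case (y, z) of (y, z) \<Rightarrow> \<phi> (y + z) * cnj (\<phi> y))"
    by simp
qed measurable

lemma autocorrelation_measurable [measurable]: "autocorrelation \<phi> \<in> borel_measurable borel"
  unfolding autocorrelation_def by measurable

lemma autocorrelation_integrable: "integrable lborel (autocorrelation \<phi>)"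
  unfolding autocorrelation_def by (rule lborel_pair.integrable_snd[OF autocorrelation_pair_integrable])

text \<open>The transform of a convolution is a product. Its two factors carry (2 pi)^(-2) each, the
  left-hand side only one, which leaves (2 pi)^2.\<close>

lemma fourier_L1_autocorrelation:
  "fourier_L1 (autocorrelation \<phi>) k = complex_of_real ((2 * pi)\<^sup>2 * (norm (fourier_L1 \<phi> k))\<^sup>2)"
proof -
  let ?A = "LINT x|lborel. fker k x * \<phi> x"
  let ?f = "\<lambda>y z. fker k z * (\<phi> (y + z) * cnj (\<phi> y))"
  have I: "integrable (lborel \<Otimes>\<^sub>M lborel) (case_prod ?f)"
    by (rule Bochner_Integration.integrable_bound[OF autocorrelation_pair_integrable])
       (auto simp: norm_mult norm_fker)
  have "(LINT z|lborel. fker k z * autocorrelation \<phi> z) = (LINT z|lborel. LINT y|lborel. ?f y z)"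
    unfolding autocorrelation_def integral_mult_right_zero ..
  also have "\<dots> = (LINT y|lborel. LINT z|lborel. ?f y z)"
    by (rule lborel_pair.Fubini_integral[OF I])
  also have "\<dots> = (LINT y|lborel. ?A * cnj (fker k y * \<phi> y))"
  proof (rule Bochner_Integration.integral_cong[OF refl])
    fix y
    \<comment> \<open>After the shift the phase is that of z - y; it splits into the phase of z and
      the conjugate of the phase of y.\<close>
    let ?h = "\<lambda>z. fker k (z + - y) * \<phi> z * cnj (\<phi> y)"
    have "(LINT z|lborel. ?f y z) = (LINT z|lborel. ?h (z + y))"
      by (simp add: add.commute mult_ac)
    also have "\<dots> = (LINT z|lborel. ?h z)"
      by (rule integral_translate) measurable
    also have "\<dots> = (LINT z|lborel. (fker k z * \<phi> z) * cnj (fker k y * \<phi> y))"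
      by (simp only: fker_add cnj_fker complex_cnj_mult mult_ac)
    also have "\<dots> = ?A * cnj (fker k y * \<phi> y)"
      by (rule integral_mult_left_zero)
    finally show "(LINT z|lborel. ?f y z) = ?A * cnj (fker k y * \<phi> y)" .
  qed
  also have "\<dots> = ?A * (LINT y|lborel. cnj (fker k y * \<phi> y))"
    by (rule integral_mult_right_zero)
  also have "(LINT y|lborel. cnj (fker k y * \<phi> y)) = cnj ?A"
    by (rule Bochner_Integration.integral_cnj)
  also have "?A * cnj ?A = complex_of_real ((norm ?A)\<^sup>2)"
    by (rule complex_norm_square[symmetric, unfolded of_real_power[symmetric]])
  finally show ?thesis
    by (simp add: fourier_L1_lborel norm_mult norm_divide norm_power power_divide power_mult_distrib power2_eq_square)
qed

lemma L2_translate: "(\<lambda>y. \<phi> (y + z)) \<in> L2" "sqnorm (\<lambda>y. \<phi> (y + z)) = sqnorm \<phi>"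
proof -
  show eq: "sqnorm (\<lambda>y. \<phi> (y + z)) = sqnorm \<phi>"
    unfolding sqnorm_def nn_integral_completion
    by (rule nn_integral_translate[where f="\<lambda>y. ennreal ((norm (\<phi> y))\<^sup>2)"]) measurable
  have "(\<lambda>y. \<phi> (y + z)) \<in> borel_measurable lebesgue"
    by (intro borel_measurable_lebesgueI) measurable
  then show "(\<lambda>y. \<phi> (y + z)) \<in> L2"
    using L2_finite[OF phiL2] by (simp add: L2_iff eq)
qed

lemma autocorrelation_cip: "autocorrelation \<phi> z = cip \<phi> (\<lambda>y. \<phi> (y + z))"
  unfolding cip_def autocorrelation_def by (subst integral_completion) (auto simp: mult.commute)

text \<open>Cauchy-Schwarz, a translate having the norm of \<phi>. The bound provides the dominating
  function when the argument is dilated to 0.\<close>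

lemma autocorrelation_bound: "norm (autocorrelation \<phi> z) \<le> enn2real (sqnorm \<phi>)"
proof -
  obtain s where s: "sqnorm \<phi> = ennreal s" "s \<ge> 0"
    using L2_finite[OF phiL2] by (cases "sqnorm \<phi>") auto
  have "ennreal ((norm (autocorrelation \<phi> z))\<^sup>2) \<le> sqnorm \<phi> * sqnorm \<phi>"
    unfolding autocorrelation_cip cip_def
    using integrable_pairing(2)[OF L2_cnj[OF phiL2] L2_translate(1)] by (simp add: L2_translate sqnorm_cnj)
  also have "\<dots> = ennreal (s\<^sup>2)" using s by (simp add: ennreal_mult power2_eq_square)
  finally have "(norm (autocorrelation \<phi> z))\<^sup>2 \<le> s\<^sup>2" by (subst (asm) ennreal_le_iff) auto
  then show ?thesis using s power2_le_imp_le by auto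
qed

lemma autocorrelation_0: "autocorrelation \<phi> 0 = complex_of_real (enn2real (sqnorm \<phi>))"
proof -
  have "(LINT x|lebesgue. (norm (\<phi> x))\<^sup>2) \<ge> 0" by (rule Bochner_Integration.integral_nonneg) simp
  then show ?thesis
    unfolding autocorrelation_cip cip_def sqnorm_eq_integral[OF phiL2]
    by (simp only: add_0_right complex_norm_square_integral enn2real_ennreal)
qed

text \<open>Translation is known to be continuous in L^1, whereas an L^2 pairing has to be
  controlled. The fixed factor \<phi> is therefore split by size: the bounded part is paired with a
  difference that is small in L^1, and the unbounded part has small L^2 norm for large M, so that
  Cauchy-Schwarz treats it uniformly in the translation.\<close>

lemma autocorrelation_tendsto:
  assumes z: "z \<longlonglongrightarrow> 0"
  shows "(\<lambda>n. autocorrelation \<phi> (z n)) \<longlonglongrightarrow> autocorrelation \<phi> 0"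
proof -
  obtain S where S: "sqnorm \<phi> = ennreal S" "S \<ge> 0"
    using L2_finite[OF phiL2] by (cases "sqnorm \<phi>") auto
  define hi where "hi (M::nat) y = (if norm (\<phi> y) > real M then \<phi> y else 0)" for M y
  define lo where "lo (M::nat) y = (if norm (\<phi> y) > real M then 0 else \<phi> y)" for M y
  have [measurable]: "hi M \<in> borel_measurable borel" "lo M \<in> borel_measurable borel" for M
    unfolding hi_def lo_def by measurable
  have hiL2: "hi M \<in> L2" and loL2: "lo M \<in> L2" for M
    by (rule L2_bound[OF phiL2]; (rule borel_measurable_lebesgueI)?; simp add: hi_def lo_def)+
  have hi0: "(\<lambda>M. sqnorm (hi M)) \<longlonglongrightarrow> 0"
  proof -
    have "(\<lambda>M. \<integral>\<^sup>+y. ennreal ((norm (hi M y))\<^sup>2) \<partial>lebesgue) \<longlonglongrightarrow> (\<integral>\<^sup>+y. 0 \<partial>(lebesgue :: quat measure))"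
    proof (rule nn_integral_dominated_convergence[where w="\<lambda>y. ennreal ((norm (\<phi> y))\<^sup>2)"])
      show "(\<integral>\<^sup>+y. ennreal ((norm (\<phi> y))\<^sup>2) \<partial>lebesgue) < \<infinity>"
        using L2_finite[OF phiL2] by (simp add: sqnorm_def)
      show "AE y in lebesgue. (\<lambda>M. ennreal ((norm (hi M y))\<^sup>2)) \<longlonglongrightarrow> 0"
      proof (rule AE_I2)
        fix y :: quat
        obtain N :: nat where N: "norm (\<phi> y) < real N" using reals_Archimedean2 by blast
        have "ennreal ((norm (hi M y))\<^sup>2) = 0" if "M \<ge> N" for M
          using that N by (auto simp: hi_def)
        then show "(\<lambda>M. ennreal ((norm (hi M y))\<^sup>2)) \<longlonglongrightarrow> 0"
          by (intro tendsto_eventually) (auto simp: eventually_sequentially)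
      qed
    qed (auto simp: hi_def intro!: borel_measurable_lebesgueI)
    then show ?thesis by (simp add: sqnorm_def)
  qed
  let ?d = "\<lambda>n y. \<phi> (y + z n) - \<phi> y"
  have dL2: "?d n \<in> L2" for n by (intro L2_diff L2_translate phiL2)
  \<comment> \<open>2 S + 2 S from the quadratic triangle inequality, since the translate has the
    same norm.\<close>
  have sqd: "sqnorm (?d n) \<le> ennreal (4 * S)" for n
    using sqnorm_diff[OF L2_measurable[OF L2_translate(1)[of "z n"]] L2_measurable[OF phiL2]] S
    by (simp add: L2_translate flip: ennreal_plus ennreal_numeral ennreal_mult)
  have diff: "autocorrelation \<phi> (z n) - autocorrelation \<phi> 0 =
      (LINT y|lebesgue. cnj (lo M y) * ?d n y) + (LINT y|lebesgue. cnj (hi M y) * ?d n y)" for n M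
  proof -
    have "autocorrelation \<phi> (z n) - autocorrelation \<phi> 0 =
       (LINT y|lebesgue. cnj (\<phi> y) * \<phi> (y + z n) - cnj (\<phi> y) * \<phi> y)"
      unfolding autocorrelation_cip cip_def
      using integrable_pairing(1)[OF L2_cnj[OF phiL2] L2_translate(1)] integrable_pairing(1)[OF L2_cnj[OF phiL2] phiL2]
      by (simp add: Bochner_Integration.integral_diff)
    also have "\<dots> = (LINT y|lebesgue. cnj (lo M y) * ?d n y + cnj (hi M y) * ?d n y)"
      by (intro Bochner_Integration.integral_cong) (auto simp: hi_def lo_def algebra_simps)
    also have "\<dots> = (LINT y|lebesgue. cnj (lo M y) * ?d n y) + (LINT y|lebesgue. cnj (hi M y) * ?d n y)"
      by (intro Bochner_Integration.integral_add integrable_pairing(1) L2_cnj loL2 hiL2 dL2)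
    finally show ?thesis .
  qed
  have "(\<lambda>n. norm (autocorrelation \<phi> (z n) - autocorrelation \<phi> 0)) \<longlonglongrightarrow> 0"
  proof (rule tendsto_0_approx)
    fix e :: real assume e: "e > 0"
    have "(\<lambda>M. ennreal (4 * S) * sqnorm (hi M)) \<longlonglongrightarrow> ennreal (4 * S) * 0"
      by (intro tendsto_mult_ennreal hi0 tendsto_const) auto
    then have "\<forall>\<^sub>F M in sequentially. ennreal (4 * S) * sqnorm (hi M) < ennreal (e\<^sup>2)"
      using e by (intro order_tendstoD(2)) auto
    then obtain M where M: "ennreal (4 * S) * sqnorm (hi M) < ennreal (e\<^sup>2)"
      by (auto simp: eventually_sequentially)
    have 1: "norm (LINT y|lebesgue. cnj (hi M y) * ?d n y) \<le> e" for n
    proof -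
      have "ennreal ((norm (LINT y|lebesgue. cnj (hi M y) * ?d n y))\<^sup>2) \<le> sqnorm (hi M) * sqnorm (?d n)"
        using integrable_pairing(2)[OF L2_cnj[OF hiL2] dL2] by (simp add: sqnorm_cnj)
      also have "\<dots> \<le> sqnorm (hi M) * ennreal (4 * S)" by (intro mult_left_mono sqd) simp
      also have "\<dots> < ennreal (e\<^sup>2)" using M by (simp add: mult.commute)
      finally have "(norm (LINT y|lebesgue. cnj (hi M y) * ?d n y))\<^sup>2 \<le> e\<^sup>2"
        by (subst (asm) ennreal_less_iff) auto
      then show ?thesis using e power2_le_imp_le by auto
    qed
    have 2: "norm (LINT y|lebesgue. cnj (lo M y) * ?d n y) \<le> real M * (LINT y|lborel. norm (?d n y))" for n
    proof -
      have i: "integrable lborel (?d n)"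
        using integrable_translate[OF int, of "z n"] int by simp
      have "(LINT y|lebesgue. cnj (lo M y) * ?d n y) = (LINT y|lborel. cnj (lo M y) * ?d n y)"
        by (intro integral_completion) measurable
      also have "norm \<dots> \<le> (LINT y|lborel. real M * norm (?d n y))"
      proof (rule Bochner_Integration.integral_norm_bound_integral)
        show b: "norm (cnj (lo M y) * ?d n y) \<le> real M * norm (?d n y)" for y
          unfolding norm_mult by (intro mult_right_mono) (auto simp: lo_def)
        show i': "integrable lborel (\<lambda>y. real M * norm (?d n y))" using i by simp
        show "integrable lborel (\<lambda>y. cnj (lo M y) * ?d n y)"
          by (rule Bochner_Integration.integrable_bound[OF i']) (use b in auto)
      qed
      finally show ?thesis by simp
    qed
    have "(\<lambda>n. real M * (LINT y|lborel. norm (?d n y))) \<longlonglongrightarrow> real M * 0"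
      by (intro tendsto_mult translation_continuous_L1 int z tendsto_const)
    moreover have "norm (autocorrelation \<phi> (z n) - autocorrelation \<phi> 0) \<le> e + real M * (LINT y|lborel. norm (?d n y))" for n
      unfolding diff[of n M] using norm_triangle_ineq 1[of n] 2[of n] by (smt (verit))
    ultimately show "\<exists>v. v \<longlonglongrightarrow> 0 \<and> (\<forall>n. norm (autocorrelation \<phi> (z n) - autocorrelation \<phi> 0) \<le> e + v n)"
      by (intro exI[of _ "\<lambda>n. real M * (LINT y|lborel. norm (?d n y))"]) auto
  qed simp
  then show ?thesis by (simp add: tendsto_norm_zero_iff LIM_zero_iff)
qed

text \<open>The multiplication formula for the dilated autocorrelation and the Gaussian. Dilation
  produces (1/s)^4 on the Fourier side, which the substitution of s k for k cancels.\<close>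

lemma gaussian_summation:
  assumes s: "s > 0"
  shows "(2 * pi)\<^sup>2 * (LINT k|lborel. (norm (fourier_L1 \<phi> k))\<^sup>2 * exp (- (norm (s *\<^sub>R k))\<^sup>2 / 2))
     = Re (LINT x|lborel. autocorrelation \<phi> (s *\<^sub>R x) * gaussian x)"
proof -
  have [measurable]: "fourier_L1 \<phi> \<in> borel_measurable borel"
    using int by (intro fourier_L1_measurable) (simp add: integrable_completion)
  let ?\<psi> = "autocorrelation \<phi>"
  have lin: "linear (\<lambda>x. r *\<^sub>R (x::quat))" for r by (intro linearI) (auto simp: algebra_simps)
  have F\<psi>: "fourier_L1 ?\<psi> \<in> borel_measurable borel"
    using autocorrelation_integrable by (intro fourier_L1_measurable) (simp add: integrable_completion)
  note [measurable] = F\<psi>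
  have cov: "fourier_L1 (\<lambda>x. ?\<psi> (s *\<^sub>R x)) k = complex_of_real ((1/s)^4) * fourier_L1 ?\<psi> ((1/s) *\<^sub>R k)" for k
    using fourier_L1_similarity_borel[OF lin[of "1/s"], of "1/s" "\<lambda>x. s *\<^sub>R x" "\<lambda>x. (1/s) *\<^sub>R x" ?\<psi> 0 k] s lin[of s]
    by simp
  have i\<psi>: "integrable lborel (\<lambda>x. ?\<psi> (s *\<^sub>R x))"
    using integrable_similarity_iff[OF lin[of s] _ s, of ?\<psi> 0] s autocorrelation_integrable by simp
  have "(LINT x|lborel. ?\<psi> (s *\<^sub>R x) * gaussian x) = (LINT x|lborel. ?\<psi> (s *\<^sub>R x) * fourier_L1 gaussian x)"
    by (simp add: fourier_L1_gaussian)
  also have "\<dots> = (LINT k|lborel. fourier_L1 (\<lambda>x. ?\<psi> (s *\<^sub>R x)) k * gaussian k)"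
    by (rule fourier_L1_multiplication_borel[symmetric]) (use i\<psi> gaussian_integrable in simp_all)
  also have "\<dots> = (s^4) *\<^sub>R (LINT k|lborel. fourier_L1 (\<lambda>x. ?\<psi> (s *\<^sub>R x)) (0 + s *\<^sub>R k) * gaussian (0 + s *\<^sub>R k))"
    by (rule integral_similarity[OF lin[of s]]) (use s in \<open>auto simp: cov\<close>)
  also have "\<dots> = (LINT k|lborel. (s^4) *\<^sub>R (fourier_L1 (\<lambda>x. ?\<psi> (s *\<^sub>R x)) (0 + s *\<^sub>R k) * gaussian (0 + s *\<^sub>R k)))"
    by (rule integral_scaleR_right[symmetric])
  also have "\<dots> = (LINT k|lborel. complex_of_real ((2 * pi)\<^sup>2 * ((norm (fourier_L1 \<phi> k))\<^sup>2 * exp (- (norm (s *\<^sub>R k))\<^sup>2 / 2))))"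
  proof (rule Bochner_Integration.integral_cong[OF refl])
    fix k
    show "(s^4) *\<^sub>R (fourier_L1 (\<lambda>x. ?\<psi> (s *\<^sub>R x)) (0 + s *\<^sub>R k) * gaussian (0 + s *\<^sub>R k))
      = complex_of_real ((2 * pi)\<^sup>2 * ((norm (fourier_L1 \<phi> k))\<^sup>2 * exp (- (norm (s *\<^sub>R k))\<^sup>2 / 2)))"
      unfolding cov fourier_L1_autocorrelation gaussian_def
      using s by (simp add: scaleR_conv_of_real[where 'a=complex] power_divide)
  qed
  also have "\<dots> = complex_of_real ((2 * pi)\<^sup>2 * (LINT k|lborel. (norm (fourier_L1 \<phi> k))\<^sup>2 * exp (- (norm (s *\<^sub>R k))\<^sup>2 / 2)))"
    by (subst integral_complex_of_real) simp
  finally show ?thesis by simp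
qed

text \<open>On the frequency side the Gaussian weights increase to 1, and monotone convergence in
  \<open>ennreal\<close> applies before finiteness is known. On the space side dominated convergence
  yields the autocorrelation at 0 times the integral (2 pi)^2 of the Gaussian.\<close>

lemma fourier_L1_isometry_borel: "sqnorm (fourier_L1 \<phi>) = sqnorm \<phi>"
proof -
  have [measurable]: "fourier_L1 \<phi> \<in> borel_measurable borel"
    using int by (intro fourier_L1_measurable) (simp add: integrable_completion)
  define s where "s n = 1 / real (Suc n)" for n
  have s: "s n > 0" "s \<longlonglongrightarrow> 0" for n
    unfolding s_def by (simp, rule LIMSEQ_Suc[OF lim_1_over_n])
  let ?F = "\<lambda>k. (norm (fourier_L1 \<phi> k))\<^sup>2"
  let ?g = "\<lambda>n k. exp (- (norm (s n *\<^sub>R k))\<^sup>2 / 2) :: real"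
  let ?I = "\<lambda>n. LINT k|lborel. ?F k * ?g n k"
  \<comment> \<open>No Plancherel enters here: the transform of an L^1 function is bounded, and the
    dilated Gaussian is integrable.\<close>
  have int_n: "integrable lborel (\<lambda>k. ?F k * ?g n k)" for n
  proof -
    let ?B = "(1 / (2 * pi)\<^sup>2 * (LINT x|lborel. norm (\<phi> x)))\<^sup>2"
    have lin: "linear (\<lambda>x. s n *\<^sub>R (x::quat))" by (intro linearI) (auto simp: algebra_simps)
    have "integrable lborel (\<lambda>k. gaussian (s n *\<^sub>R k))"
      using integrable_similarity_iff[OF lin _ s(1)[of n], of gaussian 0] s(1)[of n] gaussian_integrable by simp
    then have "integrable lborel (\<lambda>k. ?B * norm (gaussian (s n *\<^sub>R k)))" by simp
    then show ?thesis
    proof (rule Bochner_Integration.integrable_bound)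
      show "AE k in lborel. norm (?F k * ?g n k) \<le> norm (?B * norm (gaussian (s n *\<^sub>R k)))"
      proof (rule AE_I2)
        fix k
        have "?F k \<le> ?B" by (intro power_mono norm_fourier_L1_le phi int) simp
        then have "?F k * ?g n k \<le> ?B * ?g n k" by (intro mult_right_mono) auto
        then show "norm (?F k * ?g n k) \<le> norm (?B * norm (gaussian (s n *\<^sub>R k)))"
          by (simp add: gaussian_def abs_mult)
      qed
    qed measurable
  qed
  have "(\<lambda>n. \<integral>\<^sup>+k. ennreal (?F k * ?g n k) \<partial>lborel) \<longlonglongrightarrow> (\<integral>\<^sup>+k. ennreal (?F k) \<partial>lborel)"
  proof (rule nn_integral_LIMSEQ)
    show "incseq (\<lambda>n k. ennreal (?F k * ?g n k))"
    proof (intro incseq_SucI le_funI ennreal_leI mult_left_mono)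
      fix n k
      have "s (Suc n) \<le> s n" unfolding s_def by (simp add: frac_le)
      then have "(norm (s (Suc n) *\<^sub>R k))\<^sup>2 \<le> (norm (s n *\<^sub>R k))\<^sup>2"
        using s(1)[of n] s(1)[of "Suc n"] by (intro power_mono) (auto intro: mult_right_mono)
      then show "?g n k \<le> ?g (Suc n) k" by simp
    qed simp
    show "(\<lambda>n. ennreal (?F k * ?g n k)) \<longlonglongrightarrow> ennreal (?F k)" for k
    proof -
      have "(\<lambda>n. ?F k * ?g n k) \<longlonglongrightarrow> ?F k * exp (- (norm (0 *\<^sub>R k))\<^sup>2 / 2)"
        by (intro tendsto_intros s) auto
      then show ?thesis by (intro tendsto_ennrealI) simp
    qed
  qed measurable
  moreover have "(\<integral>\<^sup>+k. ennreal (?F k * ?g n k) \<partial>lborel) = ennreal (?I n)" for n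
    by (intro nn_integral_eq_integral int_n) auto
  ultimately have lim1: "(\<lambda>n. ennreal (?I n)) \<longlonglongrightarrow> sqnorm (fourier_L1 \<phi>)"
    by (simp add: sqnorm_def nn_integral_completion)
  let ?J = "\<lambda>n. LINT x|lborel. autocorrelation \<phi> (s n *\<^sub>R x) * gaussian x"
  have "?J \<longlonglongrightarrow> (LINT x|lborel. autocorrelation \<phi> 0 * gaussian x)"
  proof (rule integral_dominated_convergence[where w="\<lambda>x. enn2real (sqnorm \<phi>) * norm (gaussian x)"])
    show "integrable lborel (\<lambda>x. enn2real (sqnorm \<phi>) * norm (gaussian x))"
      using gaussian_integrable by simp
    show "AE x in lborel. (\<lambda>n. autocorrelation \<phi> (s n *\<^sub>R x) * gaussian x) \<longlonglongrightarrow> autocorrelation \<phi> 0 * gaussian x"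
    proof (intro AE_I2 tendsto_mult tendsto_const autocorrelation_tendsto)
      fix x :: quat show "(\<lambda>n. s n *\<^sub>R x) \<longlonglongrightarrow> 0"
        using tendsto_scaleR[OF s(2) tendsto_const[of x]] by simp
    qed
    show "AE x in lborel. norm (autocorrelation \<phi> (s n *\<^sub>R x) * gaussian x) \<le> enn2real (sqnorm \<phi>) * norm (gaussian x)" for n
      unfolding norm_mult by (intro AE_I2 mult_right_mono autocorrelation_bound) simp
  qed measurable
  then have "(\<lambda>n. Re (?J n) / (2 * pi)\<^sup>2) \<longlonglongrightarrow> Re (LINT x|lborel. autocorrelation \<phi> 0 * gaussian x) / (2 * pi)\<^sup>2"
    by (intro tendsto_intros) auto
  moreover have "Re (LINT x|lborel. autocorrelation \<phi> 0 * gaussian x) / (2 * pi)\<^sup>2 = enn2real (sqnorm \<phi>)"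
    by (simp add: gaussian_integral_0 autocorrelation_0 flip: of_real_mult)
  moreover have "?I n = Re (?J n) / (2 * pi)\<^sup>2" for n
    using gaussian_summation[OF s(1)[of n]] by (simp add: field_simps)
  ultimately have "?I \<longlonglongrightarrow> enn2real (sqnorm \<phi>)" by simp
  then have "(\<lambda>n. ennreal (?I n)) \<longlonglongrightarrow> ennreal (enn2real (sqnorm \<phi>))" by (rule tendsto_ennrealI)
  also have "ennreal (enn2real (sqnorm \<phi>)) = sqnorm \<phi>"
    using L2_finite[OF phiL2] by (intro ennreal_enn2real) simp
  finally show ?thesis using lim1 by (rule LIMSEQ_unique[rotated])
qed

end

lemma fourier_L1_isometry:
  assumes phi: "\<phi> \<in> L2" "integrable lebesgue \<phi>"
  shows "fourier_L1 \<phi> \<in> L2" "sqnorm (fourier_L1 \<phi>) = sqnorm \<phi>"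
proof -
  obtain g where g: "g \<in> borel_measurable borel" "integrable lborel g" and ae: "AE x in lebesgue. \<phi> x = g x"
    by (rule integrable_representative[OF phi(2)])
  have eq: "fourier_L1 \<phi> = fourier_L1 g"
    by (rule fourier_L1_cong_AE[OF borel_measurable_integrable[OF phi(2)] borel_measurable_lebesgueI[OF g(1)] ae])
  have "sqnorm (fourier_L1 g) = sqnorm g"
    using L2_cong_AE[OF phi(1) ae] g by (intro fourier_L1_isometry_borel)
  also have "sqnorm g = sqnorm \<phi>"
    using ae by (intro sqnorm_cong_AE) (auto elim: eventually_mono)
  finally show s: "sqnorm (fourier_L1 \<phi>) = sqnorm \<phi>" by (simp add: eq)
  show "fourier_L1 \<phi> \<in> L2"
    using L2_finite[OF phi(1)] borel_measurable_lebesgueI[OF fourier_L1_measurable[OF phi(2)]]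
    by (simp add: L2_iff s)
qed

lemma fourier_L1_multiplication:
  assumes "integrable lebesgue \<phi>" "integrable lebesgue \<psi>"
  shows "(LINT k|lebesgue. fourier_L1 \<phi> k * \<psi> k) = (LINT x|lebesgue. \<phi> x * fourier_L1 \<psi> x)"
proof -
  obtain f where f[measurable]: "f \<in> borel_measurable borel" and fi: "integrable lborel f" and fae: "AE x in lebesgue. \<phi> x = f x"
    by (rule integrable_representative[OF assms(1)])
  obtain g where g[measurable]: "g \<in> borel_measurable borel" and gi: "integrable lborel g" and gae: "AE x in lebesgue. \<psi> x = g x"
    by (rule integrable_representative[OF assms(2)])
  note m1 = borel_measurable_integrable[OF assms(1)] and m2 = borel_measurable_integrable[OF assms(2)]
  note [measurable] = m1 m2
  note [measurable] = borel_measurable_lebesgueI[OF f] borel_measurable_lebesgueI[OF g]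
  have F: "fourier_L1 \<phi> = fourier_L1 f" by (rule fourier_L1_cong_AE[OF m1 borel_measurable_lebesgueI[OF f] fae])
  have G: "fourier_L1 \<psi> = fourier_L1 g" by (rule fourier_L1_cong_AE[OF m2 borel_measurable_lebesgueI[OF g] gae])
  have mF: "fourier_L1 f \<in> borel_measurable borel" using fourier_L1_measurable[OF assms(1)] by (simp add: F)
  have mG: "fourier_L1 g \<in> borel_measurable borel" using fourier_L1_measurable[OF assms(2)] by (simp add: G)
  note [measurable] = mF mG borel_measurable_lebesgueI[OF mF] borel_measurable_lebesgueI[OF mG]
  have "(LINT k|lebesgue. fourier_L1 \<phi> k * \<psi> k) = (LINT k|lebesgue. fourier_L1 f k * g k)"
    unfolding F
  proof (rule integral_cong_AE)
    show "AE k in lebesgue. fourier_L1 f k * \<psi> k = fourier_L1 f k * g k" using gae by (auto elim: eventually_mono)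
  qed measurable
  also have "\<dots> = (LINT k|lborel. fourier_L1 f k * g k)" by (rule integral_completion) measurable
  also have "\<dots> = (LINT x|lborel. f x * fourier_L1 g x)"
    by (rule fourier_L1_multiplication_borel[OF f g fi gi])
  also have "\<dots> = (LINT x|lebesgue. f x * fourier_L1 g x)" by (rule integral_completion[symmetric]) measurable
  also have "\<dots> = (LINT x|lebesgue. \<phi> x * fourier_L1 \<psi> x)"
    unfolding G
  proof (rule integral_cong_AE)
    show "AE k in lebesgue. f k * fourier_L1 g k = \<phi> k * fourier_L1 g k" using fae by (auto elim: eventually_mono)
  qed measurable
  finally show ?thesis .
qed

lemma fourier_L1_linear:
  assumes "integrable lebesgue \<phi>" "integrable lebesgue \<psi>"
  shows "fourier_L1 (\<lambda>x. \<phi> x + c * \<psi> x) k = fourier_L1 \<phi> k + c * fourier_L1 \<psi> k"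
proof -
  have i: "integrable lebesgue (\<lambda>x. fker k x * f x)" if f: "integrable lebesgue f" for f
  proof (rule Bochner_Integration.integrable_bound[OF f])
    note [measurable] = borel_measurable_integrable[OF f]
    show "(\<lambda>x. fker k x * f x) \<in> borel_measurable lebesgue" by measurable
  qed (simp add: norm_mult norm_fker)
  have "(LINT x|lebesgue. fker k x * (\<phi> x + c * \<psi> x)) = (LINT x|lebesgue. fker k x * \<phi> x + c * (fker k x * \<psi> x))"
    by (simp add: algebra_simps)
  also have "\<dots> = (LINT x|lebesgue. fker k x * \<phi> x) + c * (LINT x|lebesgue. fker k x * \<psi> x)"
    using i[OF assms(1)] i[OF assms(2)]
    by (subst Bochner_Integration.integral_add) (simp_all only: integrable_mult_right integral_mult_right_zero)
  finally show ?thesis unfolding fourier_L1_def by (simp only: distrib_left mult_ac)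
qed

section \<open>Extension of the transform to L^2\<close>

lemma is_fourier_L2_iff:
  "is_fourier_L2 f F \<longleftrightarrow> F \<in> L2 \<and>
     (\<exists>\<phi>. (\<forall>n. \<phi> n \<in> L2 \<and> integrable lebesgue (\<phi> n)) \<and>
       (\<lambda>n. sqnorm (\<lambda>x. \<phi> n x - f x)) \<longlonglongrightarrow> 0 \<and>
       (\<lambda>n. sqnorm (\<lambda>k. fourier_L1 (\<phi> n) k - F k)) \<longlonglongrightarrow> 0)"
  by (simp add: is_fourier_L2_def sqnorm_def)

lemma is_fourier_L2E:
  assumes "is_fourier_L2 f F"
  obtains \<phi> where "\<And>n::nat. \<phi> n \<in> L2" "\<And>n. integrable lebesgue (\<phi> n)"
    "(\<lambda>n. sqnorm (\<lambda>x. \<phi> n x - f x)) \<longlonglongrightarrow> 0" "(\<lambda>n. sqnorm (\<lambda>k. fourier_L1 (\<phi> n) k - F k)) \<longlonglongrightarrow> 0" "F \<in> L2"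
  using assms unfolding is_fourier_L2_iff by blast

lemma is_fourier_L2I:
  assumes "F \<in> L2" "\<And>n::nat. \<phi> n \<in> L2" "\<And>n. integrable lebesgue (\<phi> n)"
    "(\<lambda>n. sqnorm (\<lambda>x. \<phi> n x - f x)) \<longlonglongrightarrow> 0" "(\<lambda>n. sqnorm (\<lambda>k. fourier_L1 (\<phi> n) k - F k)) \<longlonglongrightarrow> 0"
  shows "is_fourier_L2 f F"
  using assms unfolding is_fourier_L2_iff by blast

text \<open>By linearity and the isometry on L^1 \<inter> L^2 the transforms of the truncations form
  a Cauchy sequence, so completeness provides F.\<close>

lemma is_fourier_L2_exists:
  assumes f: "f \<in> L2"
  obtains F where "is_fourier_L2 f F"
proof -
  define \<phi> where "\<phi> = (\<lambda>(n::nat) x. indicator (ball 0 (real n)) x * f x)"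
  have phi: "\<And>n. \<phi> n \<in> L2" "\<And>n. integrable lebesgue (\<phi> n)" "(\<lambda>n. sqnorm (\<lambda>x. \<phi> n x - f x)) \<longlonglongrightarrow> 0"
    unfolding \<phi>_def using L2_truncate[OF f] by simp_all
  have d: "sqnorm (\<lambda>k. fourier_L1 (\<phi> m) k - fourier_L1 (\<phi> n) k) \<le> 2 * sqnorm (\<lambda>x. \<phi> m x - f x) + 2 * sqnorm (\<lambda>x. \<phi> n x - f x)" for m n
  proof -
    have eq: "(\<lambda>k. fourier_L1 (\<phi> m) k - fourier_L1 (\<phi> n) k) = fourier_L1 (\<lambda>x. \<phi> m x + (-1) * \<phi> n x)"
      by (rule ext) (simp only: fourier_L1_linear[OF phi(2) phi(2)], simp)
    have "sqnorm (fourier_L1 (\<lambda>x. \<phi> m x + (-1) * \<phi> n x)) = sqnorm (\<lambda>x. \<phi> m x + (-1) * \<phi> n x)"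
      by (rule fourier_L1_isometry(2)[OF L2_add[OF phi(1) L2_cmult[OF phi(1)]]])
         (intro Bochner_Integration.integrable_add integrable_mult_right phi)
    also have "\<dots> = sqnorm (\<lambda>x. (\<phi> m x - f x) - (\<phi> n x - f x))" by simp
    also have "\<dots> \<le> 2 * sqnorm (\<lambda>x. \<phi> m x - f x) + 2 * sqnorm (\<lambda>x. \<phi> n x - f x)"
      by (intro sqnorm_diff L2_measurable L2_diff phi f)
    finally show ?thesis unfolding eq .
  qed
  obtain F where F: "F \<in> L2" "(\<lambda>n. sqnorm (\<lambda>k. fourier_L1 (\<phi> n) k - F k)) \<longlonglongrightarrow> 0"
  proof (rule L2_complete[of "\<lambda>n. fourier_L1 (\<phi> n)"])
    show "fourier_L1 (\<phi> n) \<in> L2" for n by (intro fourier_L1_isometry phi)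
    fix e :: real assume e: "e > 0"
    have "\<forall>\<^sub>F n in sequentially. sqnorm (\<lambda>x. \<phi> n x - f x) < ennreal (e/4)"
      using phi(3) e by (intro order_tendstoD(2)) auto
    then obtain N where N: "\<And>n. n \<ge> N \<Longrightarrow> sqnorm (\<lambda>x. \<phi> n x - f x) < ennreal (e/4)"
      by (auto simp: eventually_sequentially)
    have "sqnorm (\<lambda>k. fourier_L1 (\<phi> m) k - fourier_L1 (\<phi> n) k) \<le> ennreal e" if "m \<ge> N" "n \<ge> N" for m n
    proof -
      have "sqnorm (\<lambda>k. fourier_L1 (\<phi> m) k - fourier_L1 (\<phi> n) k) \<le> 2 * ennreal (e/4) + 2 * ennreal (e/4)"
        by (intro order_trans[OF d] add_mono mult_left_mono less_imp_le N that) auto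
      also have "\<dots> = ennreal e" using e by (simp flip: ennreal_plus ennreal_numeral ennreal_mult)
      finally show ?thesis .
    qed
    then show "\<exists>N. \<forall>m\<ge>N. \<forall>n\<ge>N. sqnorm (\<lambda>k. fourier_L1 (\<phi> m) k - fourier_L1 (\<phi> n) k) \<le> ennreal e" by blast
  qed
  show ?thesis by (rule that, rule is_fourier_L2I[OF F(1) phi F(2)])
qed

lemma is_fourier_L2_fourier_L2: "f \<in> L2 \<Longrightarrow> is_fourier_L2 f (fourier_L2 f)"
  unfolding fourier_L2_def by (erule is_fourier_L2_exists) (rule someI[where P="is_fourier_L2 f"])

lemma is_fourier_L2_in_L2: "is_fourier_L2 f F \<Longrightarrow> F \<in> L2"
  by (simp add: is_fourier_L2_def)

lemma is_fourier_L2_fourier_L1: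
  assumes "\<phi> \<in> L2" "integrable lebesgue \<phi>"
  shows "is_fourier_L2 \<phi> (fourier_L1 \<phi>)"
  by (rule is_fourier_L2I[where \<phi>="\<lambda>_. \<phi>"]) (use assms fourier_L1_isometry in \<open>auto simp: sqnorm_def\<close>)

lemma is_fourier_L2_cong_AE:
  assumes "is_fourier_L2 f F" "AE x in lebesgue. f x = f' x" "AE x in lebesgue. F x = F' x"
  shows "is_fourier_L2 f' F'"
proof -
  obtain \<phi> where phi: "\<And>n::nat. \<phi> n \<in> L2" "\<And>n. integrable lebesgue (\<phi> n)"
    "(\<lambda>n. sqnorm (\<lambda>x. \<phi> n x - f x)) \<longlonglongrightarrow> 0" "(\<lambda>n. sqnorm (\<lambda>k. fourier_L1 (\<phi> n) k - F k)) \<longlonglongrightarrow> 0" "F \<in> L2"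
    using assms(1) by (rule is_fourier_L2E) blast
  have "sqnorm (\<lambda>x. \<phi> n x - f x) = sqnorm (\<lambda>x. \<phi> n x - f' x)" for n
    using assms(2) by (intro sqnorm_cong_AE) (auto elim: eventually_mono)
  moreover have "sqnorm (\<lambda>k. fourier_L1 (\<phi> n) k - F k) = sqnorm (\<lambda>k. fourier_L1 (\<phi> n) k - F' k)" for n
    using assms(3) by (intro sqnorm_cong_AE) (auto elim: eventually_mono)
  ultimately show ?thesis
    using phi L2_cong_AE[OF phi(5) assms(3)] by (intro is_fourier_L2I[of F' \<phi>]) simp_all
qed

lemma is_fourier_L2_linear:
  assumes f: "f \<in> L2" "is_fourier_L2 f F" and g: "g \<in> L2" "is_fourier_L2 g G"
  shows "is_fourier_L2 (\<lambda>x. f x + c * g x) (\<lambda>k. F k + c * G k)"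
proof -
  obtain \<phi> where phi: "\<And>n::nat. \<phi> n \<in> L2" "\<And>n. integrable lebesgue (\<phi> n)"
    "(\<lambda>n. sqnorm (\<lambda>x. \<phi> n x - f x)) \<longlonglongrightarrow> 0" "(\<lambda>n. sqnorm (\<lambda>k. fourier_L1 (\<phi> n) k - F k)) \<longlonglongrightarrow> 0" "F \<in> L2"
    using f(2) by (rule is_fourier_L2E) blast
  obtain \<psi> where psi: "\<And>n::nat. \<psi> n \<in> L2" "\<And>n. integrable lebesgue (\<psi> n)"
    "(\<lambda>n. sqnorm (\<lambda>x. \<psi> n x - g x)) \<longlonglongrightarrow> 0" "(\<lambda>n. sqnorm (\<lambda>k. fourier_L1 (\<psi> n) k - G k)) \<longlonglongrightarrow> 0" "G \<in> L2"
    using g(2) by (rule is_fourier_L2E) blast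
  show ?thesis
  proof (rule is_fourier_L2I[where \<phi>="\<lambda>n x. \<phi> n x + c * \<psi> n x"])
    show "(\<lambda>n. sqnorm (\<lambda>x. (\<phi> n x + c * \<psi> n x) - (f x + c * g x))) \<longlonglongrightarrow> 0"
      by (intro L2lim_add L2lim_cmult L2_cmult phi psi f g)
    have "(\<lambda>n. sqnorm (\<lambda>k. (fourier_L1 (\<phi> n) k + c * fourier_L1 (\<psi> n) k) - (F k + c * G k))) \<longlonglongrightarrow> 0"
      by (intro L2lim_add L2lim_cmult L2_cmult fourier_L1_isometry phi psi)
    then show "(\<lambda>n. sqnorm (\<lambda>k. fourier_L1 (\<lambda>x. \<phi> n x + c * \<psi> n x) k - (F k + c * G k))) \<longlonglongrightarrow> 0"
      by (simp only: fourier_L1_linear[OF phi(2) psi(2)])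
  qed (intro L2_add L2_cmult phi psi Bochner_Integration.integrable_add integrable_mult_right)+
qed

text \<open>The isometry passes to the limit along the approximating sequences; convergence of the
  norms is read off the continuity of \<open>cip\<close>.\<close>

lemma is_fourier_L2_sqnorm:
  assumes f: "f \<in> L2" "is_fourier_L2 f F"
  shows "sqnorm F = sqnorm f"
proof -
  obtain \<phi> where phi: "\<And>n::nat. \<phi> n \<in> L2" "\<And>n. integrable lebesgue (\<phi> n)"
    "(\<lambda>n. sqnorm (\<lambda>x. \<phi> n x - f x)) \<longlonglongrightarrow> 0" "(\<lambda>n. sqnorm (\<lambda>k. fourier_L1 (\<phi> n) k - F k)) \<longlonglongrightarrow> 0" "F \<in> L2"
    using f(2) by (rule is_fourier_L2E) blast
  note F1 = fourier_L1_isometry[OF phi(1,2)]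
  have "(\<lambda>n. ennreal (Re (cip (\<phi> n) (\<phi> n)))) \<longlonglongrightarrow> ennreal (Re (cip f f))"
    by (intro tendsto_ennrealI tendsto_Re cip_tendsto phi f)
  moreover have "(\<lambda>n. ennreal (Re (cip (fourier_L1 (\<phi> n)) (fourier_L1 (\<phi> n))))) \<longlonglongrightarrow> ennreal (Re (cip F F))"
    by (intro tendsto_ennrealI tendsto_Re cip_tendsto phi F1)
  ultimately show ?thesis
    using F1 phi f by (simp add: LIMSEQ_unique flip: sqnorm_eq_cip)
qed

lemma cip_linear_expand:
  assumes f: "f \<in> L2" and g: "g \<in> L2"
  shows "Re (cip (\<lambda>x. f x + c * g x) (\<lambda>x. f x + c * g x)) = Re (cip f f) + (norm c)\<^sup>2 * Re (cip g g) + 2 * Re (c * cip f g)"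
proof -
  note i = integrable_pairing(1)[OF L2_cnj]
  have "cip (\<lambda>x. f x + c * g x) (\<lambda>x. f x + c * g x) =
    (LINT x|lebesgue. (cnj (f x) * f x + c * cnj c * (cnj (g x) * g x)) + (c * (cnj (f x) * g x) + cnj (c * (cnj (f x) * g x))))"
    unfolding cip_def by (intro Bochner_Integration.integral_cong) (auto simp: algebra_simps)
  also have "\<dots> = (cip f f + c * cnj c * cip g g) + (c * cip f g + cnj (c * cip f g))"
    unfolding cip_def using i[OF f f] i[OF f g] i[OF g g]
    by (simp only: Bochner_Integration.integral_add Bochner_Integration.integrable_add integrable_mult_right
        integral_mult_right_zero Bochner_Integration.integral_cnj integrable_cnj)
  also have "c * cnj c = complex_of_real ((norm c)\<^sup>2)" by (metis complex_norm_square of_real_power)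
  finally show ?thesis by simp
qed

text \<open>The mixed term in the squared norm of f + c g is 2 Re (c <f|g>); the values c = 1 and c
  = i determine the inner product.\<close>

lemma cip_polarization:
  assumes L2: "f \<in> L2" "g \<in> L2" "F \<in> L2" "G \<in> L2"
    and sq: "sqnorm F = sqnorm f" "sqnorm G = sqnorm g"
      "\<And>c. sqnorm (\<lambda>x. F x + c * G x) = sqnorm (\<lambda>x. f x + c * g x)"
  shows "cip F G = cip f g"
proof -
  have R: "Re (cip u u) = Re (cip v v)" if "u \<in> L2" "v \<in> L2" "sqnorm u = sqnorm v" for u v
  proof -
    have "Re (cip u u) \<ge> 0" for u :: "quat \<Rightarrow> complex"
      by (simp add: cip_def complex_norm_square_integral)
    then show ?thesis using that by (simp add: sqnorm_eq_cip)
  qed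
  have "Re (c * cip F G) = Re (c * cip f g)" for c
    using R[OF L2_add[OF L2(3) L2_cmult[OF L2(4), of c]] L2_add[OF L2(1) L2_cmult[OF L2(2), of c]] sq(3)]
      R[OF L2(3) L2(1) sq(1)] R[OF L2(4) L2(2) sq(2)]
    by (simp add: cip_linear_expand L2)
  from this[of 1] this[of \<i>] show ?thesis by (simp add: complex_eq_iff)
qed

lemma is_fourier_L2_cip:
  assumes f: "f \<in> L2" "is_fourier_L2 f F" and g: "g \<in> L2" "is_fourier_L2 g G"
  shows "cip F G = cip f g"
proof (rule cip_polarization)
  show "sqnorm (\<lambda>x. F x + c * G x) = sqnorm (\<lambda>x. f x + c * g x)" for c
    by (rule is_fourier_L2_sqnorm[OF L2_add[OF f(1) L2_cmult[OF g(1)]] is_fourier_L2_linear[OF f g]])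
qed (use f g is_fourier_L2_sqnorm[OF f] is_fourier_L2_sqnorm[OF g]
    is_fourier_L2_in_L2[OF f(2)] is_fourier_L2_in_L2[OF g(2)] in auto)

text \<open>The difference of two candidates is a transform of f - f = 0, so its norm is 0.\<close>

lemma is_fourier_L2_unique:
  assumes "f \<in> L2" "is_fourier_L2 f F" "is_fourier_L2 f G"
  shows "AE k in lebesgue. F k = G k"
proof -
  have L2: "(\<lambda>k. F k + (-1) * G k) \<in> L2"
    by (intro L2_add L2_cmult is_fourier_L2_in_L2[OF assms(2)] is_fourier_L2_in_L2[OF assms(3)])
  have "sqnorm (\<lambda>k. F k + (-1) * G k) = sqnorm (\<lambda>x. f x + (-1) * f x)"
    by (intro is_fourier_L2_sqnorm is_fourier_L2_linear L2_add L2_cmult assms)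
  also have "\<dots> = 0" by (simp add: sqnorm_def)
  finally have "AE k in lebesgue. F k + (-1) * G k = 0"
    unfolding sqnorm_eq_0_iff[OF L2_measurable[OF L2]] .
  then show ?thesis
    by (rule eventually_mono) simp
qed

lemma is_fourier_L2_multiplication:
  assumes f: "f \<in> L2" "is_fourier_L2 f F" and g: "g \<in> L2" "is_fourier_L2 g G"
  shows "(LINT k|lebesgue. F k * g k) = (LINT x|lebesgue. f x * G x)"
proof -
  obtain \<phi> where phi: "\<And>n::nat. \<phi> n \<in> L2" "\<And>n. integrable lebesgue (\<phi> n)"
    "(\<lambda>n. sqnorm (\<lambda>x. \<phi> n x - f x)) \<longlonglongrightarrow> 0" "(\<lambda>n. sqnorm (\<lambda>k. fourier_L1 (\<phi> n) k - F k)) \<longlonglongrightarrow> 0" "F \<in> L2"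
    using f(2) by (rule is_fourier_L2E) blast
  obtain \<psi> where psi: "\<And>n::nat. \<psi> n \<in> L2" "\<And>n. integrable lebesgue (\<psi> n)"
    "(\<lambda>n. sqnorm (\<lambda>x. \<psi> n x - g x)) \<longlonglongrightarrow> 0" "(\<lambda>n. sqnorm (\<lambda>k. fourier_L1 (\<psi> n) k - G k)) \<longlonglongrightarrow> 0" "G \<in> L2"
    using g(2) by (rule is_fourier_L2E) blast
  have "(\<lambda>n. LINT k|lebesgue. fourier_L1 (\<phi> n) k * \<psi> n k) \<longlonglongrightarrow> (LINT k|lebesgue. F k * g k)"
    by (intro pairing_tendsto fourier_L1_isometry phi psi g)
  moreover have "(\<lambda>n. LINT x|lebesgue. \<phi> n x * fourier_L1 (\<psi> n) x) \<longlonglongrightarrow> (LINT x|lebesgue. f x * G x)"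
    by (intro pairing_tendsto fourier_L1_isometry phi psi f)
  ultimately show ?thesis
    unfolding fourier_L1_multiplication[OF phi(2) psi(2)] by (rule LIMSEQ_unique)
qed

text \<open>The bilinear symmetry makes \<open>cnj \<circ> T \<circ> cnj\<close> the adjoint of the transform \<open>T\<close>, so that the
  isometry property alone yields surjectivity.\<close>

lemma is_fourier_L2_surj:
  assumes F: "F \<in> L2"
  obtains f where "f \<in> L2" "is_fourier_L2 f F"
proof -
  obtain G where G: "is_fourier_L2 (\<lambda>k. cnj (F k)) G" using is_fourier_L2_exists[OF L2_cnj[OF F]] .
  define f where "f x = cnj (G x)" for x
  have GL2: "G \<in> L2" using G by (rule is_fourier_L2_in_L2)
  have f: "f \<in> L2" unfolding f_def by (rule L2_cnj[OF GL2])
  obtain H where H: "is_fourier_L2 f H" using is_fourier_L2_exists[OF f] .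
  have HL2: "H \<in> L2" using H by (rule is_fourier_L2_in_L2)
  have s1: "sqnorm H = sqnorm G"
    using is_fourier_L2_sqnorm[OF f H] unfolding f_def by (simp add: sqnorm_cnj)
  have s2: "sqnorm F = sqnorm G"
    using is_fourier_L2_sqnorm[OF L2_cnj[OF F] G] by (simp add: sqnorm_cnj)
  have "(LINT k|lebesgue. H k * cnj (F k)) = (LINT x|lebesgue. f x * G x)"
    by (rule is_fourier_L2_multiplication[OF f H L2_cnj[OF F] G])
  \<comment> \<open>F and H have the same norm as G, and their inner product is the square of that
    norm. This is the equality case of Cauchy-Schwarz, so F - H has norm 0.\<close>
  then have FH: "cip F H = cip G G" by (simp add: cip_def f_def mult.commute)
  have nn: "Re (cip u u) \<ge> 0" for u :: "quat \<Rightarrow> complex"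
    by (simp add: cip_def complex_norm_square_integral)
  have FF: "Re (cip F F) = Re (cip G G)" "Re (cip H H) = Re (cip G G)"
    using s1 s2 sqnorm_eq_cip[OF F] sqnorm_eq_cip[OF HL2] sqnorm_eq_cip[OF GL2] nn by simp_all
  have D: "(\<lambda>x. F x + (-1) * H x) \<in> L2" by (intro L2_add L2_cmult F HL2)
  have "sqnorm (\<lambda>x. F x + (-1) * H x) = ennreal (Re (cip (\<lambda>x. F x + (-1) * H x) (\<lambda>x. F x + (-1) * H x)))"
    by (rule sqnorm_eq_cip[OF D])
  also have "\<dots> = 0"
    unfolding cip_linear_expand[OF F HL2] using FF FH by simp
  finally have "AE k in lebesgue. F k + (-1) * H k = 0"
    unfolding sqnorm_eq_0_iff[OF L2_measurable[OF D]] .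
  then have "AE k in lebesgue. H k = F k"
    by (rule eventually_mono) simp
  then show ?thesis
    by (intro that[OF f] is_fourier_L2_cong_AE[OF H]) auto
qed

section \<open>Similarities acting on L^2 and on transforms\<close>

lemma sqnorm_similarity:
  fixes L :: "quat \<Rightarrow> quat" and u :: "quat \<Rightarrow> complex"
  assumes L: "linear L" "\<And>x. norm (L x) = c * norm x" "c > 0"
    and u: "u \<in> borel_measurable lebesgue"
  shows "(\<lambda>x. u (t + L x)) \<in> borel_measurable lebesgue" "sqnorm u = ennreal (c^4) * sqnorm (\<lambda>x. u (t + L x))"
proof -
  note [measurable] = linear_borel_measurable[OF L(1)]
  obtain v where v[measurable]: "v \<in> borel_measurable borel" and ae: "AE x in lebesgue. u x = v x"
    by (rule borel_representative[OF u])
  have ae': "AE x in lebesgue. u (t + L x) = v (t + L x)"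
    using ae unfolding AE_completion_iff by (intro AE_similarity[OF L])
  have "(\<lambda>x. v (t + L x)) \<in> borel_measurable lebesgue" by (intro borel_measurable_lebesgueI) measurable
  then show "(\<lambda>x. u (t + L x)) \<in> borel_measurable lebesgue"
    by (rule borel_measurable_lebesgue_AE) (use ae' in \<open>auto simp: eq_commute\<close>)
  have "sqnorm u = sqnorm v" using ae by (intro sqnorm_cong_AE) (auto elim: eventually_mono)
  also have "\<dots> = ennreal (c^4) * sqnorm (\<lambda>x. v (t + L x))"
    unfolding sqnorm_def nn_integral_completion
    by (rule nn_integral_similarity[OF L, where f="\<lambda>x. ennreal ((norm (v x))\<^sup>2)"]) measurable
  also have "sqnorm (\<lambda>x. v (t + L x)) = sqnorm (\<lambda>x. u (t + L x))"
    using ae' by (intro sqnorm_cong_AE) (auto elim: eventually_mono)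
  finally show "sqnorm u = ennreal (c^4) * sqnorm (\<lambda>x. u (t + L x))" .
qed

lemma sqnorm_similarity':
  fixes L :: "quat \<Rightarrow> quat" and u :: "quat \<Rightarrow> complex"
  assumes L: "linear L" "\<And>x. norm (L x) = c * norm x" "c > 0"
    and u: "u \<in> borel_measurable lebesgue"
  shows "sqnorm (\<lambda>x. u (t + L x)) = ennreal ((1/c)^4) * sqnorm u"
proof -
  have "ennreal ((1/c)^4) * sqnorm u = ennreal ((1/c)^4 * c^4) * sqnorm (\<lambda>x. u (t + L x))"
    unfolding sqnorm_similarity(2)[OF L u, of t] using L(3) by (simp add: ennreal_mult mult.assoc)
  also have "(1/c)^4 * c^4 = 1" using L(3) by (simp flip: power_mult_distrib)
  finally show ?thesis by simp
qed

lemma L2_similarity: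
  fixes L :: "quat \<Rightarrow> quat" and u :: "quat \<Rightarrow> complex"
  assumes L: "linear L" "\<And>x. norm (L x) = c * norm x" "c > 0" and u: "u \<in> L2"
  shows "(\<lambda>x. u (t + L x)) \<in> L2"
  using sqnorm_similarity(1)[OF L L2_measurable[OF u], of t] sqnorm_similarity'[OF L L2_measurable[OF u], of t] L2_finite[OF u]
  by (simp add: L2_iff ennreal_mult_less_top)

text \<open>The L^1 formula passes to the limit along a sequence defining F, because composition
  with a similarity and multiplication by a phase change squared norms only by constants.\<close>

lemma is_fourier_L2_similarity:
  fixes L M L' :: "quat \<Rightarrow> quat"
  assumes L: "linear L" "\<And>x. norm (L x) = c * norm x" "c > 0"
    and M: "linear M" "\<And>x. M (L x) = x" "\<And>x. L (M x) = x"
    and L': "linear L'" "\<And>k. norm (L' k) = c * norm k" "\<And>k x. k \<bullet> L x = L' k \<bullet> x"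
    and f: "f \<in> L2" "is_fourier_L2 f F"
  shows "is_fourier_L2 (\<lambda>x. f (M (x - b))) (\<lambda>k. complex_of_real (c^4) * fker k b * F (L' k))"
proof -
  have M': "norm (M x) = 1/c * norm x" "1/c > 0" for x
    using L(2)[of "M x"] L(3) by (simp_all add: M(3))
  have Mb: "M (x - b) = - M b + M x" for x by (simp add: linear_diff[OF M(1)])
  obtain \<phi> where phi: "\<And>n::nat. \<phi> n \<in> L2" "\<And>n. integrable lebesgue (\<phi> n)"
    "(\<lambda>n. sqnorm (\<lambda>x. \<phi> n x - f x)) \<longlonglongrightarrow> 0" "(\<lambda>n. sqnorm (\<lambda>k. fourier_L1 (\<phi> n) k - F k)) \<longlonglongrightarrow> 0" "F \<in> L2"
    using f(2) by (rule is_fourier_L2E) blast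
  have mul: "(\<lambda>k. complex_of_real (c^4) * fker k b * u k) \<in> L2" if u: "u \<in> L2" for u
  proof -
    note [measurable] = L2_measurable[OF u]
    have [measurable]: "(\<lambda>k. fker k b) \<in> borel_measurable lebesgue" by (intro borel_measurable_lebesgueI) measurable
    have "(\<lambda>k. fker k b * u k) \<in> L2"
      by (rule L2_bound[OF u]) (measurable, simp add: norm_mult norm_fker)
    from L2_cmult[OF this, of "complex_of_real (c^4)"] show ?thesis by (simp add: mult.assoc)
  qed
  show ?thesis
  proof (rule is_fourier_L2I[where \<phi>="\<lambda>n x. \<phi> n (M (x - b))"])
    show "(\<lambda>k. complex_of_real (c^4) * fker k b * F (L' k)) \<in> L2"
      using L2_similarity[OF L'(1,2) L(3) phi(5), of 0] by (intro mul) simp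
    show "(\<lambda>x. \<phi> n (M (x - b))) \<in> L2" for n
      unfolding Mb by (rule L2_similarity[OF M(1) M' phi(1)])
    show "integrable lebesgue (\<lambda>x. \<phi> n (M (x - b)))" for n
    proof -
      note [measurable] = linear_borel_measurable[OF M(1)]
      obtain v where v[measurable]: "v \<in> borel_measurable borel" and vi: "integrable lborel v" and ae: "AE x in lebesgue. \<phi> n x = v x"
        by (rule integrable_representative[OF phi(2)])
      have ae': "AE x in lebesgue. \<phi> n (- M b + M x) = v (- M b + M x)"
        using ae unfolding AE_completion_iff by (intro AE_similarity[OF M(1) M'])
      have "integrable lborel (\<lambda>x. v (- M b + M x))"
        using integrable_similarity_iff[OF M(1) M', of v "- M b"] vi by simp
      then have "integrable lebesgue (\<lambda>x. v (- M b + M x))"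
        by (subst integrable_completion) measurable
      then show ?thesis unfolding Mb
      proof (rule integrable_cong_AE_imp)
        show "(\<lambda>x. \<phi> n (- M b + M x)) \<in> borel_measurable lebesgue"
          by (rule sqnorm_similarity(1)[OF M(1) M' L2_measurable[OF phi(1)]])
        show "AE x in lebesgue. v (- M b + M x) = \<phi> n (- M b + M x)"
          using ae' by (rule eventually_mono) simp
      qed
    qed
    have "sqnorm (\<lambda>x. \<phi> n (M (x - b)) - f (M (x - b))) = ennreal (c^4) * sqnorm (\<lambda>x. \<phi> n x - f x)" for n
      unfolding Mb using sqnorm_similarity'[OF M(1) M' L2_measurable[OF L2_diff[OF phi(1)[of n] f(1)]], of "- M b"] by simp
    moreover have "(\<lambda>n. ennreal (c^4) * sqnorm (\<lambda>x. \<phi> n x - f x)) \<longlonglongrightarrow> ennreal (c^4) * 0"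
      by (intro tendsto_mult_ennreal phi tendsto_const) auto
    ultimately show "(\<lambda>n. sqnorm (\<lambda>x. \<phi> n (M (x - b)) - f (M (x - b)))) \<longlonglongrightarrow> 0" by simp
    \<comment> \<open>The factor \<open>c^4\<close> enters squared, the Jacobian of L' gives
      \<open>(1/c)^4\<close>, and the phase has modulus 1.\<close>
    have "sqnorm (\<lambda>k. fourier_L1 (\<lambda>x. \<phi> n (M (x - b))) k - complex_of_real (c^4) * fker k b * F (L' k))
       = ennreal ((c^4)\<^sup>2) * (ennreal ((1/c)^4) * sqnorm (\<lambda>k. fourier_L1 (\<phi> n) k - F k))" for n
    proof -
      have "sqnorm (\<lambda>k. fourier_L1 (\<lambda>x. \<phi> n (M (x - b))) k - complex_of_real (c^4) * fker k b * F (L' k))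
        = sqnorm (\<lambda>k. complex_of_real (c^4) * (fourier_L1 (\<phi> n) (L' k) - F (L' k)))"
        unfolding fourier_L1_similarity(2)[OF L M L'(3) L2_measurable[OF phi(1)]]
        unfolding sqnorm_def by (simp add: norm_mult norm_fker flip: right_diff_distrib)
      also have "\<dots> = ennreal ((c^4)\<^sup>2) * sqnorm (\<lambda>k. fourier_L1 (\<phi> n) (L' k) - F (L' k))"
        using L(3) sqnorm_similarity(1)[OF L'(1,2) L(3) L2_measurable[OF L2_diff[OF fourier_L1_isometry(1)[OF phi(1)[of n] phi(2)] phi(5)]], of 0]
        by (subst sqnorm_cmult) (auto simp: norm_power)
      also have "sqnorm (\<lambda>k. fourier_L1 (\<phi> n) (L' k) - F (L' k)) = ennreal ((1/c)^4) * sqnorm (\<lambda>k. fourier_L1 (\<phi> n) k - F k)"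
        using sqnorm_similarity'[OF L'(1,2) L(3) L2_measurable[OF L2_diff[OF fourier_L1_isometry(1)[OF phi(1)[of n] phi(2)] phi(5)]], of 0] by simp
      finally show ?thesis .
    qed
    moreover have "(\<lambda>n. ennreal ((c^4)\<^sup>2) * (ennreal ((1/c)^4) * sqnorm (\<lambda>k. fourier_L1 (\<phi> n) k - F k))) \<longlonglongrightarrow> ennreal ((c^4)\<^sup>2) * (ennreal ((1/c)^4) * 0)"
      by (intro tendsto_mult_ennreal phi tendsto_const) auto
    ultimately show "(\<lambda>n. sqnorm (\<lambda>k. fourier_L1 (\<lambda>x. \<phi> n (M (x - b))) k - complex_of_real (c^4) * fker k b * F (L' k))) \<longlonglongrightarrow> 0"
      by simp
  qed
qed

section \<open>The operator \<open>C\<close>\<close>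

lemma C_domain_iff:
  "f \<in> C_domain \<longleftrightarrow> f \<in> L2 \<and> (\<integral>\<^sup>+k. ennreal ((norm (fourier_L2 f k))\<^sup>2 / norm k ^ 4) \<partial>lebesgue) < \<infinity>"
  unfolding C_domain_def by (auto simp: ennreal_mult_less_top)

text \<open>The condition in \<open>C_domain\<close> says exactly that the multiplier keeps the
  transform of f in \<open>L2\<close>. Surjectivity of the transform then supplies a function for
  the choice in \<open>Cop\<close>, and uniqueness lets any transform F of f take the place of
  \<open>fourier_L2 f\<close>.\<close>

lemma Cop:
  assumes f: "f \<in> C_domain" and F: "is_fourier_L2 f F"
  shows "Cop f \<in> L2" "is_fourier_L2 (Cop f) (\<lambda>k. complex_of_real ((2 * pi / norm k)\<^sup>2) * F k)"
proof -
  let ?G = "\<lambda>k. complex_of_real ((2 * pi / norm k)\<^sup>2) * fourier_L2 f k"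
  have fL2: "f \<in> L2" using f by (simp add: C_domain_iff)
  note FT = is_fourier_L2_fourier_L2[OF fL2]
  note [measurable] = L2_measurable[OF is_fourier_L2_in_L2[OF FT]]
  have [measurable]: "(\<lambda>k::quat. complex_of_real ((2 * pi / norm k)\<^sup>2)) \<in> borel_measurable lebesgue"
    by (intro borel_measurable_lebesgueI) measurable
  have [measurable]: "(\<lambda>k. ennreal ((norm (fourier_L2 f k))\<^sup>2 / norm k ^ 4)) \<in> borel_measurable lebesgue"
  proof -
    have "(\<lambda>k::quat. norm k ^ 4) \<in> borel_measurable lebesgue"
      by (intro borel_measurable_lebesgueI) measurable
    then show ?thesis by measurable
  qed
  have "sqnorm ?G = (\<integral>\<^sup>+k. ennreal ((2*pi)^4) * ennreal ((norm (fourier_L2 f k))\<^sup>2 / norm k ^ 4) \<partial>lebesgue)"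
    unfolding sqnorm_def
    by (intro nn_integral_cong)
       (simp add: norm_mult norm_power norm_divide power_mult_distrib power_divide flip: ennreal_mult power_mult)
  also have "\<dots> = ennreal ((2*pi)^4) * (\<integral>\<^sup>+k. ennreal ((norm (fourier_L2 f k))\<^sup>2 / norm k ^ 4) \<partial>lebesgue)"
    by (rule nn_integral_cmult) measurable
  also have "\<dots> < \<infinity>" using f by (simp add: C_domain_iff ennreal_mult_less_top)
  finally have "sqnorm ?G < \<infinity>" .
  moreover have "?G \<in> borel_measurable lebesgue" by measurable
  ultimately have G: "?G \<in> L2" unfolding L2_iff by blast
  obtain g where g: "g \<in> L2" "is_fourier_L2 g ?G" using is_fourier_L2_surj[OF G] .
  have "AE k in lebesgue. fourier_L2 g k = ?G k"
    by (rule is_fourier_L2_unique[OF g(1) is_fourier_L2_fourier_L2[OF g(1)] g(2)])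
  with g(1) have "Cop f \<in> L2 \<and> (AE k in lebesgue. fourier_L2 (Cop f) k = ?G k)"
    unfolding Cop_def by (intro someI[of "\<lambda>g. g \<in> L2 \<and> (AE k in lebesgue. fourier_L2 g k = ?G k)" g]) simp
  then have CL2: "Cop f \<in> L2" and ae: "AE k in lebesgue. fourier_L2 (Cop f) k = ?G k" by auto
  show "Cop f \<in> L2" by (rule CL2)
  have "AE k in lebesgue. fourier_L2 f k = F k"
    by (rule is_fourier_L2_unique[OF fL2 FT F])
  with ae have "AE k in lebesgue. fourier_L2 (Cop f) k = complex_of_real ((2 * pi / norm k)\<^sup>2) * F k"
    by eventually_elim simp
  then show "is_fourier_L2 (Cop f) (\<lambda>k. complex_of_real ((2 * pi / norm k)\<^sup>2) * F k)"
    by (intro is_fourier_L2_cong_AE[OF is_fourier_L2_fourier_L2[OF CL2]]) auto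
qed

section \<open>Orthogonality relations\<close>

lemma linear_quat_mult_left: "linear (\<lambda>x::quat. a * x)"
  by (intro linearI) (auto simp: distrib_left)

lemma linear_qcnj: "linear qcnj"
  by (intro linearI) (auto simp: qcnj_def quat_eq_iff)

lemma linear_qcnj_mult: "linear (\<lambda>a. qcnj a * k)"
  by (intro linearI) (auto simp: qcnj_def quat_eq_iff times_quat_def algebra_simps)

lemma norm_qcnj: "norm (qcnj a) = norm a"
  by (simp add: norm_quat_def qcnj_def)

lemma inner_quat_mult_left: "k \<bullet> (a * x) = (qcnj a * k) \<bullet> x" for k :: quat
  by (simp add: inner_quat_def qcnj_def times_quat_def algebra_simps)

lemma measurable_qcnj [measurable]: "qcnj \<in> borel_measurable borel"
  by (rule linear_borel_measurable[OF linear_qcnj])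

text \<open>The affine representation on complex L^2. For a = 0 the convention 1/0 = 0 makes it the
  zero function, so that \<open>Uc_L2\<close> and \<open>Uc_cong_AE\<close> hold at every p, also
  outside the group.\<close>

definition Uc :: "quat \<times> quat \<Rightarrow> (quat \<Rightarrow> complex) \<Rightarrow> quat \<Rightarrow> complex" where
  "Uc p f = (\<lambda>x. complex_of_real (1 / (norm (snd p))\<^sup>2) * f (inverse (snd p) * (x - fst p)))"

lemma Uc_L2:
  assumes f: "f \<in> L2"
  shows "Uc (b, a) f \<in> L2"
proof (cases "a = 0")
  case True then show ?thesis by (simp add: Uc_def L2_zero)
next
  case False
  have "(\<lambda>x. f (- (inverse a * b) + inverse a * x)) \<in> L2"
    by (rule L2_similarity[OF linear_quat_mult_left _ _ f, where c="norm (inverse a)"])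
       (use False in \<open>auto simp: norm_mult\<close>)
  from L2_cmult[OF this, of "complex_of_real (1 / (norm a)\<^sup>2)"] show ?thesis
    by (simp add: Uc_def right_diff_distrib)
qed

lemma Uc_cong_AE:
  assumes ae: "AE x in lebesgue. f x = g x"
  shows "AE x in lebesgue. Uc (b, a) f x = Uc (b, a) g x"
proof (cases "a = 0")
  case True then show ?thesis by (simp add: Uc_def)
next
  case False
  have "AE x in lborel. f (- (inverse a * b) + inverse a * x) = g (- (inverse a * b) + inverse a * x)"
    by (rule AE_similarity[OF linear_quat_mult_left, where c="norm (inverse a)"])
       (use False ae in \<open>auto simp: norm_mult AE_completion_iff\<close>)
  then show ?thesis unfolding AE_completion_iff
    by (rule eventually_mono) (simp add: Uc_def right_diff_distrib)
qed

text \<open>The similarity factor |a|^4 against the normalization |a|^(-2) leaves |a|^2; the adjoint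
  of left multiplication by a is left multiplication by \<open>qcnj a\<close>.\<close>

lemma is_fourier_L2_Uc:
  assumes f: "f \<in> L2" "is_fourier_L2 f F" and a: "a \<noteq> 0"
  shows "is_fourier_L2 (Uc (b, a) f) (\<lambda>k. complex_of_real ((norm a)\<^sup>2) * fker k b * F (qcnj a * k))"
proof -
  let ?u = "\<lambda>x. f (inverse a * (x - b))" and ?v = "\<lambda>k. complex_of_real (norm a ^ 4) * fker k b * F (qcnj a * k)"
  let ?c = "complex_of_real (1 / (norm a)\<^sup>2)"
  have uv: "is_fourier_L2 ?u ?v"
    by (rule is_fourier_L2_similarity[OF linear_quat_mult_left _ _ linear_quat_mult_left _ _ linear_quat_mult_left _ _ f])
       (use a in \<open>auto simp: norm_mult norm_qcnj inner_quat_mult_left simp flip: mult.assoc\<close>)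
  have "(\<lambda>x. f (- (inverse a * b) + inverse a * x)) \<in> L2"
    by (rule L2_similarity[OF linear_quat_mult_left _ _ f(1), where c="norm (inverse a)"])
       (use a in \<open>auto simp: norm_mult\<close>)
  then have u: "?u \<in> L2" by (simp add: right_diff_distrib)
  \<comment> \<open>Multiplication by \<open>?c\<close> is written as u + (c - 1) u, the form in
    which linearity has been stated.\<close>
  have "is_fourier_L2 (\<lambda>x. ?u x + (?c - 1) * ?u x) (\<lambda>k. ?v k + (?c - 1) * ?v k)"
    by (rule is_fourier_L2_linear[OF u uv u uv])
  moreover have "?u x + (?c - 1) * ?u x = Uc (b, a) f x" for x
    by (simp add: Uc_def algebra_simps)
  moreover have "?v k + (?c - 1) * ?v k = complex_of_real ((norm a)\<^sup>2) * fker k b * F (qcnj a * k)" for k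
  proof -
    have "?c * complex_of_real (norm a ^ 4) = complex_of_real ((norm a)\<^sup>2)"
      using a by (simp add: power4_eq_xxxx power2_eq_square)
    then have "?c * ?v k = complex_of_real ((norm a)\<^sup>2) * fker k b * F (qcnj a * k)"
      by (metis mult.assoc)
    then show ?thesis by (simp add: left_diff_distrib)
  qed
  ultimately show ?thesis by simp
qed

lemma cip_commute: "cip g f = cnj (cip f g)"
proof -
  have "cnj (cip f g) = (LINT x|lebesgue. cnj (cnj (f x) * g x))"
    unfolding cip_def by (rule Bochner_Integration.integral_cnj[symmetric])
  then show ?thesis by (simp add: cip_def mult.commute)
qed

lemma cip_cong_AE:
  assumes "f \<in> L2" "g \<in> L2" "AE x in lebesgue. f x = f' x" "AE x in lebesgue. g x = g' x"
  shows "cip f g = cip f' g'"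
proof -
  note [measurable] = L2_measurable[OF assms(1)] L2_measurable[OF assms(2)]
    L2_measurable[OF L2_cong_AE[OF assms(1,3)]] L2_measurable[OF L2_cong_AE[OF assms(2,4)]]
  show ?thesis unfolding cip_def
  proof (rule integral_cong_AE)
    show "AE x in lebesgue. cnj (f x) * g x = cnj (f' x) * g' x"
      using assms(3,4) by eventually_elim simp
  qed measurable
qed

subsection \<open>Left Haar measure\<close>

text \<open>The convention 1/0 = 0 makes the density vanish outside \<open>Gaff\<close>, so that the
  integral can be taken over the full product, where Fubini applies. Pairs are ordered as (b, a),
  whence \<open>snd\<close>.\<close>

lemma
  fixes W :: "quat \<times> quat \<Rightarrow> 'b::{banach, second_countable_topology}"
  assumes W[measurable]: "W \<in> borel_measurable (lborel \<Otimes>\<^sub>M lborel)"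
  shows integrable_haar_left: "integrable haar_left W \<longleftrightarrow> integrable (lborel \<Otimes>\<^sub>M lborel) (\<lambda>p. (1 / norm (snd p) ^ 8) *\<^sub>R W p)"
    and integral_haar_left: "(LINT p|haar_left. W p) = (LINT p|(lborel \<Otimes>\<^sub>M lborel). (1 / norm (snd p) ^ 8) *\<^sub>R W p)"
proof -
  let ?R = "restrict_space (lborel \<Otimes>\<^sub>M lborel) Gaff :: (quat \<times> quat) measure"
  have [measurable]: "Gaff \<in> sets (lborel \<Otimes>\<^sub>M lborel)"
    unfolding Gaff_def by (intro pair_measureI) auto
  then have G: "Gaff \<inter> space (lborel \<Otimes>\<^sub>M lborel) \<in> sets (lborel \<Otimes>\<^sub>M lborel)"
    by (subst sets.Int_space_eq2)
  have h: "haar_left = density ?R (\<lambda>p. ennreal (1 / norm (snd p) ^ 8))"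
    unfolding haar_left_def by (intro arg_cong2[where f=density] refl) auto
  have [measurable]: "W \<in> borel_measurable ?R" by (rule measurable_restrict_space1[OF W])
  have "(\<lambda>p::quat\<times>quat. 1 / norm (snd p) ^ 8) \<in> borel_measurable (lborel \<Otimes>\<^sub>M lborel)"
    by measurable
  then have [measurable]: "(\<lambda>p::quat\<times>quat. 1 / norm (snd p) ^ 8) \<in> borel_measurable ?R"
    by (rule measurable_restrict_space1)
  have i: "indicator Gaff p *\<^sub>R ((1 / norm (snd p) ^ 8) *\<^sub>R W p) = (1 / norm (snd p) ^ 8) *\<^sub>R W p" for p
    by (cases p) (auto simp: Gaff_def indicator_def)
  show "integrable haar_left W \<longleftrightarrow> integrable (lborel \<Otimes>\<^sub>M lborel) (\<lambda>p. (1 / norm (snd p) ^ 8) *\<^sub>R W p)"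
    unfolding h by (subst integrable_density) (simp_all add: integrable_restrict_space[OF G] i del: scaleR_scaleR)
  show "(LINT p|haar_left. W p) = (LINT p|(lborel \<Otimes>\<^sub>M lborel). (1 / norm (snd p) ^ 8) *\<^sub>R W p)"
    unfolding h by (subst integral_density) (simp_all add: integral_restrict_space[OF G] i del: scaleR_scaleR)
qed

subsection \<open>The kernel of the coefficients\<close>

definition coeff_kernel :: "(quat \<Rightarrow> complex) \<Rightarrow> (quat \<Rightarrow> complex) \<Rightarrow> quat \<Rightarrow> quat \<Rightarrow> complex" where
  "coeff_kernel F G a k = complex_of_real ((norm a)\<^sup>2) * (cnj (G k) * F (qcnj a * k))"

lemma coeff_kernel_measurable [measurable]:
  assumes [measurable]: "F \<in> borel_measurable borel" "G \<in> borel_measurable borel"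
  shows "(\<lambda>(a, k). coeff_kernel F G a k) \<in> borel_measurable (lborel \<Otimes>\<^sub>M lborel)"
    "coeff_kernel F G a \<in> borel_measurable borel"
  unfolding coeff_kernel_def by measurable

text \<open>The map a \<mapsto> \<open>qcnj a * k\<close> is a similarity of ratio |k|, and its
  Jacobian |k|^4 cancels against the homogeneity of |a|^(-4).\<close>

lemma nn_integral_orbit:
  assumes [measurable]: "u \<in> borel_measurable borel" and u: "\<And>a. u a \<ge> 0" and k: "k \<noteq> 0"
  shows "(\<integral>\<^sup>+a. ennreal (u (qcnj a * k) / norm a ^ 4) \<partial>lborel) = (\<integral>\<^sup>+a. ennreal (u a / norm a ^ 4) \<partial>lborel)"
proof -
  have "(\<integral>\<^sup>+a. ennreal (u a / norm a ^ 4) \<partial>lborel) =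
      ennreal (norm k ^ 4) * (\<integral>\<^sup>+a. ennreal (u (0 + qcnj a * k) / norm (0 + qcnj a * k) ^ 4) \<partial>lborel)"
    by (rule nn_integral_similarity[OF linear_qcnj_mult]) (use k in \<open>auto simp: norm_mult norm_qcnj\<close>)
  also have "\<dots> = (\<integral>\<^sup>+a. ennreal (norm k ^ 4) * ennreal (u (0 + qcnj a * k) / norm (0 + qcnj a * k) ^ 4) \<partial>lborel)"
    by (rule nn_integral_cmult[symmetric]) measurable
  also have "\<dots> = (\<integral>\<^sup>+a. ennreal (u (qcnj a * k) / norm a ^ 4) \<partial>lborel)"
    using k u by (intro nn_integral_cong) (simp add: norm_mult norm_qcnj power_mult_distrib flip: ennreal_mult)
  finally show ?thesis by simp
qed

lemma integral_orbit:
  fixes u :: "quat \<Rightarrow> complex"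
  assumes [measurable]: "u \<in> borel_measurable borel" and k: "k \<noteq> 0"
  shows "(LINT a|lborel. u (qcnj a * k) / norm a ^ 4) = (LINT a|lborel. u a / norm a ^ 4)"
proof -
  have "(LINT a|lborel. u a / norm a ^ 4) =
      (norm k ^ 4) *\<^sub>R (LINT a|lborel. u (0 + qcnj a * k) / norm (0 + qcnj a * k) ^ 4)"
    by (rule integral_similarity[OF linear_qcnj_mult]) (use k in \<open>auto simp: norm_mult norm_qcnj\<close>)
  also have "\<dots> = complex_of_real (norm k ^ 4) * (LINT a|lborel. u (0 + qcnj a * k) / norm (0 + qcnj a * k) ^ 4)"
    by (simp add: scaleR_conv_of_real)
  also have "\<dots> = (LINT a|lborel. complex_of_real (norm k ^ 4) * (u (0 + qcnj a * k) / norm (0 + qcnj a * k) ^ 4))"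
    by (rule integral_mult_right_zero[symmetric])
  also have "\<dots> = (LINT a|lborel. u (qcnj a * k) / norm a ^ 4)"
    using k by (intro Bochner_Integration.integral_cong) (simp_all add: norm_mult norm_qcnj power_mult_distrib)
  finally show ?thesis by simp
qed

text \<open>Up to the factor (2 pi)^4, the squared norm of C f in terms of a transform F of f; for f
  in L^2 it is finite exactly when f is in the domain of C.\<close>

definition duflo_moore :: "(quat \<Rightarrow> complex) \<Rightarrow> ennreal" where
  "duflo_moore F = (\<integral>\<^sup>+k. ennreal ((norm (F k))\<^sup>2 / norm k ^ 4) \<partial>lborel)"

lemma coeff_kernel_norm:
  "1 / norm a ^ 8 * (norm (coeff_kernel F G a k))\<^sup>2 = (norm (G k))\<^sup>2 * ((norm (F (qcnj a * k)))\<^sup>2 / norm a ^ 4)"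
  by (cases "a = 0")
     (simp_all add: coeff_kernel_def norm_mult norm_power power_mult_distrib field_simps flip: power_mult power_add)

text \<open>Tonelli, so that a is integrated first: the inner integral is then the same number for
  all k \<noteq> 0, by the invariance of da/|a|^4.\<close>

lemma nn_integral_coeff_kernel:
  assumes [measurable]: "F \<in> borel_measurable borel" "G \<in> borel_measurable borel"
  shows "(\<integral>\<^sup>+a. \<integral>\<^sup>+k. ennreal (1 / norm a ^ 8 * (norm (coeff_kernel F G a k))\<^sup>2) \<partial>lborel \<partial>lborel)
    = sqnorm G * duflo_moore F"
proof -
  have "(\<integral>\<^sup>+a. \<integral>\<^sup>+k. ennreal (1 / norm a ^ 8 * (norm (coeff_kernel F G a k))\<^sup>2) \<partial>lborel \<partial>lborel)
     = (\<integral>\<^sup>+a. \<integral>\<^sup>+k. ennreal ((norm (G k))\<^sup>2 * ((norm (F (qcnj a * k)))\<^sup>2 / norm a ^ 4)) \<partial>lborel \<partial>lborel)"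
    by (simp only: coeff_kernel_norm)
  also have "\<dots> = (\<integral>\<^sup>+k. \<integral>\<^sup>+a. ennreal ((norm (G k))\<^sup>2 * ((norm (F (qcnj a * k)))\<^sup>2 / norm a ^ 4)) \<partial>lborel \<partial>lborel)"
    by (rule lborel_pair.Fubini'[symmetric]) measurable
  also have "\<dots> = (\<integral>\<^sup>+k. ennreal ((norm (G k))\<^sup>2) * duflo_moore F \<partial>lborel)"
  proof (rule nn_integral_cong_AE)
    have "AE k in lborel. k \<noteq> (0::quat)" by (rule AE_lborel_singleton)
    then show "AE k in lborel. (\<integral>\<^sup>+a. ennreal ((norm (G k))\<^sup>2 * ((norm (F (qcnj a * k)))\<^sup>2 / norm a ^ 4)) \<partial>lborel)
       = ennreal ((norm (G k))\<^sup>2) * duflo_moore F"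
    proof eventually_elim
      case (elim k)
      have "(\<integral>\<^sup>+a. ennreal ((norm (G k))\<^sup>2 * ((norm (F (qcnj a * k)))\<^sup>2 / norm a ^ 4)) \<partial>lborel)
        = (\<integral>\<^sup>+a. ennreal ((norm (G k))\<^sup>2) * ennreal ((norm (F (qcnj a * k)))\<^sup>2 / norm a ^ 4) \<partial>lborel)"
        by (intro nn_integral_cong) (simp add: ennreal_mult[symmetric])
      also have "\<dots> = ennreal ((norm (G k))\<^sup>2) * (\<integral>\<^sup>+a. ennreal ((norm (F (qcnj a * k)))\<^sup>2 / norm a ^ 4) \<partial>lborel)"
        by (rule nn_integral_cmult) measurable
      also have "(\<integral>\<^sup>+a. ennreal ((norm (F (qcnj a * k)))\<^sup>2 / norm a ^ 4) \<partial>lborel) = duflo_moore F"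
        unfolding duflo_moore_def by (rule nn_integral_orbit[where u="\<lambda>a. (norm (F a))\<^sup>2"]) (use elim in auto)
      finally show ?case .
    qed
  qed
  also have "\<dots> = sqnorm G * duflo_moore F"
    unfolding sqnorm_def nn_integral_completion by (rule nn_integral_multc) measurable
  finally show ?thesis .
qed

text \<open>A finite iterated integral has almost everywhere finite inner integrals. With
  \<open>coeff_kernel_integrable\<close> this puts almost every kernel in L^1 \<inter> L^2, where
  the isometry holds for \<open>fourier_L1\<close> itself.\<close>

lemma coeff_kernel_L2:
  assumes [measurable]: "F \<in> borel_measurable borel" "G \<in> borel_measurable borel"
    and L2: "G \<in> L2" and D: "duflo_moore F < \<infinity>"
  shows "AE a in lborel. a \<noteq> 0 \<and> coeff_kernel F G a \<in> L2"
proof -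
  have "(\<integral>\<^sup>+a. \<integral>\<^sup>+k. ennreal (1 / norm a ^ 8 * (norm (coeff_kernel F G a k))\<^sup>2) \<partial>lborel \<partial>lborel) < \<infinity>"
    unfolding nn_integral_coeff_kernel[OF assms(1,2)] using L2_finite[OF L2] D by (simp add: ennreal_mult_less_top)
  then have "AE a in lborel. (\<integral>\<^sup>+k. ennreal (1 / norm a ^ 8 * (norm (coeff_kernel F G a k))\<^sup>2) \<partial>lborel) \<noteq> \<infinity>"
    by (intro nn_integral_PInf_AE) (simp_all add: less_top)
  moreover have "AE a in lborel. a \<noteq> (0::quat)" by (rule AE_lborel_singleton)
  ultimately show ?thesis
  proof eventually_elim
    case (elim a)
    have "(\<integral>\<^sup>+k. ennreal (1 / norm a ^ 8 * (norm (coeff_kernel F G a k))\<^sup>2) \<partial>lborel)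
       = (\<integral>\<^sup>+k. ennreal (1 / norm a ^ 8) * ennreal ((norm (coeff_kernel F G a k))\<^sup>2) \<partial>lborel)"
      by (intro nn_integral_cong) (simp add: ennreal_mult[symmetric])
    also have "\<dots> = ennreal (1 / norm a ^ 8) * sqnorm (coeff_kernel F G a)"
      unfolding sqnorm_def nn_integral_completion by (rule nn_integral_cmult) measurable
    finally have "ennreal (1 / norm a ^ 8) * sqnorm (coeff_kernel F G a) < top" using elim(1) by (simp add: less_top)
    then have "sqnorm (coeff_kernel F G a) < top"
      using elim(2) by (auto simp: ennreal_mult_less_top)
    moreover have "coeff_kernel F G a \<in> borel_measurable lebesgue"
      by (intro borel_measurable_lebesgueI) measurable
    ultimately show ?case using elim(2) by (simp add: L2_iff)
  qed
qed

lemma coeff_kernel_integrable: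
  assumes "F \<in> L2" "G \<in> L2" "a \<noteq> 0"
  shows "integrable lebesgue (coeff_kernel F G a)"
proof -
  have "(\<lambda>k. F (0 + qcnj a * k)) \<in> L2"
    by (rule L2_similarity[OF linear_quat_mult_left _ _ assms(1), where c="norm a"])
       (use assms(3) in \<open>auto simp: norm_mult norm_qcnj\<close>)
  then have "(\<lambda>k. F (qcnj a * k)) \<in> L2" by simp
  then show ?thesis
    unfolding coeff_kernel_def by (intro integrable_mult_right integrable_pairing L2_cnj assms)
qed

text \<open>On the frequency side b occurs only in the phase, whose symmetry turns b into the
  variable of a transform. The constant undoes the normalization of
  \<open>fourier_L1\<close>.\<close>

lemma cip_Uc:
  assumes f: "f \<in> L2" "is_fourier_L2 f F" and g: "g \<in> L2" "is_fourier_L2 g G" and a: "a \<noteq> 0"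
  shows "cip g (Uc (b, a) f) = complex_of_real ((2 * pi)\<^sup>2) * fourier_L1 (coeff_kernel F G a) b"
proof -
  have "cip g (Uc (b, a) f) = cip G (\<lambda>k. complex_of_real ((norm a)\<^sup>2) * fker k b * F (qcnj a * k))"
    by (rule is_fourier_L2_cip[OF g Uc_L2[OF f(1)] is_fourier_L2_Uc[OF f a], symmetric])
  also have "\<dots> = (LINT k|lebesgue. fker b k * coeff_kernel F G a k)"
    unfolding cip_def coeff_kernel_def by (intro Bochner_Integration.integral_cong) (simp_all add: inner_commute mult_ac)
  finally show ?thesis by (simp add: fourier_L1_def)
qed

lemma Uc_coefficient_measurable:
  assumes [measurable]: "f \<in> borel_measurable borel" "g \<in> borel_measurable borel"
  shows "(\<lambda>p. cip g (Uc p f)) \<in> borel_measurable (lborel \<Otimes>\<^sub>M lborel)"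
proof -
  have "cip g (Uc p f) = (LINT x|lborel. cnj (g x) * Uc p f x)" for p
    unfolding cip_def Uc_def by (rule integral_completion) measurable
  then have "(\<lambda>p. cip g (Uc p f)) = (\<lambda>p. LINT x|lborel. cnj (g x) * Uc p f x)" by simp
  also have "\<dots> \<in> borel_measurable (lborel \<Otimes>\<^sub>M lborel)"
    unfolding Uc_def by measurable
  finally show ?thesis .
qed

text \<open>The diagonal case, carried out with nonnegative integrals. It supplies the integrability
  that Fubini requires for products of two different coefficients.\<close>

lemma Uc_coefficient_square_integrable:
  assumes [measurable]: "f \<in> borel_measurable borel" "g \<in> borel_measurable borel"
      "F \<in> borel_measurable borel" "G \<in> borel_measurable borel"
    and f: "f \<in> L2" "is_fourier_L2 f F" and g: "g \<in> L2" "is_fourier_L2 g G" and D: "duflo_moore F < \<infinity>"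
  shows "integrable (lborel \<Otimes>\<^sub>M lborel) (\<lambda>p. 1 / norm (snd p) ^ 8 * (norm (cip g (Uc p f)))\<^sup>2)"
proof (rule integrableI_bounded)
  note [measurable] = Uc_coefficient_measurable[OF assms(1,2)]
  note FL2 = is_fourier_L2_in_L2[OF f(2)] and GL2 = is_fourier_L2_in_L2[OF g(2)]
  let ?C = "ennreal ((2 * pi)^4)"
  show "(\<lambda>p. 1 / norm (snd p) ^ 8 * (norm (cip g (Uc p f)))\<^sup>2) \<in> borel_measurable (lborel \<Otimes>\<^sub>M lborel)"
    by measurable
  have "(\<integral>\<^sup>+p. ennreal (norm (1 / norm (snd p) ^ 8 * (norm (cip g (Uc p f)))\<^sup>2)) \<partial>(lborel \<Otimes>\<^sub>M lborel))
    = (\<integral>\<^sup>+a. \<integral>\<^sup>+b. ennreal (1 / norm a ^ 8 * (norm (cip g (Uc (b, a) f)))\<^sup>2) \<partial>lborel \<partial>lborel)"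
    by (subst lborel_pair.nn_integral_snd[symmetric]) simp_all
  also have "\<dots> = (\<integral>\<^sup>+a. ?C * (\<integral>\<^sup>+k. ennreal (1 / norm a ^ 8 * (norm (coeff_kernel F G a k))\<^sup>2) \<partial>lborel) \<partial>lborel)"
  proof (rule nn_integral_cong_AE)
    show "AE a in lborel. (\<integral>\<^sup>+b. ennreal (1 / norm a ^ 8 * (norm (cip g (Uc (b, a) f)))\<^sup>2) \<partial>lborel)
      = ?C * (\<integral>\<^sup>+k. ennreal (1 / norm a ^ 8 * (norm (coeff_kernel F G a k))\<^sup>2) \<partial>lborel)"
      using coeff_kernel_L2[OF assms(3,4) GL2 D]
    proof eventually_elim
      case (elim a)
      then have a: "a \<noteq> 0" by simp
      note int = coeff_kernel_integrable[OF FL2 GL2 a]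
      have [measurable]: "fourier_L1 (coeff_kernel F G a) \<in> borel_measurable borel"
        by (rule fourier_L1_measurable[OF int])
      have "(\<integral>\<^sup>+b. ennreal (1 / norm a ^ 8 * (norm (cip g (Uc (b, a) f)))\<^sup>2) \<partial>lborel)
        = (\<integral>\<^sup>+b. ennreal ((2*pi)^4 / norm a ^ 8) * ennreal ((norm (fourier_L1 (coeff_kernel F G a) b))\<^sup>2) \<partial>lborel)"
        by (intro nn_integral_cong)
           (simp add: cip_Uc[OF f g a] norm_mult norm_power power_mult_distrib flip: ennreal_mult power_mult)
      also have "\<dots> = ennreal ((2*pi)^4 / norm a ^ 8) * sqnorm (fourier_L1 (coeff_kernel F G a))"
        unfolding sqnorm_def nn_integral_completion by (rule nn_integral_cmult) measurable
      also have "sqnorm (fourier_L1 (coeff_kernel F G a)) = sqnorm (coeff_kernel F G a)"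
        using elim int by (intro fourier_L1_isometry) auto
      also have "ennreal ((2*pi)^4 / norm a ^ 8) * sqnorm (coeff_kernel F G a) = ?C * (ennreal (1 / norm a ^ 8) * sqnorm (coeff_kernel F G a))"
        by (simp flip: ennreal_mult mult.assoc)
      also have "ennreal (1 / norm a ^ 8) * sqnorm (coeff_kernel F G a) = (\<integral>\<^sup>+k. ennreal (1 / norm a ^ 8) * ennreal ((norm (coeff_kernel F G a k))\<^sup>2) \<partial>lborel)"
        unfolding sqnorm_def nn_integral_completion by (rule nn_integral_cmult[symmetric]) measurable
      also have "\<dots> = (\<integral>\<^sup>+k. ennreal (1 / norm a ^ 8 * (norm (coeff_kernel F G a k))\<^sup>2) \<partial>lborel)"
        by (intro nn_integral_cong) (simp add: ennreal_mult[symmetric])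
      finally show ?case .
    qed
  qed
  also have "\<dots> = ?C * (\<integral>\<^sup>+a. \<integral>\<^sup>+k. ennreal (1 / norm a ^ 8 * (norm (coeff_kernel F G a k))\<^sup>2) \<partial>lborel \<partial>lborel)"
    by (rule nn_integral_cmult) measurable
  also have "\<dots> < \<infinity>"
    unfolding nn_integral_coeff_kernel[OF assms(3,4)] using L2_finite[OF GL2] D by (simp add: ennreal_mult_less_top)
  finally show "(\<integral>\<^sup>+p. ennreal (norm (1 / norm (snd p) ^ 8 * (norm (cip g (Uc p f)))\<^sup>2)) \<partial>(lborel \<Otimes>\<^sub>M lborel)) < \<infinity>" .
qed

lemma norm_mult_le_squares: "norm (x * y) \<le> (norm x)\<^sup>2 + (norm y)\<^sup>2" for x y :: complex
proof -
  have "2 * (norm x * norm y) \<le> (norm x)\<^sup>2 + (norm y)\<^sup>2"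
    using sum_squares_bound[of "norm x" "norm y"] by (simp add: mult.assoc)
  moreover have "0 \<le> norm x * norm y" by simp
  ultimately show ?thesis unfolding norm_mult by linarith
qed

text \<open>A product of two coefficients is dominated by the sum of their squares, and likewise for
  two kernels; both exchanges of the order of integration rest on this. Between them stands
  Plancherel in b for almost every fixed a.\<close>

lemma Uc_orthogonality_borel:
  assumes fb[measurable]: "f \<in> borel_measurable borel" "f' \<in> borel_measurable borel"
      "g \<in> borel_measurable borel" "h \<in> borel_measurable borel"
      "F \<in> borel_measurable borel" "F' \<in> borel_measurable borel"
      "G \<in> borel_measurable borel" "H \<in> borel_measurable borel"
    and f: "f \<in> L2" "is_fourier_L2 f F" and f': "f' \<in> L2" "is_fourier_L2 f' F'"
    and g: "g \<in> L2" "is_fourier_L2 g G" and h: "h \<in> L2" "is_fourier_L2 h H"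
    and D: "duflo_moore F < \<infinity>" "duflo_moore F' < \<infinity>"
  shows "integrable (lborel \<Otimes>\<^sub>M lborel) (\<lambda>p. (1 / norm (snd p) ^ 8) *\<^sub>R (cip g (Uc p f) * cip (Uc p f') h))" (is ?I)
    "(LINT p|(lborel \<Otimes>\<^sub>M lborel). (1 / norm (snd p) ^ 8) *\<^sub>R (cip g (Uc p f) * cip (Uc p f') h))
      = complex_of_real ((2*pi)^4) * (LINT a|lborel. cnj (F' a) * F a / norm a ^ 4) * cip g h" (is ?value)
proof -
  note [measurable] = Uc_coefficient_measurable[OF fb(1,3)] Uc_coefficient_measurable[OF fb(2,4)]
  note FL2 = is_fourier_L2_in_L2[OF f(2)] and GL2 = is_fourier_L2_in_L2[OF g(2)]
    and F'L2 = is_fourier_L2_in_L2[OF f'(2)] and HL2 = is_fourier_L2_in_L2[OF h(2)]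
  let ?P = "\<lambda>p. (1 / norm (snd p) ^ 8) *\<^sub>R (cip g (Uc p f) * cip (Uc p f') h)"
  let ?K = "coeff_kernel F G" and ?K' = "coeff_kernel F' H"
  let ?C = "complex_of_real ((2*pi)^4)"
  let ?E = "LINT a|lborel. cnj (F' a) * F a / norm a ^ 4"
  have [measurable]: "?P \<in> borel_measurable (lborel \<Otimes>\<^sub>M lborel)"
    unfolding cip_commute[of _ h] by measurable
  show I: ?I
  proof (rule Bochner_Integration.integrable_bound)
    show "integrable (lborel \<Otimes>\<^sub>M lborel) (\<lambda>p. 1 / norm (snd p) ^ 8 * (norm (cip g (Uc p f)))\<^sup>2 + 1 / norm (snd p) ^ 8 * (norm (cip h (Uc p f')))\<^sup>2)"
      by (intro Bochner_Integration.integrable_add Uc_coefficient_square_integrable[OF fb(1,3,5,7) f g D(1)]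
          Uc_coefficient_square_integrable[OF fb(2,4,6,8) f' h D(2)])
    show "AE p in lborel \<Otimes>\<^sub>M lborel. norm (?P p) \<le> norm (1 / norm (snd p) ^ 8 * (norm (cip g (Uc p f)))\<^sup>2 + 1 / norm (snd p) ^ 8 * (norm (cip h (Uc p f')))\<^sup>2)"
    proof (rule AE_I2)
      fix p :: "quat \<times> quat"
      have "norm (?P p) = 1 / norm (snd p) ^ 8 * norm (cip g (Uc p f) * cnj (cip h (Uc p f')))"
        by (simp add: cip_commute[of _ h])
      also have "\<dots> \<le> 1 / norm (snd p) ^ 8 * ((norm (cip g (Uc p f)))\<^sup>2 + (norm (cip h (Uc p f')))\<^sup>2)"
        using norm_mult_le_squares[of "cip g (Uc p f)" "cnj (cip h (Uc p f'))"] by (intro mult_left_mono) auto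
      finally show "norm (?P p) \<le> norm (1 / norm (snd p) ^ 8 * (norm (cip g (Uc p f)))\<^sup>2 + 1 / norm (snd p) ^ 8 * (norm (cip h (Uc p f')))\<^sup>2)"
        by (simp add: distrib_left)
    qed
  qed measurable
  have IK: "integrable (lborel \<Otimes>\<^sub>M lborel) (\<lambda>(a, k). 1 / norm a ^ 8 * (norm (coeff_kernel \<Phi> \<Gamma> a k))\<^sup>2)"
    if [measurable]: "\<Phi> \<in> borel_measurable borel" "\<Gamma> \<in> borel_measurable borel" and "\<Gamma> \<in> L2" "duflo_moore \<Phi> < \<infinity>" for \<Phi> \<Gamma>
  proof (rule integrableI_bounded)
    have "(\<integral>\<^sup>+p. ennreal (norm (case p of (a, k) \<Rightarrow> 1 / norm a ^ 8 * (norm (coeff_kernel \<Phi> \<Gamma> a k))\<^sup>2)) \<partial>(lborel \<Otimes>\<^sub>M lborel))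
      = (\<integral>\<^sup>+a. \<integral>\<^sup>+k. ennreal (1 / norm a ^ 8 * (norm (coeff_kernel \<Phi> \<Gamma> a k))\<^sup>2) \<partial>lborel \<partial>lborel)"
      by (subst lborel.nn_integral_fst[symmetric]) simp_all
    also have "\<dots> < \<infinity>"
      unfolding nn_integral_coeff_kernel[OF that(1,2)] using L2_finite[OF that(3)] that(4) by (simp add: ennreal_mult_less_top)
    finally show "(\<integral>\<^sup>+p. ennreal (norm (case p of (a, k) \<Rightarrow> 1 / norm a ^ 8 * (norm (coeff_kernel \<Phi> \<Gamma> a k))\<^sup>2)) \<partial>(lborel \<Otimes>\<^sub>M lborel)) < \<infinity>" .
  qed measurable
  \<comment> \<open>The integrand after Plancherel in b, with the constants (2 pi)^2 of both
    coefficients and the Haar density included.\<close>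
  let ?Q = "\<lambda>a k. ?C * ((cnj (?K' a k) * ?K a k) / norm a ^ 8)"
  have IQ: "integrable (lborel \<Otimes>\<^sub>M lborel) (case_prod ?Q)"
  proof -
    have "integrable (lborel \<Otimes>\<^sub>M lborel) (\<lambda>(a, k). (cnj (?K' a k) * ?K a k) / norm a ^ 8)"
    proof (rule Bochner_Integration.integrable_bound)
      show "integrable (lborel \<Otimes>\<^sub>M lborel) (\<lambda>p. (case p of (a, k) \<Rightarrow> 1 / norm a ^ 8 * (norm (?K' a k))\<^sup>2) + (case p of (a, k) \<Rightarrow> 1 / norm a ^ 8 * (norm (?K a k))\<^sup>2))"
        by (intro Bochner_Integration.integrable_add IK fb GL2 HL2 D)
      show "AE p in lborel \<Otimes>\<^sub>M lborel. norm (case p of (a, k) \<Rightarrow> (cnj (?K' a k) * ?K a k) / norm a ^ 8) \<le>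
        norm ((case p of (a, k) \<Rightarrow> 1 / norm a ^ 8 * (norm (?K' a k))\<^sup>2) + (case p of (a, k) \<Rightarrow> 1 / norm a ^ 8 * (norm (?K a k))\<^sup>2))"
      proof (rule AE_I2)
        fix p :: "quat \<times> quat"
        obtain a k where p: "p = (a, k)" by (cases p)
        have "norm (cnj (?K' a k) * ?K a k) / norm a ^ 8 \<le> ((norm (?K' a k))\<^sup>2 + (norm (?K a k))\<^sup>2) / norm a ^ 8"
          using norm_mult_le_squares[of "cnj (?K' a k)" "?K a k"] by (intro divide_right_mono) auto
        then show "norm (case p of (a, k) \<Rightarrow> (cnj (?K' a k) * ?K a k) / norm a ^ 8) \<le>
          norm ((case p of (a, k) \<Rightarrow> 1 / norm a ^ 8 * (norm (?K' a k))\<^sup>2) + (case p of (a, k) \<Rightarrow> 1 / norm a ^ 8 * (norm (?K a k))\<^sup>2))"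
          by (simp add: p norm_divide norm_power add_divide_distrib)
      qed
    qed measurable
    from integrable_mult_right[OF this, of ?C] show ?thesis by (simp add: case_prod_beta')
  qed
  have P: "case_prod (\<lambda>b a. ?P (b, a)) = ?P" by auto
  have "integrable (lborel \<Otimes>\<^sub>M lborel) (case_prod (\<lambda>b a. ?P (b, a)))" unfolding P by (rule I)
  then have "(LINT p|(lborel \<Otimes>\<^sub>M lborel). ?P p) = (LINT a|lborel. LINT b|lborel. ?P (b, a))"
    by (subst lborel_pair.integral_snd) (simp_all only: P)
  also have "\<dots> = (LINT a|lborel. LINT k|lborel. ?Q a k)"
  proof (rule integral_cong_AE)
    show "AE a in lborel. (LINT b|lborel. ?P (b, a)) = (LINT k|lborel. ?Q a k)"
      using coeff_kernel_L2[OF fb(5,7) GL2 D(1)] coeff_kernel_L2[OF fb(6,8) HL2 D(2)]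
    proof eventually_elim
      case (elim a)
      then have a: "a \<noteq> 0" by simp
      note int = coeff_kernel_integrable[OF FL2 GL2 a] and int' = coeff_kernel_integrable[OF F'L2 HL2 a]
      have [measurable]: "fourier_L1 (?K a) \<in> borel_measurable borel" "fourier_L1 (?K' a) \<in> borel_measurable borel"
        by (rule fourier_L1_measurable[OF int], rule fourier_L1_measurable[OF int'])
      have "(LINT b|lborel. ?P (b, a)) = (LINT b|lborel. ?C / norm a ^ 8 * (cnj (fourier_L1 (?K' a) b) * fourier_L1 (?K a) b))"
      proof (rule Bochner_Integration.integral_cong[OF refl])
        fix b
        show "?P (b, a) = ?C / norm a ^ 8 * (cnj (fourier_L1 (?K' a) b) * fourier_L1 (?K a) b)"
          unfolding cip_commute[of _ h] cip_Uc[OF f g a] cip_Uc[OF f' h a]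
          by (simp add: scaleR_conv_of_real power4_eq_xxxx power2_eq_square)
      qed
      also have "\<dots> = ?C / norm a ^ 8 * (LINT b|lborel. cnj (fourier_L1 (?K' a) b) * fourier_L1 (?K a) b)"
        by (rule integral_mult_right_zero)
      also have "(LINT b|lborel. cnj (fourier_L1 (?K' a) b) * fourier_L1 (?K a) b) = cip (fourier_L1 (?K' a)) (fourier_L1 (?K a))"
        unfolding cip_def by (rule integral_completion[symmetric]) measurable
      also have "\<dots> = cip (?K' a) (?K a)"
        using elim int int' by (intro is_fourier_L2_cip is_fourier_L2_fourier_L1) auto
      also have "\<dots> = (LINT k|lborel. cnj (?K' a k) * ?K a k)"
        unfolding cip_def by (rule integral_completion) measurable
      also have "?C / norm a ^ 8 * \<dots> = (LINT k|lborel. ?C / norm a ^ 8 * (cnj (?K' a k) * ?K a k))"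
        by (rule integral_mult_right_zero[symmetric])
      also have "\<dots> = (LINT k|lborel. ?Q a k)" by simp
      finally show ?case .
    qed
  qed measurable
  also have "\<dots> = (LINT k|lborel. LINT a|lborel. ?Q a k)"
    by (rule lborel_pair.Fubini_integral[OF IQ, symmetric])
  also have "\<dots> = (LINT k|lborel. ?C * ?E * (cnj (G k) * H k))"
  proof (rule integral_cong_AE)
    have "AE k in lborel. k \<noteq> (0::quat)" by (rule AE_lborel_singleton)
    then show "AE k in lborel. (LINT a|lborel. ?Q a k) = ?C * ?E * (cnj (G k) * H k)"
    proof eventually_elim
      case (elim k)
      let ?u = "\<lambda>a. cnj (F' a) * F a"
      have "(LINT a|lborel. ?Q a k) = (LINT a|lborel. ?C * (cnj (G k) * H k) * (?u (qcnj a * k) / norm a ^ 4))"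
      proof (rule Bochner_Integration.integral_cong[OF refl])
        fix a :: quat
        \<comment> \<open>At a = 0 both sides are 0 by the convention for division.\<close>
        have n: "complex_of_real ((norm a)\<^sup>2) * complex_of_real ((norm a)\<^sup>2) / complex_of_real (norm a ^ 8) = 1 / complex_of_real (norm a ^ 4)"
          by (cases "a = 0") (simp_all add: field_simps flip: power_add of_real_mult)
        have "?Q a k = ?C * (cnj (G k) * H k) * ?u (qcnj a * k) * (complex_of_real ((norm a)\<^sup>2) * complex_of_real ((norm a)\<^sup>2) / complex_of_real (norm a ^ 8))"
          by (simp add: coeff_kernel_def)
        also have "\<dots> = ?C * (cnj (G k) * H k) * (?u (qcnj a * k) / norm a ^ 4)"
          unfolding n by simp
        finally show "?Q a k = ?C * (cnj (G k) * H k) * (?u (qcnj a * k) / norm a ^ 4)" .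
      qed
      also have "\<dots> = ?C * (cnj (G k) * H k) * (LINT a|lborel. ?u (qcnj a * k) / norm a ^ 4)"
        by (rule integral_mult_right_zero)
      also have "(LINT a|lborel. ?u (qcnj a * k) / norm a ^ 4) = ?E"
        by (rule integral_orbit[where u="?u"]) (use elim in auto)
      finally show ?case by (simp add: mult_ac)
    qed
  qed measurable
  also have "\<dots> = ?C * ?E * (LINT k|lborel. cnj (G k) * H k)"
    by (rule integral_mult_right_zero)
  also have "(LINT k|lborel. cnj (G k) * H k) = cip G H"
    unfolding cip_def by (rule integral_completion[symmetric]) measurable
  also have "cip G H = cip g h" by (rule is_fourier_L2_cip[OF g h])
  finally show ?value .
qed

text \<open>Functions and transforms are replaced by Borel representatives; similarities preserve
  null sets, so the coefficients stay the same at every p. The weighted integral of the transforms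
  is then recognized as <C f'|C f> by the isometry.\<close>

lemma Uc_orthogonality:
  assumes f: "f \<in> C_domain" and f': "f' \<in> C_domain" and g: "g \<in> L2" and h: "h \<in> L2"
  shows "integrable haar_left (\<lambda>p. cip g (Uc p f) * cip (Uc p f') h)"
    "(LINT p|haar_left. cip g (Uc p f) * cip (Uc p f') h) = cip (Cop f') (Cop f) * cip g h"
proof -
  have fL2: "f \<in> L2" "f' \<in> L2" using f f' by (auto simp: C_domain_iff)
  have rep: "\<exists>u0 U0. u0 \<in> borel_measurable borel \<and> u0 \<in> L2 \<and> (AE x in lebesgue. u x = u0 x) \<and>
      U0 \<in> borel_measurable borel \<and> (AE k in lebesgue. fourier_L2 u k = U0 k) \<and> is_fourier_L2 u0 U0" if u: "u \<in> L2" for u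
  proof -
    obtain u0 where u0: "u0 \<in> borel_measurable borel" "u0 \<in> L2" "AE x in lebesgue. u x = u0 x"
      by (rule L2_representative[OF u])
    have FT: "is_fourier_L2 u (fourier_L2 u)" by (rule is_fourier_L2_fourier_L2[OF u])
    obtain U0 where U0: "U0 \<in> borel_measurable borel" "U0 \<in> L2" "AE x in lebesgue. fourier_L2 u x = U0 x"
      by (rule L2_representative[OF is_fourier_L2_in_L2[OF FT]])
    show ?thesis using u0 U0 is_fourier_L2_cong_AE[OF FT u0(3) U0(3)] by blast
  qed
  obtain f0 F where f0[measurable]: "f0 \<in> borel_measurable borel" "F \<in> borel_measurable borel"
    and f1: "f0 \<in> L2" "AE x in lebesgue. f x = f0 x" "AE k in lebesgue. fourier_L2 f k = F k" "is_fourier_L2 f0 F"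
    using rep[OF fL2(1)] by blast
  obtain f0' F' where f0'[measurable]: "f0' \<in> borel_measurable borel" "F' \<in> borel_measurable borel"
    and f1': "f0' \<in> L2" "AE x in lebesgue. f' x = f0' x" "AE k in lebesgue. fourier_L2 f' k = F' k" "is_fourier_L2 f0' F'"
    using rep[OF fL2(2)] by blast
  obtain g0 G where g0[measurable]: "g0 \<in> borel_measurable borel" "G \<in> borel_measurable borel"
    and g1: "g0 \<in> L2" "AE x in lebesgue. g x = g0 x" "is_fourier_L2 g0 G"
    using rep[OF g] by blast
  obtain h0 H where h0[measurable]: "h0 \<in> borel_measurable borel" "H \<in> borel_measurable borel"
    and h1: "h0 \<in> L2" "AE x in lebesgue. h x = h0 x" "is_fourier_L2 h0 H"
    using rep[OF h] by blast
  have D: "duflo_moore F < \<infinity>" if "u \<in> C_domain" "AE k in lebesgue. fourier_L2 u k = F k" for u F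
  proof -
    have "duflo_moore F = (\<integral>\<^sup>+k. ennreal ((norm (fourier_L2 u k))\<^sup>2 / norm k ^ 4) \<partial>lebesgue)"
      unfolding duflo_moore_def nn_integral_completion
      using that(2) unfolding AE_completion_iff by (intro nn_integral_cong_AE) (auto elim: eventually_mono)
    then show ?thesis using that(1) by (simp add: C_domain_iff)
  qed
  have W: "cip g (Uc p f) * cip (Uc p f') h = cip g0 (Uc p f0) * cip (Uc p f0') h0" for p
    using cip_cong_AE[OF g Uc_L2[OF fL2(1)] g1(2) Uc_cong_AE[OF f1(2)], of "fst p" "snd p"]
      cip_cong_AE[OF Uc_L2[OF fL2(2)] h Uc_cong_AE[OF f1'(2)] h1(2), of "fst p" "snd p"] by simp
  note orth = Uc_orthogonality_borel[OF f0(1) f0'(1) g0(1) h0(1) f0(2) f0'(2) g0(2) h0(2) f1(1,4) f1'(1,4) g1(1,3) h1(1,3)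
      D[OF f f1(3)] D[OF f' f1'(3)]]
  have [measurable]: "(\<lambda>p. cip g0 (Uc p f0) * cip (Uc p f0') h0) \<in> borel_measurable (lborel \<Otimes>\<^sub>M lborel)"
    unfolding cip_commute[of _ h0]
    using Uc_coefficient_measurable[OF f0(1) g0(1)] Uc_coefficient_measurable[OF f0'(1) h0(1)] by measurable
  show "integrable haar_left (\<lambda>p. cip g (Uc p f) * cip (Uc p f') h)"
    unfolding W using orth(1) by (subst integrable_haar_left) auto
  have "(LINT p|haar_left. cip g (Uc p f) * cip (Uc p f') h)
     = complex_of_real ((2*pi)^4) * (LINT a|lborel. cnj (F' a) * F a / norm a ^ 4) * cip g0 h0"
    unfolding W using orth(2) by (subst integral_haar_left) auto
  also have "cip g0 h0 = cip g h" by (rule cip_cong_AE[OF g h g1(2) h1(2), symmetric])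
  also have "complex_of_real ((2*pi)^4) * (LINT a|lborel. cnj (F' a) * F a / norm a ^ 4) = cip (Cop f') (Cop f)"
  proof -
    let ?m = "\<lambda>k::quat. complex_of_real ((2 * pi / norm k)\<^sup>2)"
    have FT: "is_fourier_L2 f F" "is_fourier_L2 f' F'"
      using is_fourier_L2_cong_AE[OF f1(4), of f F] is_fourier_L2_cong_AE[OF f1'(4), of f' F'] f1(2) f1'(2)
      by (auto simp: eq_commute)
    have "cip (Cop f') (Cop f) = cip (\<lambda>k. ?m k * F' k) (\<lambda>k. ?m k * F k)"
      by (rule is_fourier_L2_cip[OF Cop[OF f' FT(2)] Cop[OF f FT(1)], symmetric])
    also have "\<dots> = (LINT k|lborel. cnj (?m k * F' k) * (?m k * F k))"
      unfolding cip_def by (rule integral_completion) measurable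
    also have "\<dots> = (LINT k|lborel. complex_of_real ((2*pi)^4) * (cnj (F' k) * F k / norm k ^ 4))"
    proof (rule Bochner_Integration.integral_cong[OF refl])
      fix k :: quat
      have m: "?m k * ?m k = complex_of_real ((2*pi)^4 / norm k ^ 4)"
        unfolding of_real_mult[symmetric] by (simp add: power_divide power4_eq_xxxx power2_eq_square)
      have "cnj (?m k * F' k) * (?m k * F k) = (?m k * ?m k) * (cnj (F' k) * F k)"
        by (simp only: complex_cnj_mult complex_cnj_complex_of_real mult_ac)
      then show "cnj (?m k * F' k) * (?m k * F k) = complex_of_real ((2*pi)^4) * (cnj (F' k) * F k / norm k ^ 4)"
        unfolding m by simp
    qed
    also have "\<dots> = complex_of_real ((2*pi)^4) * (LINT a|lborel. cnj (F' a) * F a / norm a ^ 4)"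
      by (rule integral_mult_right_zero)
    finally show ?thesis by simp
  qed
  finally show "(LINT p|haar_left. cip g (Uc p f) * cip (Uc p f') h) = cip (Cop f') (Cop f) * cip g h" .
qed

section \<open>Quaternionic coefficients\<close>

lemma quat_of_simps [simp]:
  "QRe (quat_of z w) = Re z" "QIm1 (quat_of z w) = Im w" "QIm2 (quat_of z w) = Re w" "QIm3 (quat_of z w) = Im z"
  by (simp_all add: quat_of_def)

lemma linear_qz1: "linear qz1" and linear_qz2: "linear qz2"
  by (auto intro!: linearI simp: qz1_def qz2_def complex_eq_iff)

lemma quat_of_split: "quat_of z w = quat_of z 0 + quat_of 0 w"
  by (simp add: quat_eq_iff)

lemma bounded_linear_quat_of: "bounded_linear (\<lambda>z. quat_of z 0)" "bounded_linear (\<lambda>w. quat_of 0 w)"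
  by (auto intro!: linear_linear[THEN iffD2] linearI simp: quat_eq_iff simp flip: linear_conv_bounded_linear)

lemma has_bochner_integral_quat_of:
  assumes "has_bochner_integral M u z" "has_bochner_integral M v w"
  shows "has_bochner_integral M (\<lambda>x. quat_of (u x) (v x)) (quat_of z w)"
proof -
  have "has_bochner_integral M (\<lambda>x. quat_of (u x) 0 + quat_of 0 (v x)) (quat_of z 0 + quat_of 0 w)"
    by (intro has_bochner_integral_add has_bochner_integral_bounded_linear[OF bounded_linear_quat_of(1) assms(1)]
        has_bochner_integral_bounded_linear[OF bounded_linear_quat_of(2) assms(2)])
  then show ?thesis by (simp flip: quat_of_split)
qed

lemma norm_quat_components: "(norm q)\<^sup>2 = (norm (qz1 q))\<^sup>2 + (norm (qz2 q))\<^sup>2"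
  by (simp add: norm_quat_def qz1_def qz2_def cmod_power2)

lemma L2_components:
  assumes f: "f \<in> L2"
  shows "comp1 f \<in> L2" "comp2 f \<in> L2"
proof -
  note [measurable] = L2_measurable[OF f] linear_borel_measurable[OF linear_qz1] linear_borel_measurable[OF linear_qz2]
  have le: "sqnorm (comp1 f) \<le> sqnorm f" "sqnorm (comp2 f) \<le> sqnorm f"
    unfolding sqnorm_def
    by (intro nn_integral_mono ennreal_leI; simp add: norm_quat_components comp1_def comp2_def)+
  have "comp1 f \<in> borel_measurable lebesgue" "comp2 f \<in> borel_measurable lebesgue"
    unfolding comp1_def comp2_def by measurable
  then show "comp1 f \<in> L2" "comp2 f \<in> L2"
    using le L2_finite[OF f] by (auto simp: L2_iff intro: le_less_trans)
qed

lemma L2_quat_of: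
  assumes u: "u \<in> L2" and v: "v \<in> L2"
  shows "(\<lambda>x. quat_of (u x) (v x)) \<in> L2"
proof -
  note [measurable] = L2_measurable[OF u] L2_measurable[OF v]
    linear_borel_measurable[OF bounded_linear.linear[OF bounded_linear_quat_of(1)]]
    linear_borel_measurable[OF bounded_linear.linear[OF bounded_linear_quat_of(2)]]
  have m: "(\<lambda>x. quat_of (u x) 0) \<in> borel_measurable lebesgue" "(\<lambda>x. quat_of 0 (v x)) \<in> borel_measurable lebesgue"
    by measurable
  have "sqnorm (\<lambda>x. quat_of (u x) 0) = sqnorm u" "sqnorm (\<lambda>x. quat_of 0 (v x)) = sqnorm v"
    unfolding sqnorm_def by (simp_all add: norm_quat_components)
  with m have "(\<lambda>x. quat_of (u x) 0) \<in> L2" "(\<lambda>x. quat_of 0 (v x)) \<in> L2"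
    using L2_finite[OF u] L2_finite[OF v] by (simp_all add: L2_iff)
  then have "(\<lambda>x. quat_of (u x) 0 + quat_of 0 (v x)) \<in> L2" by (rule L2_add)
  then show ?thesis by (simp flip: quat_of_split)
qed

text \<open>The entries of p occur unconjugated in the second component, which is why complex inner
  products of conjugated functions appear in what follows.\<close>

lemma qcnj_mult_components:
  "qcnj p * q = quat_of (cnj (qz1 p) * qz1 q + cnj (qz2 p) * qz2 q) (qz1 p * qz2 q - qz2 p * qz1 q)"
  by (simp add: quat_eq_iff qcnj_def times_quat_def qz1_def qz2_def algebra_simps)

lemma quat_mult_components:
  "quat_of z w * quat_of z' w' = quat_of (z * z' - cnj w * w') (w * z' + cnj z * w')"
  by (simp add: quat_eq_iff times_quat_def algebra_simps)

abbreviation (input) ccnj :: "(quat \<Rightarrow> complex) \<Rightarrow> quat \<Rightarrow> complex" where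
  "ccnj f \<equiv> \<lambda>x. cnj (f x)"

lemma has_bochner_integral_cip:
  "f \<in> L2 \<Longrightarrow> g \<in> L2 \<Longrightarrow> has_bochner_integral lebesgue (\<lambda>x. cnj (f x) * g x) (cip f g)"
  unfolding cip_def by (rule has_bochner_integral_integrable[OF integrable_pairing(1)[OF L2_cnj]])

lemma has_bochner_integral_qip:
  assumes f: "f \<in> L2" and g: "g \<in> L2"
  shows "has_bochner_integral lebesgue (\<lambda>x. qcnj (f x) * g x)
    (quat_of (cip (comp1 f) (comp1 g) + cip (comp2 f) (comp2 g))
      (cip (ccnj (comp1 f)) (comp2 g) - cip (ccnj (comp2 f)) (comp1 g)))"
proof -
  note c = L2_components[OF f] L2_components[OF g]
  have "has_bochner_integral lebesgue (\<lambda>x. quat_of (cnj (comp1 f x) * comp1 g x + cnj (comp2 f x) * comp2 g x)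
      (cnj (cnj (comp1 f x)) * comp2 g x - cnj (cnj (comp2 f x)) * comp1 g x))
    (quat_of (cip (comp1 f) (comp1 g) + cip (comp2 f) (comp2 g))
      (cip (ccnj (comp1 f)) (comp2 g) - cip (ccnj (comp2 f)) (comp1 g)))"
    by (intro has_bochner_integral_quat_of has_bochner_integral_add has_bochner_integral_diff
        has_bochner_integral_cip L2_cnj c)
  then show ?thesis unfolding qcnj_mult_components by (simp add: comp1_def comp2_def)
qed

lemmas qip_components = has_bochner_integral_integral_eq[OF has_bochner_integral_qip, folded qip_def]

lemma U_components: "comp1 (U p f) = Uc p (comp1 f)" "comp2 (U p f) = Uc p (comp2 f)"
  by (auto simp: fun_eq_iff U_def Uc_def comp1_def comp2_def linear_scale[OF linear_qz1] linear_scale[OF linear_qz2]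
      scaleR_conv_of_real[where 'a=complex])

lemma L2_from_components:
  assumes "comp1 f \<in> L2" "comp2 f \<in> L2" shows "f \<in> L2"
  using L2_quat_of[OF assms] by (simp add: comp1_def comp2_def)

lemma U_L2: "f \<in> L2 \<Longrightarrow> U p f \<in> L2"
  using Uc_L2[OF L2_components(1), of f "fst p" "snd p"] Uc_L2[OF L2_components(2), of f "fst p" "snd p"]
  by (intro L2_from_components) (simp_all add: U_components)

lemma qip_mult_right:
  assumes f: "f \<in> L2" and g: "g \<in> L2"
  shows "qip f (\<lambda>x. g x * q) = qip f g * q"
proof -
  have "qip f (\<lambda>x. g x * q) = (LINT x|lebesgue. (qcnj (f x) * g x) * q)"
    by (simp add: qip_def mult.assoc)
  also have "\<dots> = qip f g * q"
    unfolding qip_def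
    by (rule Bochner_Integration.integral_mult_left) (use has_bochner_integral_qip[OF f g] in \<open>simp add: has_bochner_integral_iff\<close>)
  finally show ?thesis .
qed

lemma qip_rank_one:
  assumes "f \<in> L2" "f' \<in> L2" "g \<in> L2"
  shows "qip g (rank_one (U p f) (U p f') h) = qip g (U p f) * qip (U p f') h"
  unfolding rank_one_def by (rule qip_mult_right[OF assms(3) U_L2[OF assms(1)]])

lemma cip_ccnj_ccnj: "cip (ccnj f) (ccnj g) = cnj (cip f g)"
proof -
  have "cnj (cip f g) = (LINT x|lebesgue. cnj (cnj (f x) * g x))"
    unfolding cip_def by (rule Bochner_Integration.integral_cnj[symmetric])
  then show ?thesis by (simp add: cip_def)
qed

lemma cip_linear_right:
  assumes "g \<in> L2" "u \<in> L2" "v \<in> L2"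
  shows "cip g (\<lambda>x. a * u x + b * v x) = a * cip g u + b * cip g v"
proof -
  note i = integrable_pairing(1)[OF L2_cnj[OF assms(1)] assms(2)] integrable_pairing(1)[OF L2_cnj[OF assms(1)] assms(3)]
  have "cip g (\<lambda>x. a * u x + b * v x) = (LINT x|lebesgue. a * (cnj (g x) * u x) + b * (cnj (g x) * v x))"
    unfolding cip_def by (simp add: algebra_simps)
  also have "\<dots> = a * cip g u + b * cip g v"
    unfolding cip_def using i
    by (simp only: Bochner_Integration.integral_add integrable_mult_right integral_mult_right_zero)
  finally show ?thesis .
qed

section \<open>The multiplier q and the quaternionic orthogonality relation\<close>

lemma admissibleD:
  assumes "admissible f"
  shows "f \<in> L2" "comp1 f \<in> C_domain" "comp2 f \<in> C_domain"
  using assms by (auto simp: admissible_def)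

text \<open>For admissible f and f' this is the integral over x of
  \<open>bold_C f x * qcnj (bold_C f' x)\<close>, given by the first column of its matrix, which
  determines a quaternion.\<close>

definition C_gram :: "(quat \<Rightarrow> quat) \<Rightarrow> (quat \<Rightarrow> quat) \<Rightarrow> quat" where
  "C_gram f f' = quat_of
     (cip (Cop (comp1 f')) (Cop (comp1 f)) + cnj (cip (Cop (comp2 f')) (Cop (comp2 f))))
     (cip (Cop (comp1 f')) (Cop (comp2 f)) - cnj (cip (Cop (comp2 f')) (Cop (comp1 f))))"

lemma quat_mat_C_gram:
  "quat_mat (C_gram f f') = vector
              [vector [cip (Cop (comp1 f')) (Cop (comp1 f))
                         + cip (\<lambda>x. cnj (Cop (comp2 f') x)) (\<lambda>x. cnj (Cop (comp2 f) x)),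
                       cip (Cop (comp2 f')) (Cop (comp1 f))
                         - cip (\<lambda>x. cnj (Cop (comp1 f') x)) (\<lambda>x. cnj (Cop (comp2 f) x))],
               vector [cip (Cop (comp1 f')) (Cop (comp2 f))
                         - cip (\<lambda>x. cnj (Cop (comp2 f') x)) (\<lambda>x. cnj (Cop (comp1 f) x)),
                       cip (\<lambda>x. cnj (Cop (comp1 f') x)) (\<lambda>x. cnj (Cop (comp1 f) x))
                         + cip (Cop (comp2 f')) (Cop (comp2 f))]]"
  by (simp add: quat_mat_def C_gram_def cip_ccnj_ccnj)

lemma has_bochner_integral_cnj':
  "has_bochner_integral M f z \<Longrightarrow> has_bochner_integral M (\<lambda>x. cnj (f x)) (cnj z)"
  by (rule has_bochner_integral_bounded_linear[OF bounded_linear_cnj])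

lemma has_bochner_integral_Uc:
  assumes "f \<in> C_domain" "f' \<in> C_domain" "g \<in> L2" "h \<in> L2"
  shows "has_bochner_integral haar_left (\<lambda>p. cip g (Uc p f) * cip (Uc p f') h) (cip (Cop f') (Cop f) * cip g h)"
  using Uc_orthogonality[OF assms] by (simp add: has_bochner_integral_iff)

text \<open>Both sides are one real linear expression in sixteen complex terms, evaluated at
  products of complex coefficients and at the integrals of these products, so the group integral can
  be taken term by term.\<close>

lemma quaternionic_orthogonality:
  assumes f: "admissible f" and f': "admissible f'" and g: "g \<in> L2" and h: "h \<in> L2"
  shows "has_bochner_integral haar_left (\<lambda>p. qip g (U p f) * qip (U p f') h) (qip g (\<lambda>x. C_gram f f' * h x))"
proof -
  note fL2 = admissibleD(1)[OF f] and f'L2 = admissibleD(1)[OF f']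
  note dom = admissibleD(2,3)[OF f] admissibleD(2,3)[OF f']
  let ?f1 = "comp1 f" and ?f2 = "comp2 f" and ?e1 = "comp1 f'" and ?e2 = "comp2 f'"
  let ?g1 = "comp1 g" and ?g2 = "comp2 g" and ?h1 = "comp1 h" and ?h2 = "comp2 h"
  note gL2 = L2_components[OF g] and hL2 = L2_components[OF h]
  let ?t = "\<lambda>u v a b p. cip a (Uc p u) * cip (Uc p v) b"
  let ?k = "\<lambda>u v a b. cip (Cop v) (Cop u) * cip a b"
  \<comment> \<open>The terms are abstracted as a function t, so that the same expression can be
    instantiated with the products \<open>?t\<close> and with their integrals
    \<open>?k\<close>.\<close>
  let ?Z = "\<lambda>t. (t ?f1 ?e1 ?g1 ?h1 + t ?f1 ?e2 ?g1 ?h2 + (t ?f2 ?e1 ?g2 ?h1 + t ?f2 ?e2 ?g2 ?h2))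
      - cnj ((t ?f2 ?e1 (ccnj ?g1) (ccnj ?h2) - t ?f2 ?e2 (ccnj ?g1) (ccnj ?h1))
           - (t ?f1 ?e1 (ccnj ?g2) (ccnj ?h2) - t ?f1 ?e2 (ccnj ?g2) (ccnj ?h1)))"
  let ?W = "\<lambda>t. (t ?f2 ?e1 (ccnj ?g1) ?h1 + t ?f2 ?e2 (ccnj ?g1) ?h2 - (t ?f1 ?e1 (ccnj ?g2) ?h1 + t ?f1 ?e2 (ccnj ?g2) ?h2))
      + cnj ((t ?f1 ?e1 ?g1 (ccnj ?h2) - t ?f1 ?e2 ?g1 (ccnj ?h1))
           + (t ?f2 ?e1 ?g2 (ccnj ?h2) - t ?f2 ?e2 ?g2 (ccnj ?h1)))"
  have "has_bochner_integral haar_left (\<lambda>p. quat_of (?Z (\<lambda>u v a b. ?t u v a b p)) (?W (\<lambda>u v a b. ?t u v a b p)))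
      (quat_of (?Z ?k) (?W ?k))"
    by (intro has_bochner_integral_quat_of has_bochner_integral_add has_bochner_integral_diff
        has_bochner_integral_cnj' has_bochner_integral_Uc dom gL2 hL2 L2_cnj)
  moreover have "quat_of (?Z (\<lambda>u v a b. ?t u v a b p)) (?W (\<lambda>u v a b. ?t u v a b p)) = qip g (U p f) * qip (U p f') h" for p
  proof -
    \<comment> \<open>Conjugation is moved from the transformed component of f' onto the component
      of h, which may be any element of \<open>L2\<close>.\<close>
    have c: "cip (ccnj (Uc p u)) v = cnj (cip (Uc p u) (ccnj v))" for u v
      using cip_ccnj_ccnj[of "Uc p u" "ccnj v"] by simp
    show ?thesis
      unfolding qip_components[OF g U_L2[OF fL2]] qip_components[OF U_L2[OF f'L2] h] U_components
        quat_mult_components c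
      by (simp add: algebra_simps)
  qed
  moreover have "quat_of (?Z ?k) (?W ?k) = qip g (\<lambda>x. C_gram f f' * h x)"
  proof -
    let ?q = "C_gram f f'"
    have cm: "comp1 (\<lambda>x. ?q * h x) = (\<lambda>x. qz1 ?q * ?h1 x + (- cnj (qz2 ?q)) * ?h2 x)"
      "comp2 (\<lambda>x. ?q * h x) = (\<lambda>x. qz2 ?q * ?h1 x + cnj (qz1 ?q) * ?h2 x)"
      by (auto simp: comp1_def comp2_def times_quat_def qz1_def qz2_def complex_eq_iff algebra_simps)
    have qh: "(\<lambda>x. ?q * h x) \<in> L2"
      by (rule L2_from_components; unfold cm; intro L2_add L2_cmult hL2)
    have q: "qz1 ?q = cip (Cop ?e1) (Cop ?f1) + cnj (cip (Cop ?e2) (Cop ?f2))"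
      "qz2 ?q = cip (Cop ?e1) (Cop ?f2) - cnj (cip (Cop ?e2) (Cop ?f1))"
      by (simp_all add: C_gram_def)
    have c: "cip (ccnj u) v = cnj (cip u (ccnj v))" for u v
      using cip_ccnj_ccnj[of u "ccnj v"] by simp
    show ?thesis
      unfolding qip_components[OF g qh] cm cip_linear_right[OF gL2(1) hL2] cip_linear_right[OF gL2(2) hL2]
        cip_linear_right[OF L2_cnj[OF gL2(1)] hL2] cip_linear_right[OF L2_cnj[OF gL2(2)] hL2] q
      by (simp add: c algebra_simps)
  qed
  ultimately show ?thesis by simp
qed

lemma Cop_L2: "f \<in> C_domain \<Longrightarrow> Cop f \<in> L2"
  using Cop(1)[OF _ is_fourier_L2_fourier_L2] by (simp add: C_domain_iff)

text \<open>Injectivity of C: its multiplier has no zeros for k \<noteq> 0, and the transform is an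
  isometry.\<close>

lemma Cop_eq_0_imp:
  assumes f: "f \<in> C_domain" and z: "cip (Cop f) (Cop f) = 0"
  shows "AE x in lebesgue. f x = 0"
proof -
  have fL2: "f \<in> L2" using f by (simp add: C_domain_iff)
  note F = is_fourier_L2_fourier_L2[OF fL2]
  note C = Cop[OF f F]
  note FL2 = is_fourier_L2_in_L2[OF F]
  have "sqnorm (Cop f) = 0" by (simp add: sqnorm_eq_cip[OF C(1)] z)
  then have "sqnorm (\<lambda>k. complex_of_real ((2 * pi / norm k)\<^sup>2) * fourier_L2 f k) = 0"
    using is_fourier_L2_sqnorm[OF C] by simp
  then have "AE k in lebesgue. complex_of_real ((2 * pi / norm k)\<^sup>2) * fourier_L2 f k = 0"
    by (subst (asm) sqnorm_eq_0_iff[OF L2_measurable[OF is_fourier_L2_in_L2[OF C(2)]]])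
  moreover have "AE k in lebesgue. k \<noteq> (0::quat)"
    unfolding AE_completion_iff by (rule AE_lborel_singleton)
  ultimately have "AE k in lebesgue. fourier_L2 f k = 0"
    by eventually_elim auto
  then have "sqnorm (fourier_L2 f) = 0"
    by (subst sqnorm_eq_0_iff[OF L2_measurable[OF FL2]])
  then have "sqnorm f = 0" using is_fourier_L2_sqnorm[OF fL2 F] by simp
  then show ?thesis by (subst (asm) sqnorm_eq_0_iff[OF L2_measurable[OF fL2]])
qed

text \<open>For f = f' the off-diagonal entries cancel by Hermitian symmetry of the inner product,
  and both diagonal entries are the real number <C f1|C f1> + <C f2|C f2>. Injectivity of C makes it
  nonzero.\<close>

lemma qnorm_bold_C:
  assumes f: "admissible f"
  shows "C_gram f f = of_real ((qnorm (bold_C f))\<^sup>2)"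
    and "\<not> (AE x in lebesgue. f x = 0) \<Longrightarrow> qnorm (bold_C f) \<noteq> 0"
proof -
  note dom = admissibleD(2,3)[OF f]
  let ?a = "cip (Cop (comp1 f)) (Cop (comp1 f))" and ?b = "cip (Cop (comp2 f)) (Cop (comp2 f))"
  note C = Cop_L2[OF dom(1)] Cop_L2[OF dom(2)]
  have comps: "comp1 (bold_C f) = Cop (comp1 f)" "comp2 (bold_C f) = Cop (comp2 f)"
    by (auto simp: bold_C_def comp1_def[of "bold_C f"] comp2_def[of "bold_C f"])
  have L2: "bold_C f \<in> L2" by (rule L2_from_components) (simp_all add: comps C)
  have real: "cip u u = complex_of_real (Re (cip u u))" "Re (cip u u) \<ge> 0" for u
    by (simp_all add: cip_def complex_norm_square_integral)
  have q: "(qnorm (bold_C f))\<^sup>2 = Re ?a + Re ?b"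
    unfolding qnorm_def qip_components[OF L2 L2] comps using real(2) by simp
  have "qz1 (C_gram f f) = complex_of_real (Re ?a + Re ?b)"
    using real(1)[of "Cop (comp1 f)"] real(1)[of "Cop (comp2 f)"]
    by (simp add: C_gram_def) (metis complex_cnj_complex_of_real)
  moreover have "qz2 (C_gram f f) = 0"
    by (simp add: C_gram_def cip_commute[of "Cop (comp2 f)" "Cop (comp1 f)"])
  ultimately show "C_gram f f = of_real ((qnorm (bold_C f))\<^sup>2)"
    unfolding q by (simp add: quat_eq_iff qz1_def qz2_def complex_eq_iff of_real_def)
  assume nz: "\<not> (AE x in lebesgue. f x = 0)"
  show "qnorm (bold_C f) \<noteq> 0"
  proof
    assume "qnorm (bold_C f) = 0"
    then have "Re ?a + Re ?b = 0" using q by simp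
    then have "Re ?a = 0" "Re ?b = 0"
      using real(2)[of "Cop (comp1 f)"] real(2)[of "Cop (comp2 f)"] by auto
    then have "?a = 0" "?b = 0"
      using real(1)[of "Cop (comp1 f)"] real(1)[of "Cop (comp2 f)"] by simp_all
    then have "AE x in lebesgue. comp1 f x = 0" "AE x in lebesgue. comp2 f x = 0"
      using Cop_eq_0_imp dom by auto
    then have "AE x in lebesgue. f x = 0"
      by eventually_elim (simp add: comp1_def comp2_def qz1_def qz2_def quat_eq_iff complex_eq_iff)
    with nz show False ..
  qed
qed

text \<open>Integrability is claimed along with each value, since the Bochner integral of a
  non-integrable function is 0 by convention. As vectors are represented by functions, a nonzero
  vector is one that does not vanish almost everywhere. The quaternion q is unique because
  \<open>quat_mat\<close> is injective.\<close>

theorem mainTheorem3: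
  shows
    "(\<forall>f f'. admissible f \<and> admissible f' \<longrightarrow>
       (\<exists>q. quat_mat q = vector
              [vector [cip (Cop (comp1 f')) (Cop (comp1 f))
                         + cip (\<lambda>x. cnj (Cop (comp2 f') x)) (\<lambda>x. cnj (Cop (comp2 f) x)),
                       cip (Cop (comp2 f')) (Cop (comp1 f))
                         - cip (\<lambda>x. cnj (Cop (comp1 f') x)) (\<lambda>x. cnj (Cop (comp2 f) x))],
               vector [cip (Cop (comp1 f')) (Cop (comp2 f))
                         - cip (\<lambda>x. cnj (Cop (comp2 f') x)) (\<lambda>x. cnj (Cop (comp1 f) x)),
                       cip (\<lambda>x. cnj (Cop (comp1 f') x)) (\<lambda>x. cnj (Cop (comp1 f) x))
                         + cip (Cop (comp2 f')) (Cop (comp2 f))]] \<and>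
            (\<forall>g\<in>L2. \<forall>h\<in>L2.
               integrable haar_left (\<lambda>p. qip g (rank_one (U p f) (U p f') h)) \<and>
               (LINT p|haar_left. qip g (rank_one (U p f) (U p f') h)) = qip g (\<lambda>x. q * h x) \<and>
               integrable haar_left (\<lambda>p. qip g (U p f) * qip (U p f') h) \<and>
               (LINT p|haar_left. qip g (U p f) * qip (U p f') h) = qip g (\<lambda>x. q * h x)))) \<and>
     (\<forall>f. admissible f \<and> \<not> (AE x in lebesgue. f x = 0) \<longrightarrow>
       qnorm (bold_C f) \<noteq> 0 \<and>
       (\<forall>g\<in>L2. \<forall>h\<in>L2.
          integrable haar_left (\<lambda>p. qip g (rank_one (U p f) (U p f) h)) \<and>
          inverse ((qnorm (bold_C f))\<^sup>2) *\<^sub>R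
            (LINT p|haar_left. qip g (rank_one (U p f) (U p f) h)) = qip g h))"
proof -
  have orth: "integrable haar_left (\<lambda>p. qip g (U p f) * qip (U p f') h)"
    "(LINT p|haar_left. qip g (U p f) * qip (U p f') h) = qip g (\<lambda>x. C_gram f f' * h x)"
    "(\<lambda>p. qip g (rank_one (U p f) (U p f') h)) = (\<lambda>p. qip g (U p f) * qip (U p f') h)"
    if "admissible f" "admissible f'" "g \<in> L2" "h \<in> L2" for f f' g h
    using quaternionic_orthogonality[OF that] qip_rank_one[OF that(1,2)[THEN admissibleD(1)] that(3)]
    by (auto simp: has_bochner_integral_iff)
  show ?thesis
  proof (intro conjI allI impI ballI; elim conjE)
    fix f f' assume a: "admissible f" "admissible f'"
    show "\<exists>q. quat_mat q = vector
              [vector [cip (Cop (comp1 f')) (Cop (comp1 f))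
                         + cip (\<lambda>x. cnj (Cop (comp2 f') x)) (\<lambda>x. cnj (Cop (comp2 f) x)),
                       cip (Cop (comp2 f')) (Cop (comp1 f))
                         - cip (\<lambda>x. cnj (Cop (comp1 f') x)) (\<lambda>x. cnj (Cop (comp2 f) x))],
               vector [cip (Cop (comp1 f')) (Cop (comp2 f))
                         - cip (\<lambda>x. cnj (Cop (comp2 f') x)) (\<lambda>x. cnj (Cop (comp1 f) x)),
                       cip (\<lambda>x. cnj (Cop (comp1 f') x)) (\<lambda>x. cnj (Cop (comp1 f) x))
                         + cip (Cop (comp2 f')) (Cop (comp2 f))]] \<and>
            (\<forall>g\<in>L2. \<forall>h\<in>L2.
               integrable haar_left (\<lambda>p. qip g (rank_one (U p f) (U p f') h)) \<and>
               (LINT p|haar_left. qip g (rank_one (U p f) (U p f') h)) = qip g (\<lambda>x. q * h x) \<and>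
               integrable haar_left (\<lambda>p. qip g (U p f) * qip (U p f') h) \<and>
               (LINT p|haar_left. qip g (U p f) * qip (U p f') h) = qip g (\<lambda>x. q * h x))"
      using quat_mat_C_gram[of f f'] orth[OF a] by (intro exI[of _ "C_gram f f'"]) simp
  next
    fix f assume f: "admissible f" "\<not> (AE x in lebesgue. f x = 0)"
    show nz: "qnorm (bold_C f) \<noteq> 0" by (rule qnorm_bold_C(2)[OF f])
    fix g h :: "quat \<Rightarrow> quat" assume g: "g \<in> L2" and h: "h \<in> L2"
    note o = orth[OF f(1) f(1) g h]
    show "integrable haar_left (\<lambda>p. qip g (rank_one (U p f) (U p f) h))" unfolding o(3) by (rule o(1))
    let ?r = "(qnorm (bold_C f))\<^sup>2"
    \<comment> \<open>A real quaternion is central, so the left factor may be moved to the right,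
      where the inner product is linear over the quaternions.\<close>
    have "qip g (\<lambda>x. C_gram f f * h x) = qip g (\<lambda>x. h x * of_real ?r)"
      by (simp add: qnorm_bold_C(1)[OF f(1)] of_real_def)
    also have "\<dots> = ?r *\<^sub>R qip g h"
      unfolding qip_mult_right[OF g h] by (simp add: of_real_def)
    finally show "inverse ?r *\<^sub>R (LINT p|haar_left. qip g (rank_one (U p f) (U p f) h)) = qip g h"
      unfolding o(3) o(2) using nz by simp
  qed
qed

end
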